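(* Let $(X,\mu)$ be a discrete measure space and let $T\colon X\to X$ be a map such that $h_T\in L^\infty(\mu)$ and $G_T$ is connected and of one-cycle type with $\mathcal R\neq\varnothing$ (with notation $\kappa$, $v_0,\ldots,v_{\kappa-1}$, $\mathcal R$, $\omega_R$, $i_R$ as in the context). If $S_{\lambda_T}$ is $2$-isometric, then the following conditions are equivalent: (i) the Cauchy dual $S_{\lambda_T}'$ is subnormal; (ii) for every $m\in\{0,\ldots,\kappa-1\}$, $$\|S_{\lambda_T}'^{\,n}e_{v_m}\|^2=\int_{[0,1]}t^n\,\mathrm d\mu_{v_m}(t),\qquad n\in\{0,1,\ldots,\kappa-1\},$$ with $\mu_{v_m}=(1-\alpha_m)\delta_{\sqrt[\kappa]{D}}+\alpha_m\delta_1$, where $$D=\Lambda_{0,\kappa}'^{\,2}=\prod_{i=0}^{\kappa-1}c_{v_i}^2,\qquad \alpha_m=\frac{C_m}{1-D},\qquad C_m=\sum_{i=0}^{\kappa-1}c_{v_{(i+m)\bmod\kappa}}^2\,\Lambda_{m,i}'^{\,2}\sum_{\substack{R\in\mathcal R\\ i_R=(i+m)\bmod\kappa}}\lambda_{\omega_R}^2 .$$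
   Context: A discrete measure space is a pair $(X,\mu)$ with $X$ an at most countable (non-empty) set and $\mu\colon 2^X\to[0,\infty]$ a measure with $\mu(x):=\mu(\{x\})\in(0,\infty)$ for all $x\in X$. For $T\colon X\to X$ put $h_T(x)=\mu(T^{-1}(\{x\}))/\mu(x)$. The graph $G_T=(V_T,E_T)$ has $V_T=X$ and $E_T=\{(Tx,x):x\in X\}$. For $v\in V_T$ put $\lambda_v=\sqrt{\mu(v)}/\sqrt{\mu(Tv)}$. If $h_T\in L^\infty(\mu)$, then $S_{\lambda_T}$ is the bounded linear operator on the complex Hilbert space $\ell^2(V_T)$, with standard orthonormal basis $(e_v)_{v\in V_T}$, given by $S_{\lambda_T}e_u=\sum_{v\in V_T,\,Tv=u}\lambda_v e_v$. A graph is connected if any two distinct vertices can be joined by a finite sequence of vertices in which consecutive ones are joined by an edge in one direction or the other. A directed tree is a connected directed graph with every in-degree at most $1$ and no cycle (path $(u_0,\ldots,u_k)$, $k\ge1$, with $u_0=u_k$); its root, if it exists, is its unique vertex of in-degree $0$, and the tree is then called rooted. $G_T$ is of one-cycle type if: (a) there are $\kappa\ge1$ and distinct vertices $v_0,\ldots,v_{\kappa-1}\in V_T$ with $(v_j,v_{j+1})\in E_T$ for $0\le j\le\kappa-2$ and $(v_{\kappa-1},v_0)\in E_T$; (b) there is a partition $\mathcal R$ of $V_T\setminus\{v_0,\ldots,v_{\kappa-1}\}$ such that for every $R\in\mathcal R$ the graph $(R,E_T\cap(R\times R))$ is a rooted directed tree whose root $\omega_R$ has the property that there is exactly one $i_R\in\{0,\ldots,\kappa-1\}$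 with $(v_{i_R},\omega_R)\in E_T$. An operator $S\in\mathbf B(H)$ is $2$-isometric if $I-2S^*S+S^{*2}S^2=0$ (such an operator is left-invertible). The Cauchy dual of a left-invertible $S\in\mathbf B(H)$ is $S'=S(S^*S)^{-1}$. An operator $S\in\mathbf B(H)$ is subnormal if there are a Hilbert space $K\supset H$ and a normal operator $N\in\mathbf B(K)$ with $N|_H=S$. Put $c_v=\|S_{\lambda_T}e_v\|^{-2}$ for $v\in V_T$, and $$\Lambda_{m,i}'=\prod_{j=m+1}^{m+i}\lambda_{v_{j\bmod\kappa}}\,c_{v_{(j-1)\bmod\kappa}},\qquad 0\le m\le\kappa-1,\ i\ge0$$ (empty product $=1$). $\delta_x$ denotes the Dirac measure at $x$. *)

theory Defs
  imports "HOL-Analysis.Analysis" "HOL-Probability.Giry_Monad" "HOL-Library.Disjoint_Sets"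
begin

section \<open>Complex Hilbert spaces and their bounded operators\<close>

text \<open>
  Hilbert spaces are structures on carrier sets, so that one can quantify existentially
  over them. Operators are functions on the ambient type of which only the
  values on the carrier matter. The inner product is linear in the first argument.
\<close>

record 'v hilbert =
  hcarrier :: "'v set"
  hzero :: 'v
  hadd :: "'v \<Rightarrow> 'v \<Rightarrow> 'v"
  hscale :: "complex \<Rightarrow> 'v \<Rightarrow> 'v"
  hinner :: "'v \<Rightarrow> 'v \<Rightarrow> complex"

definition hdiff :: "'v hilbert \<Rightarrow> 'v \<Rightarrow> 'v \<Rightarrow> 'v" where
  "hdiff H x y = hadd H x (hscale H (- 1) y)"

definition hnorm :: "'v hilbert \<Rightarrow> 'v \<Rightarrow> real" where
  "hnorm H x = sqrt (Re (hinner H x x))"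

locale complex_hilbert =
  fixes H :: "'v hilbert"
  assumes zero_closed: "hzero H \<in> hcarrier H"
    and add_closed: "\<lbrakk>x \<in> hcarrier H; y \<in> hcarrier H\<rbrakk> \<Longrightarrow> hadd H x y \<in> hcarrier H"
    and scale_closed: "x \<in> hcarrier H \<Longrightarrow> hscale H a x \<in> hcarrier H"
    and add_assoc: "\<lbrakk>x \<in> hcarrier H; y \<in> hcarrier H; z \<in> hcarrier H\<rbrakk>
      \<Longrightarrow> hadd H (hadd H x y) z = hadd H x (hadd H y z)"
    and add_commute: "\<lbrakk>x \<in> hcarrier H; y \<in> hcarrier H\<rbrakk> \<Longrightarrow> hadd H x y = hadd H y x"
    and add_zero: "x \<in> hcarrier H \<Longrightarrow> hadd H x (hzero H) = x"
    and add_neg: "x \<in> hcarrier H \<Longrightarrow> hadd H x (hscale H (- 1) x) = hzero H"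
    and scale_one: "x \<in> hcarrier H \<Longrightarrow> hscale H 1 x = x"
    and scale_scale: "x \<in> hcarrier H \<Longrightarrow> hscale H a (hscale H b x) = hscale H (a * b) x"
    and scale_add_right: "\<lbrakk>x \<in> hcarrier H; y \<in> hcarrier H\<rbrakk>
      \<Longrightarrow> hscale H a (hadd H x y) = hadd H (hscale H a x) (hscale H a y)"
    and scale_add_left: "x \<in> hcarrier H
      \<Longrightarrow> hscale H (a + b) x = hadd H (hscale H a x) (hscale H b x)"
    and inner_add_left: "\<lbrakk>x \<in> hcarrier H; y \<in> hcarrier H; z \<in> hcarrier H\<rbrakk>
      \<Longrightarrow> hinner H (hadd H x y) z = hinner H x z + hinner H y z"
    and inner_scale_left: "\<lbrakk>x \<in> hcarrier H; y \<in> hcarrier H\<rbrakk>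
      \<Longrightarrow> hinner H (hscale H a x) y = a * hinner H x y"
    and inner_cnj: "\<lbrakk>x \<in> hcarrier H; y \<in> hcarrier H\<rbrakk> \<Longrightarrow> hinner H y x = cnj (hinner H x y)"
    and inner_nonneg: "x \<in> hcarrier H \<Longrightarrow> 0 \<le> Re (hinner H x x)"
    and inner_definite: "\<lbrakk>x \<in> hcarrier H; hinner H x x = 0\<rbrakk> \<Longrightarrow> x = hzero H"
    and complete: "\<lbrakk>\<And>n. s n \<in> hcarrier H;
        \<And>e. 0 < e \<Longrightarrow> \<exists>N. \<forall>m\<ge>N. \<forall>n\<ge>N. hnorm H (hdiff H (s m) (s n)) < e\<rbrakk>
      \<Longrightarrow> \<exists>l\<in>hcarrier H. (\<lambda>n. hnorm H (hdiff H (s n) l)) \<longlonglongrightarrow> 0"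

definition linear_map :: "'v hilbert \<Rightarrow> 'w hilbert \<Rightarrow> ('v \<Rightarrow> 'w) \<Rightarrow> bool" where
  "linear_map H K A \<longleftrightarrow>
     A \<in> hcarrier H \<rightarrow> hcarrier K \<and>
     (\<forall>x\<in>hcarrier H. \<forall>y\<in>hcarrier H. A (hadd H x y) = hadd K (A x) (A y)) \<and>
     (\<forall>a. \<forall>x\<in>hcarrier H. A (hscale H a x) = hscale K a (A x))"

definition bounded_op :: "'v hilbert \<Rightarrow> ('v \<Rightarrow> 'v) \<Rightarrow> bool" where
  "bounded_op H A \<longleftrightarrow>
     linear_map H H A \<and> (\<exists>C. \<forall>x\<in>hcarrier H. hnorm H (A x) \<le> C * hnorm H x)"

definition adj :: "'v hilbert \<Rightarrow> ('v \<Rightarrow> 'v) \<Rightarrow> 'v \<Rightarrow> 'v" where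
  "adj H A y = (THE z. z \<in> hcarrier H \<and> (\<forall>x\<in>hcarrier H. hinner H (A x) y = hinner H x z))"

definition normal_op :: "'v hilbert \<Rightarrow> ('v \<Rightarrow> 'v) \<Rightarrow> bool" where
  "normal_op H N \<longleftrightarrow> bounded_op H N \<and> (\<forall>x\<in>hcarrier H. adj H N (N x) = N (adj H N x))"

definition two_isometric :: "'v hilbert \<Rightarrow> ('v \<Rightarrow> 'v) \<Rightarrow> bool" where
  "two_isometric H S \<longleftrightarrow> bounded_op H S \<and>
     (\<forall>x\<in>hcarrier H.
        hadd H (hdiff H x (hscale H 2 (adj H S (S x)))) (adj H S (adj H S (S (S x)))) = hzero H)"

definition cauchy_dual :: "'v hilbert \<Rightarrow> ('v \<Rightarrow> 'v) \<Rightarrow> 'v \<Rightarrow> 'v" where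
  "cauchy_dual H S x = S (inv_into (hcarrier H) (\<lambda>y. adj H S (S y)) x)"

text \<open>
  \<open>normal_extension H S K \<iota> N\<close>: the isometry \<open>\<iota>\<close> identifies \<open>H\<close> with a subspace of
  the Hilbert space \<open>K\<close>, and the normal operator \<open>N\<close> on \<open>K\<close> extends \<open>S\<close>.
\<close>

definition normal_extension ::
  "'v hilbert \<Rightarrow> ('v \<Rightarrow> 'v) \<Rightarrow> 'w hilbert \<Rightarrow> ('v \<Rightarrow> 'w) \<Rightarrow> ('w \<Rightarrow> 'w) \<Rightarrow> bool" where
  "normal_extension H S K \<iota> N \<longleftrightarrow>
     complex_hilbert K \<and> linear_map H K \<iota> \<and>
     (\<forall>x\<in>hcarrier H. \<forall>y\<in>hcarrier H. hinner K (\<iota> x) (\<iota> y) = hinner H x y) \<and>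
     normal_op K N \<and> (\<forall>x\<in>hcarrier H. N (\<iota> x) = \<iota> (S x))"

text \<open>
  One cannot quantify existentially over the type that carries \<open>K\<close>. Fixing the type
  below loses nothing: see \<open>subnormalI\<close>, which accepts an extension \<open>K\<close> over any type.
\<close>

definition subnormal :: "'v hilbert \<Rightarrow> ('v \<Rightarrow> 'v) \<Rightarrow> bool" where
  "subnormal H S \<longleftrightarrow> bounded_op H S \<and>
     (\<exists>(K :: (nat \<times> 'v \<Rightarrow> complex) hilbert) \<iota> N. normal_extension H S K \<iota> N)"


section \<open>The space of square-summable functions\<close>

definition ell2 :: "'a set \<Rightarrow> ('a \<Rightarrow> complex) hilbert" where
  "ell2 X = \<lparr>
     hcarrier = {f. (\<forall>x. x \<notin> X \<longrightarrow> f x = 0) \<and> (\<lambda>x. (cmod (f x))\<^sup>2) summable_on X},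
     hzero = (\<lambda>x. 0),
     hadd = (\<lambda>f g x. f x + g x),
     hscale = (\<lambda>a f x. a * f x),
     hinner = (\<lambda>f g. \<Sum>\<^sub>\<infinity>x\<in>X. f x * cnj (g x))\<rparr>"

definition basis_vec :: "'a \<Rightarrow> 'a \<Rightarrow> complex" where
  "basis_vec u = (\<lambda>x. if x = u then 1 else 0)"


section \<open>Directed graphs\<close>

definition graph_connected :: "'a set \<Rightarrow> ('a \<times> 'a) set \<Rightarrow> bool" where
  "graph_connected V E \<longleftrightarrow> (\<forall>u\<in>V. \<forall>w\<in>V. (u, w) \<in> (E \<union> E\<inverse>)\<^sup>*)"

definition directed_tree :: "'a set \<Rightarrow> ('a \<times> 'a) set \<Rightarrow> bool" where
  "directed_tree V E \<longleftrightarrow>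
     V \<noteq> {} \<and> E \<subseteq> V \<times> V \<and> graph_connected V E \<and>
     (\<forall>u u' w. (u, w) \<in> E \<and> (u', w) \<in> E \<longrightarrow> u = u') \<and>
     acyclic E"

definition is_root :: "'a set \<Rightarrow> ('a \<times> 'a) set \<Rightarrow> 'a \<Rightarrow> bool" where
  "is_root V E w \<longleftrightarrow> w \<in> V \<and> (\<forall>u. (u, w) \<notin> E)"

definition rooted_directed_tree :: "'a set \<Rightarrow> ('a \<times> 'a) set \<Rightarrow> bool" where
  "rooted_directed_tree V E \<longleftrightarrow> directed_tree V E \<and> (\<exists>!w. is_root V E w)"

definition induced :: "('a \<times> 'a) set \<Rightarrow> 'a set \<Rightarrow> ('a \<times> 'a) set" where
  "induced E R = E \<inter> R \<times> R"

definition root_of :: "('a \<times> 'a) set \<Rightarrow> 'a set \<Rightarrow> 'a" where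
  "root_of E R = (THE w. is_root R (induced E R) w)"

definition one_cycle_type ::
  "'a set \<Rightarrow> ('a \<times> 'a) set \<Rightarrow> nat \<Rightarrow> (nat \<Rightarrow> 'a) \<Rightarrow> 'a set set \<Rightarrow> bool" where
  "one_cycle_type V E \<kappa> v \<R> \<longleftrightarrow>
     1 \<le> \<kappa> \<and> inj_on v {..<\<kappa>} \<and> v ` {..<\<kappa>} \<subseteq> V \<and>
     (\<forall>j. Suc j < \<kappa> \<longrightarrow> (v j, v (Suc j)) \<in> E) \<and> (v (\<kappa> - 1), v 0) \<in> E \<and>
     partition_on (V - v ` {..<\<kappa>}) \<R> \<and>
     (\<forall>R\<in>\<R>. rooted_directed_tree R (induced E R) \<and>
        (\<exists>!i. i < \<kappa> \<and> (v i, root_of E R) \<in> E))"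

definition attach_index :: "('a \<times> 'a) set \<Rightarrow> nat \<Rightarrow> (nat \<Rightarrow> 'a) \<Rightarrow> 'a set \<Rightarrow> nat" where
  "attach_index E \<kappa> v R = (THE i. i < \<kappa> \<and> (v i, root_of E R) \<in> E)"


section \<open>Self-maps of discrete measure spaces\<close>

definition discrete_measure_space :: "'a measure \<Rightarrow> bool" where
  "discrete_measure_space M \<longleftrightarrow>
     countable (space M) \<and> space M \<noteq> {} \<and> sets M = Pow (space M) \<and>
     (\<forall>x\<in>space M. 0 < emeasure M {x} \<and> emeasure M {x} < \<infinity>)"

definition h_fun :: "'a measure \<Rightarrow> ('a \<Rightarrow> 'a) \<Rightarrow> 'a \<Rightarrow> ennreal" where
  "h_fun M T x = emeasure M (T -` {x} \<inter> space M) / emeasure M {x}"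

definition ess_bounded :: "'a measure \<Rightarrow> ('a \<Rightarrow> ennreal) \<Rightarrow> bool" where
  "ess_bounded M h \<longleftrightarrow> h \<in> borel_measurable M \<and> (\<exists>C::real. AE x in M. h x \<le> ennreal C)"

definition edges :: "'a measure \<Rightarrow> ('a \<Rightarrow> 'a) \<Rightarrow> ('a \<times> 'a) set" where
  "edges M T = {(T x, x) | x. x \<in> space M}"

definition weight :: "'a measure \<Rightarrow> ('a \<Rightarrow> 'a) \<Rightarrow> 'a \<Rightarrow> real" where
  "weight M T x = sqrt (measure M {x}) / sqrt (measure M {T x})"

text \<open>
  The operator \<open>S\<^sub>\<lambda>\<close>; see \<open>shift_basis_vec\<close>, \<open>bounded_op_shift\<close> and \<open>shift_unique\<close> below:
  when \<open>h_fun M T\<close> is essentially bounded, it is the unique bounded operator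
  that maps the basis vector at \<open>u\<close> to the sum of \<open>\<lambda>\<^sub>x e\<^sub>x\<close> over all \<open>x\<close> with \<open>T x = u\<close>.
\<close>

definition shift :: "'a measure \<Rightarrow> ('a \<Rightarrow> 'a) \<Rightarrow> ('a \<Rightarrow> complex) \<Rightarrow> 'a \<Rightarrow> complex" where
  "shift M T f = (\<lambda>x. if x \<in> space M then complex_of_real (weight M T x) * f (T x) else 0)"

definition c_coeff :: "'a measure \<Rightarrow> ('a \<Rightarrow> 'a) \<Rightarrow> 'a \<Rightarrow> real" where
  "c_coeff M T u = 1 / (hnorm (ell2 (space M)) (shift M T (basis_vec u)))\<^sup>2"

definition Lam ::
  "'a measure \<Rightarrow> ('a \<Rightarrow> 'a) \<Rightarrow> nat \<Rightarrow> (nat \<Rightarrow> 'a) \<Rightarrow> nat \<Rightarrow> nat \<Rightarrow> real" where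
  "Lam M T \<kappa> v m i =
     (\<Prod>j=m+1..m+i. weight M T (v (j mod \<kappa>)) * c_coeff M T (v ((j - 1) mod \<kappa>)))"

definition D_const :: "'a measure \<Rightarrow> ('a \<Rightarrow> 'a) \<Rightarrow> nat \<Rightarrow> (nat \<Rightarrow> 'a) \<Rightarrow> real" where
  "D_const M T \<kappa> v = (Lam M T \<kappa> v 0 \<kappa>)\<^sup>2"

definition C_const ::
  "'a measure \<Rightarrow> ('a \<Rightarrow> 'a) \<Rightarrow> nat \<Rightarrow> (nat \<Rightarrow> 'a) \<Rightarrow> 'a set set \<Rightarrow> nat \<Rightarrow> real" where
  "C_const M T \<kappa> v \<R> m =
     (\<Sum>i=0..\<kappa>-1. (c_coeff M T (v ((i + m) mod \<kappa>)))\<^sup>2 * (Lam M T \<kappa> v m i)\<^sup>2 *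
        (\<Sum>\<^sub>\<infinity>R\<in>{R\<in>\<R>. attach_index (edges M T) \<kappa> v R = (i + m) mod \<kappa>}.
           (weight M T (root_of (edges M T) R))\<^sup>2))"

definition alpha_const ::
  "'a measure \<Rightarrow> ('a \<Rightarrow> 'a) \<Rightarrow> nat \<Rightarrow> (nat \<Rightarrow> 'a) \<Rightarrow> 'a set set \<Rightarrow> nat \<Rightarrow> real" where
  "alpha_const M T \<kappa> v \<R> m = C_const M T \<kappa> v \<R> m / (1 - D_const M T \<kappa> v)"

text \<open>
  The measure \<open>(1 - \<alpha>) \<delta>\<^sub>a + \<alpha> \<delta>\<^sub>b\<close>, for \<open>0 \<le> \<alpha> \<le> 1\<close>. When the shift is 2-isometric
  and \<open>D_const M T \<kappa> v < 1\<close>, the numbers \<open>alpha_const M T \<kappa> v \<R> m\<close> lie in this range, so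
  that \<open>ennreal\<close> truncates nothing.
\<close>

definition two_point_measure :: "real \<Rightarrow> real \<Rightarrow> real \<Rightarrow> real measure" where
  "two_point_measure \<alpha> a b = measure_of UNIV (sets borel)
     (\<lambda>A. ennreal (1 - \<alpha>) * emeasure (return borel a) A + ennreal \<alpha> * emeasure (return borel b) A)"


section \<open>Adjoints and normal extensions\<close>

context complex_hilbert
begin

lemma diff_closed: "\<lbrakk>x \<in> hcarrier H; y \<in> hcarrier H\<rbrakk> \<Longrightarrow> hdiff H x y \<in> hcarrier H"
  by (simp add: hdiff_def add_closed scale_closed)

lemmas closed = zero_closed add_closed scale_closed diff_closed

lemma inner_add_right:
  assumes "x \<in> hcarrier H" "y \<in> hcarrier H" "z \<in> hcarrier H"
  shows "hinner H z (hadd H x y) = hinner H z x + hinner H z y"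
  using assms by (simp add: inner_cnj[of _ z] inner_add_left closed)

lemma inner_scale_right:
  assumes "x \<in> hcarrier H" "y \<in> hcarrier H"
  shows "hinner H x (hscale H a y) = cnj a * hinner H x y"
  using assms by (simp add: inner_cnj[of _ x] inner_scale_left closed)

lemma inner_diff_left:
  assumes "x \<in> hcarrier H" "y \<in> hcarrier H" "z \<in> hcarrier H"
  shows "hinner H (hdiff H x y) z = hinner H x z - hinner H y z"
  using assms by (simp add: hdiff_def inner_add_left inner_scale_left closed)

lemma inner_diff_right:
  assumes "x \<in> hcarrier H" "y \<in> hcarrier H" "z \<in> hcarrier H"
  shows "hinner H z (hdiff H x y) = hinner H z x - hinner H z y"
  using assms by (simp add: hdiff_def inner_add_right inner_scale_right closed)

lemmas inner_simps = inner_add_left inner_add_right inner_scale_left inner_scale_right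
  inner_diff_left inner_diff_right

lemma inner_zero_left: "x \<in> hcarrier H \<Longrightarrow> hinner H (hzero H) x = 0"
  using inner_diff_left[of x x x] add_neg[of x] by (simp add: hdiff_def)

lemma norm_ge_0: "x \<in> hcarrier H \<Longrightarrow> 0 \<le> hnorm H x"
  by (simp add: hnorm_def inner_nonneg)

lemma norm_sq: "x \<in> hcarrier H \<Longrightarrow> (hnorm H x)\<^sup>2 = Re (hinner H x x)"
  by (simp add: hnorm_def inner_nonneg)

lemma inner_self: "x \<in> hcarrier H \<Longrightarrow> hinner H x x = complex_of_real ((hnorm H x)\<^sup>2)"
  using arg_cong[OF inner_cnj[of x x], of Im] by (simp add: norm_sq complex_eq_iff)

lemma diff_zero_imp_eq:
  assumes "x \<in> hcarrier H" "y \<in> hcarrier H" "hdiff H x y = hzero H"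
  shows "x = y"
proof -
  note sy = scale_closed[OF assms(2), of "-1"]
  have "x = hadd H x (hadd H (hscale H (-1) y) y)"
    by (simp only: add_commute[OF sy assms(2)] add_neg[OF assms(2)] add_zero[OF assms(1)])
  also have "\<dots> = hadd H (hdiff H x y) y"
    by (simp only: hdiff_def add_assoc[OF assms(1) sy assms(2)])
  also have "\<dots> = y"
    by (simp only: assms(3) add_commute[OF zero_closed assms(2)] add_zero[OF assms(2)])
  finally show ?thesis .
qed

lemma eq_if_inner_eq:
  assumes "y \<in> hcarrier H" "z \<in> hcarrier H"
    and "\<And>x. x \<in> hcarrier H \<Longrightarrow> hinner H x y = hinner H x z"
  shows "y = z"
proof -
  have "hinner H (hdiff H y z) (hdiff H y z) = 0"
    using inner_diff_right[OF assms(1,2) diff_closed[OF assms(1,2)]]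
      assms(3)[OF diff_closed[OF assms(1,2)]] by simp
  then show ?thesis
    by (intro diff_zero_imp_eq[OF assms(1,2)] inner_definite diff_closed assms(1,2))
qed

lemma cauchy_schwarz:
  assumes x: "x \<in> hcarrier H" and y: "y \<in> hcarrier H"
  shows "cmod (hinner H x y) \<le> hnorm H x * hnorm H y"
proof (cases "hinner H y y = 0")
  case True
  then have "y = hzero H" using y inner_definite by blast
  then have "hinner H x y = 0"
    using x inner_zero_left[of x] inner_cnj[of "hzero H" x] by (simp add: closed)
  then show ?thesis using norm_ge_0 x y by simp
next
  case False
  define c where "c = hinner H x y"
  define q where "q = (hnorm H y)\<^sup>2"
  have q: "q > 0" "hinner H y y = of_real q"
    using False inner_self[OF y] by (auto simp: q_def)
  define a where "a = c / of_real q"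
  have "0 \<le> Re (hinner H (hdiff H x (hscale H a y)) (hdiff H x (hscale H a y)))"
    using x y by (intro inner_nonneg closed)
  also have "hinner H (hdiff H x (hscale H a y)) (hdiff H x (hscale H a y))
      = hinner H x x - cnj a * c - a * (cnj c - cnj a * hinner H y y)"
    using x y by (simp add: inner_simps closed c_def inner_cnj[of x y] algebra_simps)
  also have "\<dots> = of_real ((hnorm H x)\<^sup>2) - c * cnj c / of_real q"
    using q by (simp add: a_def inner_self[OF x] q(2) field_simps)
  also have "c * cnj c = of_real ((cmod c)\<^sup>2)"
    by (simp only: complex_norm_square)
  finally have "0 \<le> (hnorm H x)\<^sup>2 - (cmod c)\<^sup>2 / q"
    by (simp flip: of_real_divide of_real_diff of_real_power)
  then have "(cmod c)\<^sup>2 \<le> (hnorm H x * hnorm H y)\<^sup>2"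
    using q by (simp add: q_def field_simps power_mult_distrib)
  then show ?thesis
    unfolding c_def using norm_ge_0 x y by (meson power2_le_imp_le mult_nonneg_nonneg)
qed

lemma inner_tendsto:
  assumes "\<And>n. s n \<in> hcarrier H" "l \<in> hcarrier H" "y \<in> hcarrier H"
    and lim: "(\<lambda>n. hnorm H (hdiff H (s n) l)) \<longlonglongrightarrow> 0"
  shows "(\<lambda>n. hinner H (s n) y) \<longlonglongrightarrow> hinner H l y"
proof -
  have "(\<lambda>n. hinner H (s n) y - hinner H l y) \<longlonglongrightarrow> 0"
  proof (rule Lim_null_comparison)
    show "(\<lambda>n. hnorm H (hdiff H (s n) l) * hnorm H y) \<longlonglongrightarrow> 0"
      using tendsto_mult_left_zero[OF lim] .
    show "\<forall>\<^sub>F n in sequentially. cmod (hinner H (s n) y - hinner H l y)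
        \<le> hnorm H (hdiff H (s n) l) * hnorm H y"
      using cauchy_schwarz[of "hdiff H (s _) l" y] assms
      by (intro always_eventually) (simp add: closed inner_diff_left)
  qed
  then show ?thesis by (simp add: LIM_zero_iff)
qed

lemma riesz:
  assumes add: "\<And>x y. \<lbrakk>x \<in> hcarrier H; y \<in> hcarrier H\<rbrakk> \<Longrightarrow> f (hadd H x y) = f x + f y"
    and scale: "\<And>a x. x \<in> hcarrier H \<Longrightarrow> f (hscale H a x) = a * f x"
    and bound: "\<And>x. x \<in> hcarrier H \<Longrightarrow> cmod (f x) \<le> C * hnorm H x"
  shows "\<exists>z\<in>hcarrier H. \<forall>x\<in>hcarrier H. f x = hinner H x z"
proof -
  define J where "J x = Re (hinner H x x) - 2 * Re (f x)" for x
  have J_bound: "- (C\<^sup>2) \<le> J x" if x: "x \<in> hcarrier H" for x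
  proof -
    have "Re (f x) \<le> C * hnorm H x"
      using bound[OF x] complex_Re_le_cmod order_trans by blast
    moreover have "0 \<le> (hnorm H x - C)\<^sup>2" by simp
    ultimately show ?thesis
      unfolding J_def norm_sq[OF x, symmetric] by (simp add: power2_diff algebra_simps)
  qed
  define d where "d = Inf (J ` hcarrier H)"
  have bdd: "bdd_below (J ` hcarrier H)"
    using J_bound by (auto intro!: bdd_belowI)
  have d_le: "d \<le> J x" if "x \<in> hcarrier H" for x
    unfolding d_def using bdd that by (auto intro: cInf_lower)
  have "\<exists>x\<in>hcarrier H. J x < d + 1 / real (Suc n)" for n
    using cInf_lessD[of "J ` hcarrier H" "d + 1 / real (Suc n)"] zero_closed
    by (auto simp: d_def)
  then obtain s where s: "\<And>n. s n \<in> hcarrier H" "\<And>n. J (s n) < d + 1 / real (Suc n)"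
    by metis
  have par: "Re (hinner H (hdiff H x y) (hdiff H x y)) \<le> 2 * (J x + J y - 2 * d)"
    if x: "x \<in> hcarrier H" and y: "y \<in> hcarrier H" for x y
  proof -
    have "d \<le> J (hscale H (1/2) (hadd H x y))"
      using x y by (intro d_le closed)
    then show ?thesis
      using x y by (simp add: J_def inner_simps closed add scale field_simps)
  qed
  have "\<exists>N. \<forall>m\<ge>N. \<forall>n\<ge>N. hnorm H (hdiff H (s m) (s n)) < e" if e: "0 < e" for e
  proof -
    obtain N where N: "inverse (real (Suc N)) < e\<^sup>2 / 4"
      using reals_Archimedean[of "e\<^sup>2 / 4"] e by auto
    have "hnorm H (hdiff H (s m) (s n)) < e" if mn: "m \<ge> N" "n \<ge> N" for m n
    proof -
      have *: "J (s k) < d + e\<^sup>2 / 4" if "k \<ge> N" for k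
      proof -
        have "1 / real (Suc k) \<le> inverse (real (Suc N))"
          using that by (simp add: field_simps)
        with s(2)[of k] N show ?thesis by simp
      qed
      have "Re (hinner H (hdiff H (s m) (s n)) (hdiff H (s m) (s n))) < e\<^sup>2"
        using par[OF s(1)[of m] s(1)[of n]] *[OF mn(1)] *[OF mn(2)] by argo
      then show ?thesis
        using e by (simp add: hnorm_def real_less_lsqrt)
    qed
    then show ?thesis by blast
  qed
  then obtain z where z: "z \<in> hcarrier H" "(\<lambda>n. hnorm H (hdiff H (s n) z)) \<longlonglongrightarrow> 0"
    using complete[of s] s(1) by blast
  have J_lim: "(\<lambda>n. J (s n)) \<longlonglongrightarrow> d"
  proof (rule tendsto_sandwich[of "\<lambda>n. d" _ _ "\<lambda>n. d + 1 / real (Suc n)"])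
    show "(\<lambda>n. d + 1 / real (Suc n)) \<longlonglongrightarrow> d"
      using tendsto_add[OF tendsto_const LIMSEQ_inverse_real_of_nat, of d]
      by (simp add: inverse_eq_divide)
    show "\<forall>\<^sub>F n in sequentially. d \<le> J (s n)"
      using d_le[OF s(1)] by simp
    show "\<forall>\<^sub>F n in sequentially. J (s n) \<le> d + 1 / real (Suc n)"
      using s(2) less_imp_le by (intro always_eventually) blast
  qed simp
  have Re_eq: "Re (f x) = Re (hinner H x z)" if x: "x \<in> hcarrier H" for x
  proof -
    define r where "r = Re (hinner H z x) - Re (f x)"
    have lim: "(\<lambda>n. Re (hinner H (s n) x)) \<longlonglongrightarrow> Re (hinner H z x)"
      using tendsto_Re[OF inner_tendsto[OF s(1) z(1) x z(2)]] .
    have quad: "0 \<le> 2 * t * r + t\<^sup>2 * Re (hinner H x x)" for t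
    proof -
      have "d \<le> J (s n) + (2 * t * (Re (hinner H (s n) x) - Re (f x)) + t\<^sup>2 * Re (hinner H x x))"
        for n
      proof -
        have "d \<le> J (hadd H (s n) (hscale H (of_real t) x))"
          using x s(1) by (intro d_le closed)
        also have "\<dots> = J (s n) + (2 * t * (Re (hinner H (s n) x) - Re (f x))
            + t\<^sup>2 * Re (hinner H x x))"
          unfolding J_def
          using x s(1)[of n] inner_cnj[OF s(1)[of n] x]
          by (simp add: inner_simps closed add scale) (simp add: power2_eq_square algebra_simps)
        finally show ?thesis .
      qed
      moreover have "(\<lambda>n. J (s n) + (2 * t * (Re (hinner H (s n) x) - Re (f x))
          + t\<^sup>2 * Re (hinner H x x))) \<longlonglongrightarrow> d + (2 * t * r + t\<^sup>2 * Re (hinner H x x))"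
        unfolding r_def by (intro tendsto_intros J_lim lim)
      ultimately have "d \<le> d + (2 * t * r + t\<^sup>2 * Re (hinner H x x))"
        by (intro LIMSEQ_le_const) auto
      then show ?thesis by simp
    qed
    define b where "b = Re (hinner H x x) + 1"
    have b: "b > 0" "Re (hinner H x x) < b"
      using inner_nonneg[OF x] by (auto simp: b_def)
    have "0 \<le> 2 * (- r / b) * r + (- r / b)\<^sup>2 * Re (hinner H x x)"
      by (rule quad)
    also have "\<dots> \<le> 2 * (- r / b) * r + (- r / b)\<^sup>2 * b"
      using b by (intro add_left_mono mult_left_mono) auto
    also have "\<dots> = - (r\<^sup>2 / b)"
      using b by (simp add: field_simps power2_eq_square)
    finally have "r = 0"
      using b by (simp add: divide_le_0_iff zero_le_divide_iff)
    then show ?thesis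
      using inner_cnj[OF x z(1)] by (simp add: r_def)
  qed
  have "f x = hinner H x z" if x: "x \<in> hcarrier H" for x
  proof (rule complex_eqI)
    show "Re (f x) = Re (hinner H x z)" using Re_eq[OF x] .
    show "Im (f x) = Im (hinner H x z)"
      using Re_eq[of "hscale H \<i> x"] x z(1) by (simp add: scale closed inner_scale_left)
  qed
  then show ?thesis using z(1) by blast
qed

lemma adj_eqI:
  assumes "y \<in> hcarrier H" "z \<in> hcarrier H"
    and "\<And>x. x \<in> hcarrier H \<Longrightarrow> hinner H (A x) y = hinner H x z"
  shows "adj H A y = z"
  unfolding adj_def
proof (rule the_equality)
  fix z' assume z': "z' \<in> hcarrier H \<and> (\<forall>x\<in>hcarrier H. hinner H (A x) y = hinner H x z')"
  show "z' = z" using assms z' by (intro eq_if_inner_eq) auto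
qed (use assms in auto)

lemma adj_exists:
  assumes "bounded_op H A" "y \<in> hcarrier H"
  shows adj_closed: "adj H A y \<in> hcarrier H"
    and inner_adj: "x \<in> hcarrier H \<Longrightarrow> hinner H (A x) y = hinner H x (adj H A y)"
proof -
  obtain C where C: "\<And>x. x \<in> hcarrier H \<Longrightarrow> hnorm H (A x) \<le> C * hnorm H x"
    using assms by (auto simp: bounded_op_def)
  have A: "\<And>x. x \<in> hcarrier H \<Longrightarrow> A x \<in> hcarrier H"
    using assms by (auto simp: bounded_op_def linear_map_def)
  have "\<exists>z\<in>hcarrier H. \<forall>x\<in>hcarrier H. hinner H (A x) y = hinner H x z"
  proof (rule riesz[where C = "C * hnorm H y"])
    fix x assume x: "x \<in> hcarrier H"
    have "cmod (hinner H (A x) y) \<le> hnorm H (A x) * hnorm H y"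
      using cauchy_schwarz[OF A[OF x] assms(2)] .
    also have "\<dots> \<le> C * hnorm H x * hnorm H y"
      using C[OF x] norm_ge_0[OF assms(2)] by (intro mult_right_mono)
    finally show "cmod (hinner H (A x) y) \<le> C * hnorm H y * hnorm H x"
      by (simp add: algebra_simps)
  qed (use assms A in \<open>auto simp: bounded_op_def linear_map_def inner_simps\<close>)
  then obtain z where z: "z \<in> hcarrier H" "\<forall>x\<in>hcarrier H. hinner H (A x) y = hinner H x z"
    by blast
  then have "adj H A y = z" using assms by (intro adj_eqI) auto
  with z show "adj H A y \<in> hcarrier H"
    and "x \<in> hcarrier H \<Longrightarrow> hinner H (A x) y = hinner H x (adj H A y)" by auto
qed

lemma inner_adj':
  assumes "bounded_op H A" "x \<in> hcarrier H" "y \<in> hcarrier H"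
  shows "hinner H (adj H A x) y = hinner H x (A y)"
proof -
  have "A y \<in> hcarrier H" using assms by (auto simp: bounded_op_def linear_map_def)
  then show ?thesis
    using inner_adj[OF assms(1,2,3)] inner_cnj[OF assms(3) adj_closed[OF assms(1,2)]]
      inner_cnj[of "A y" x] assms by simp
qed

end

lemma complex_hilbert_transport:
  fixes K :: "'w hilbert" and \<phi> :: "'w \<Rightarrow> 'u"
  assumes K: "complex_hilbert K" and Z: "Z \<subseteq> hcarrier K"
  defines "K0 \<equiv> {k \<in> hcarrier K. \<forall>z\<in>Z. hinner K k z = 0}"
  assumes inj: "inj_on \<phi> K0"
  defines "\<psi> \<equiv> inv_into K0 \<phi>"
  defines "K' \<equiv> \<lparr>hcarrier = \<phi> ` K0, hzero = \<phi> (hzero K),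
     hadd = (\<lambda>f g. \<phi> (hadd K (\<psi> f) (\<psi> g))), hscale = (\<lambda>a f. \<phi> (hscale K a (\<psi> f))),
     hinner = (\<lambda>f g. hinner K (\<psi> f) (\<psi> g))\<rparr>"
  shows "complex_hilbert K'"
proof -
  interpret K: complex_hilbert K by (rule K)
  have [simp]: "\<psi> (\<phi> a) = a" if "a \<in> K0" for a
    using that inj by (simp add: \<psi>_def)
  have sub: "a \<in> hcarrier K" if "a \<in> K0" for a
    using that by (simp add: K0_def)
  have cl [simp]: "hzero K \<in> K0" "\<And>a b. \<lbrakk>a \<in> K0; b \<in> K0\<rbrakk> \<Longrightarrow> hadd K a b \<in> K0"
    "\<And>c a. a \<in> K0 \<Longrightarrow> hscale K c a \<in> K0"
    using Z by (auto simp: K0_def K.closed K.inner_simps K.inner_zero_left subset_iff)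
  have K' [simp]: "hcarrier K' = \<phi> ` K0" "hzero K' = \<phi> (hzero K)"
    "\<And>f g. hadd K' f g = \<phi> (hadd K (\<psi> f) (\<psi> g))" "\<And>a f. hscale K' a f = \<phi> (hscale K a (\<psi> f))"
    "\<And>f g. hinner K' f g = hinner K (\<psi> f) (\<psi> g)"
    by (simp_all add: K'_def)
  show ?thesis
  proof (unfold_locales; (unfold K')?)
    fix f g h a b assume fgh: "f \<in> \<phi> ` K0"
    show "\<phi> (hscale K a (\<psi> f)) \<in> \<phi> ` K0" using fgh by auto
    show "\<phi> (hadd K (\<psi> f) (\<psi> (\<phi> (hzero K)))) = f" using fgh by (auto simp: K.add_zero sub)
    show "\<phi> (hadd K (\<psi> f) (\<psi> (\<phi> (hscale K (- 1) (\<psi> f))))) = \<phi> (hzero K)"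
      using fgh by (auto simp: K.add_neg sub)
    show "\<phi> (hscale K 1 (\<psi> f)) = f" using fgh by (auto simp: K.scale_one sub)
    show "\<phi> (hscale K a (\<psi> (\<phi> (hscale K b (\<psi> f))))) = \<phi> (hscale K (a * b) (\<psi> f))"
      using fgh by (auto simp: K.scale_scale sub)
    show "\<phi> (hscale K (a + b) (\<psi> f)) =
        \<phi> (hadd K (\<psi> (\<phi> (hscale K a (\<psi> f)))) (\<psi> (\<phi> (hscale K b (\<psi> f)))))"
      using fgh by (auto simp: K.scale_add_left sub)
    show "0 \<le> Re (hinner K (\<psi> f) (\<psi> f))" using fgh K.inner_nonneg sub by force
    show "f = \<phi> (hzero K)" if "hinner K (\<psi> f) (\<psi> f) = 0"
    proof -
      obtain x where x: "x \<in> K0" "f = \<phi> x" using fgh by blast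
      then have "x = hzero K" using that by (intro K.inner_definite sub) auto
      then show ?thesis using x by simp
    qed
    assume g: "g \<in> \<phi> ` K0"
    show "\<phi> (hadd K (\<psi> f) (\<psi> g)) \<in> \<phi> ` K0" using fgh g by auto
    show "\<phi> (hadd K (\<psi> f) (\<psi> g)) = \<phi> (hadd K (\<psi> g) (\<psi> f))"
    proof -
      have "\<psi> f \<in> hcarrier K" "\<psi> g \<in> hcarrier K" using fgh g sub by auto
      then show ?thesis using K.add_commute by metis
    qed
    show "\<phi> (hscale K a (\<psi> (\<phi> (hadd K (\<psi> f) (\<psi> g))))) =
        \<phi> (hadd K (\<psi> (\<phi> (hscale K a (\<psi> f)))) (\<psi> (\<phi> (hscale K a (\<psi> g)))))"
      using fgh g by (auto simp: K.scale_add_right sub)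
    show "hinner K (\<psi> (\<phi> (hscale K a (\<psi> f)))) (\<psi> g) = a * hinner K (\<psi> f) (\<psi> g)"
      using fgh g by (auto simp: K.inner_scale_left sub)
    show "hinner K (\<psi> g) (\<psi> f) = cnj (hinner K (\<psi> f) (\<psi> g))"
    proof -
      have "\<psi> f \<in> hcarrier K" "\<psi> g \<in> hcarrier K" using fgh g sub by auto
      then show ?thesis by (rule K.inner_cnj)
    qed
    assume h: "h \<in> \<phi> ` K0"
    show "\<phi> (hadd K (\<psi> (\<phi> (hadd K (\<psi> f) (\<psi> g)))) (\<psi> h)) =
        \<phi> (hadd K (\<psi> f) (\<psi> (\<phi> (hadd K (\<psi> g) (\<psi> h)))))"
      using fgh g h by (auto simp: K.add_assoc sub)
    show "hinner K (\<psi> (\<phi> (hadd K (\<psi> f) (\<psi> g)))) (\<psi> h) =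
        hinner K (\<psi> f) (\<psi> h) + hinner K (\<psi> g) (\<psi> h)"
      using fgh g h by (auto simp: K.inner_add_left sub)
  next
    fix s :: "nat \<Rightarrow> 'u"
    assume s: "\<And>n. s n \<in> \<phi> ` K0"
      and cauchy: "\<And>e. 0 < e \<Longrightarrow> \<exists>N. \<forall>m\<ge>N. \<forall>n\<ge>N. hnorm K' (hdiff K' (s m) (s n)) < e"
    define t where "t n = \<psi> (s n)" for n
    have t: "t n \<in> K0" "s n = \<phi> (t n)" for n
      using s[of n] by (auto simp: t_def)
    have norm: "hnorm K' (hdiff K' (\<phi> a) (\<phi> b)) = hnorm K (hdiff K a b)"
      if "a \<in> K0" "b \<in> K0" for a b
      using that by (simp add: hnorm_def hdiff_def)
    have "\<exists>l\<in>hcarrier K. (\<lambda>n. hnorm K (hdiff K (t n) l)) \<longlonglongrightarrow> 0"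
      using cauchy by (intro K.complete) (simp_all add: t norm sub)
    then obtain l where l: "l \<in> hcarrier K" "(\<lambda>n. hnorm K (hdiff K (t n) l)) \<longlonglongrightarrow> 0"
      by blast
    have "hinner K l z = 0" if "z \<in> Z" for z
    proof -
      have "(\<lambda>n. hinner K (t n) z) \<longlonglongrightarrow> hinner K l z"
        using that Z l t sub by (intro K.inner_tendsto) auto
      moreover have "(\<lambda>n. hinner K (t n) z) = (\<lambda>n. 0)"
        using t that by (auto simp: K0_def)
      ultimately show ?thesis by (simp add: LIMSEQ_const_iff)
    qed
    then have "l \<in> K0" using l by (simp add: K0_def)
    then have "(\<lambda>n. hnorm K' (hdiff K' (s n) (\<phi> l))) \<longlonglongrightarrow> 0"
      using l(2) t by (simp add: norm)
    then show "\<exists>l\<in>\<phi> ` K0. (\<lambda>n. hnorm K' (hdiff K' (s n) l)) \<longlonglongrightarrow> 0"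
      using \<open>l \<in> K0\<close> by blast
  qed (use cl in auto)
qed

text \<open>
  The vectors \<open>N\<^sup>*\<^sup>n (\<iota> h)\<close> generate a reducing subspace for \<open>N\<close> that contains the range of \<open>\<iota>\<close>;
  a vector in it is determined by its inner products with the generators.
\<close>

lemma subnormalI:
  fixes H :: "'v hilbert" and K :: "'w hilbert"
  assumes S: "bounded_op H S" and ext: "normal_extension H S K \<iota> N"
  shows "subnormal H S"
proof -
  have K: "complex_hilbert K" and \<iota>: "linear_map H K \<iota>" and N: "normal_op K N" "bounded_op K N"
    and \<iota>_inner: "\<And>x y. \<lbrakk>x \<in> hcarrier H; y \<in> hcarrier H\<rbrakk> \<Longrightarrow> hinner K (\<iota> x) (\<iota> y) = hinner H x y"
    and N\<iota>: "\<And>x. x \<in> hcarrier H \<Longrightarrow> N (\<iota> x) = \<iota> (S x)"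
    using ext by (auto simp: normal_extension_def normal_op_def)
  interpret K: complex_hilbert K by (rule K)
  define M where "M = adj K N"
  have N_cl: "N x \<in> hcarrier K" if "x \<in> hcarrier K" for x
    using that N(2) by (auto simp: bounded_op_def linear_map_def)
  have M_cl: "M x \<in> hcarrier K" if "x \<in> hcarrier K" for x
    using that N(2) by (auto simp: M_def intro: K.adj_closed)
  have comm: "N (M x) = M (N x)" if "x \<in> hcarrier K" for x
    using that N(1) by (auto simp: M_def normal_op_def)
  have NM: "hinner K (N x) y = hinner K x (M y)" if "x \<in> hcarrier K" "y \<in> hcarrier K" for x y
    using that K.inner_adj[OF N(2)] by (auto simp: M_def)
  have MN: "hinner K (M x) y = hinner K x (N y)" if "x \<in> hcarrier K" "y \<in> hcarrier K" for x y
    using that K.inner_adj'[OF N(2)] by (auto simp: M_def)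
  define g where "g n h = (M ^^ n) (\<iota> h)" for n h
  have \<iota>_cl: "\<iota> h \<in> hcarrier K" if "h \<in> hcarrier H" for h
    using that \<iota> by (auto simp: linear_map_def)
  have g_cl: "g n h \<in> hcarrier K" if "h \<in> hcarrier H" for n h
    using that by (induction n) (auto simp: g_def \<iota>_cl M_cl)
  have S_cl: "S h \<in> hcarrier H" if "h \<in> hcarrier H" for h
    using that S by (auto simp: bounded_op_def linear_map_def)
  have Ng: "N (g n h) = g n (S h)" if "h \<in> hcarrier H" for n h
  proof (induction n)
    case (Suc n)
    then show ?case using comm[OF g_cl[OF that, of n]] by (simp add: g_def)
  qed (simp add: g_def N\<iota> that)
  have Mg: "M (g n h) = g (Suc n) h" for n h by (simp add: g_def)
  define Z where "Z = {z \<in> hcarrier K. \<forall>n. \<forall>h\<in>hcarrier H. hinner K (g n h) z = 0}"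
  define K0 where "K0 = {k \<in> hcarrier K. \<forall>z\<in>Z. hinner K k z = 0}"
  have sub: "k \<in> hcarrier K" if "k \<in> K0" for k using that by (simp add: K0_def)
  have Z_cl: "M z \<in> Z" "N z \<in> Z" if z: "z \<in> Z" for z
  proof -
    have zK: "z \<in> hcarrier K" using z by (simp add: Z_def)
    have "hinner K (g n h) (M z) = 0" "hinner K (g n h) (N z) = 0" if h: "h \<in> hcarrier H" for n h
      using z NM[OF g_cl[OF h] zK] MN[OF g_cl[OF h] zK] Ng[OF h] Mg S_cl[OF h] h
      by (simp_all add: Z_def)
    then show "M z \<in> Z" "N z \<in> Z" using zK by (simp_all add: Z_def M_cl N_cl)
  qed
  have zsub: "z \<in> hcarrier K" if "z \<in> Z" for z using that by (simp add: Z_def)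
  have N0: "N k \<in> K0" and M0: "M k \<in> K0" if "k \<in> K0" for k
    using that Z_cl zsub by (auto simp: K0_def N_cl M_cl NM MN)
  have \<iota>0: "\<iota> h \<in> K0" if h: "h \<in> hcarrier H" for h
  proof -
    have "hinner K (\<iota> h) z = 0" if "z \<in> Z" for z
    proof -
      have "hinner K (g 0 h) z = 0" using that h unfolding Z_def by blast
      then show ?thesis by (simp add: g_def)
    qed
    then show ?thesis by (simp add: K0_def \<iota>_cl h)
  qed
  define \<phi> :: "'w \<Rightarrow> nat \<times> 'v \<Rightarrow> complex"
    where "\<phi> k = (\<lambda>(n, h). if h \<in> hcarrier H then hinner K k (g n h) else 0)" for k
  have inj: "inj_on \<phi> K0"
  proof (rule inj_onI)
    fix k l assume kl: "k \<in> K0" "l \<in> K0" and eq: "\<phi> k = \<phi> l"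
    have d: "hdiff K k l \<in> hcarrier K" using kl sub K.diff_closed by blast
    have "hinner K (hdiff K k l) (g n h) = 0" if h: "h \<in> hcarrier H" for n h
      using fun_cong[OF eq, of "(n, h)"] h kl by (simp add: \<phi>_def K.inner_diff_left g_cl sub)
    then have "hdiff K k l \<in> Z"
      using K.inner_cnj[OF d g_cl] d by (simp add: Z_def)
    then have "hinner K (hdiff K k l) (hdiff K k l) = 0"
      using kl by (simp add: K.inner_diff_left K0_def d)
    then show "k = l"
      by (rule K.diff_zero_imp_eq[OF sub[OF kl(1)] sub[OF kl(2)] K.inner_definite[OF d]])
  qed
  define \<psi> where "\<psi> = inv_into K0 \<phi>"
  define K' where "K' = \<lparr>hcarrier = \<phi> ` K0, hzero = \<phi> (hzero K),
     hadd = (\<lambda>f g. \<phi> (hadd K (\<psi> f) (\<psi> g))), hscale = (\<lambda>a f. \<phi> (hscale K a (\<psi> f))),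
     hinner = (\<lambda>f g. hinner K (\<psi> f) (\<psi> g))\<rparr>"
  have K'_hilbert: "complex_hilbert K'"
    unfolding K'_def \<psi>_def K0_def
    by (rule complex_hilbert_transport[OF K]) (use zsub inj in \<open>auto simp: K0_def\<close>)
  interpret K': complex_hilbert K' by (rule K'_hilbert)
  have \<psi>\<phi> [simp]: "\<psi> (\<phi> a) = a" if "a \<in> K0" for a
    using that inj by (simp add: \<psi>_def)
  have K' [simp]: "hcarrier K' = \<phi> ` K0"
    "\<And>f g. hadd K' f g = \<phi> (hadd K (\<psi> f) (\<psi> g))" "\<And>a f. hscale K' a f = \<phi> (hscale K a (\<psi> f))"
    "\<And>f g. hinner K' f g = hinner K (\<psi> f) (\<psi> g)"
    by (simp_all add: K'_def)
  have cl [simp]: "\<And>a b. \<lbrakk>a \<in> K0; b \<in> K0\<rbrakk> \<Longrightarrow> hadd K a b \<in> K0"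
    "\<And>c a. a \<in> K0 \<Longrightarrow> hscale K c a \<in> K0"
    using zsub by (auto simp: K0_def K.closed K.inner_simps)
  define N' where "N' f = \<phi> (N (\<psi> f))" for f
  have bdd: "bounded_op K' N'"
  proof -
    obtain C where "\<And>x. x \<in> hcarrier K \<Longrightarrow> hnorm K (N x) \<le> C * hnorm K x"
      using N(2) by (auto simp: bounded_op_def)
    then have "\<forall>f\<in>hcarrier K'. hnorm K' (N' f) \<le> C * hnorm K' f"
      by (auto simp: N'_def N0 hnorm_def sub)
    moreover have "linear_map K' K' N'"
      using N(2) by (auto simp: linear_map_def bounded_op_def N'_def N0 sub)
    ultimately show ?thesis by (auto simp: bounded_op_def)
  qed
  have adj: "adj K' N' (\<phi> k) = \<phi> (M k)" if "k \<in> K0" for k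
    using that by (intro K'.adj_eqI) (auto simp: N'_def N0 M0 NM sub)
  have "normal_extension H S K' (\<phi> \<circ> \<iota>) N'"
    unfolding normal_extension_def
  proof (intro conjI ballI K'_hilbert)
    show "linear_map H K' (\<phi> \<circ> \<iota>)"
      using \<iota> by (auto simp: linear_map_def \<iota>0)
    show "normal_op K' N'"
      using bdd by (auto simp: normal_op_def adj N'_def N0 M0 comm sub)
  qed (auto simp: \<iota>0 \<iota>_inner N'_def N\<iota>)
  then show ?thesis
    unfolding subnormal_def using S by blast
qed


section \<open>Properties of the spaces and operators above\<close>

lemma ell2_carrier:
  "f \<in> hcarrier (ell2 X) \<longleftrightarrow> (\<forall>x. x \<notin> X \<longrightarrow> f x = 0) \<and> (\<lambda>x. (cmod (f x))\<^sup>2) summable_on X"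
  by (simp add: ell2_def)

lemma ell2_simps [simp]:
  "hzero (ell2 X) = (\<lambda>x. 0)"
  "hadd (ell2 X) f g = (\<lambda>x. f x + g x)"
  "hscale (ell2 X) a f = (\<lambda>x. a * f x)"
  "hdiff (ell2 X) f g = (\<lambda>x. f x - g x)"
  by (simp_all add: ell2_def hdiff_def)

lemma ell2_inner: "hinner (ell2 X) f g = (\<Sum>\<^sub>\<infinity>x\<in>X. f x * cnj (g x))"
  by (simp add: ell2_def)

lemma ell2_summable:
  assumes "f \<in> hcarrier (ell2 X)" "g \<in> hcarrier (ell2 X)"
  shows "(\<lambda>x. f x * cnj (g x)) summable_on X"
proof (rule abs_summable_summable, rule abs_summable_product)
  show "(\<lambda>x. norm (f x * f x)) summable_on X" "(\<lambda>x. norm (cnj (g x) * cnj (g x))) summable_on X"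
    using assms by (simp_all add: ell2_carrier norm_mult power2_eq_square)
qed

lemma ell2_inner_self:
  "hinner (ell2 X) f f = complex_of_real (\<Sum>\<^sub>\<infinity>x\<in>X. (cmod (f x))\<^sup>2)"
proof -
  have "(\<Sum>\<^sub>\<infinity>x\<in>X. complex_of_real ((cmod (f x))\<^sup>2)) = of_real (\<Sum>\<^sub>\<infinity>x\<in>X. (cmod (f x))\<^sup>2)"
  proof (cases "(\<lambda>x. (cmod (f x))\<^sup>2) summable_on X")
    case True
    then show ?thesis by (intro infsumI has_sum_of_real has_sum_infsum)
  next
    case False
    have *: "\<not> (\<lambda>x. complex_of_real ((cmod (f x))\<^sup>2)) summable_on X"
      using False summable_on_Re by fastforce
    show ?thesis by (simp only: infsum_not_exists[OF False] infsum_not_exists[OF *] of_real_0)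
  qed
  then show ?thesis by (simp only: ell2_inner complex_norm_square)
qed

lemma ell2_norm_sq: "(hnorm (ell2 X) f)\<^sup>2 = (\<Sum>\<^sub>\<infinity>x\<in>X. (cmod (f x))\<^sup>2)"
  by (simp add: hnorm_def ell2_inner_self infsum_nonneg)

lemma ell2_boundedI:
  assumes "\<And>x. x \<notin> X \<Longrightarrow> f x = 0"
    and "\<And>F. \<lbrakk>finite F; F \<subseteq> X\<rbrakk> \<Longrightarrow> (\<Sum>x\<in>F. (cmod (f x))\<^sup>2) \<le> B\<^sup>2" and "0 \<le> B"
  shows "f \<in> hcarrier (ell2 X)" and "hnorm (ell2 X) f \<le> B"
proof -
  have s: "(\<lambda>x. (cmod (f x))\<^sup>2) summable_on X"
    using assms(2) by (intro nonneg_bdd_above_summable_on bdd_aboveI2[where M = "B\<^sup>2"]) auto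
  then show "f \<in> hcarrier (ell2 X)" using assms(1) by (simp add: ell2_carrier)
  have "(hnorm (ell2 X) f)\<^sup>2 \<le> B\<^sup>2"
    unfolding ell2_norm_sq using s assms(2) by (intro infsum_le_finite_sums) auto
  then show "hnorm (ell2 X) f \<le> B" using assms(3) power2_le_imp_le by blast
qed

lemma ell2_finite_sum_le:
  assumes "f \<in> hcarrier (ell2 X)" "finite F" "F \<subseteq> X"
  shows "(\<Sum>x\<in>F. (cmod (f x))\<^sup>2) \<le> (hnorm (ell2 X) f)\<^sup>2"
  unfolding ell2_norm_sq using assms by (intro finite_sum_le_infsum) (auto simp: ell2_carrier)

lemma ell2_add:
  assumes "f \<in> hcarrier (ell2 X)" "g \<in> hcarrier (ell2 X)"
  shows "(\<lambda>x. f x + g x) \<in> hcarrier (ell2 X)"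
proof -
  have "(cmod (a + b))\<^sup>2 \<le> 2 * (cmod a)\<^sup>2 + 2 * (cmod b)\<^sup>2" for a b
  proof -
    have "(cmod (a + b))\<^sup>2 \<le> (cmod a + cmod b)\<^sup>2"
      by (simp add: norm_triangle_ineq power_mono)
    moreover have "0 \<le> (cmod a - cmod b)\<^sup>2" by simp
    ultimately show ?thesis by (simp add: power2_sum power2_diff)
  qed
  moreover have "(\<lambda>x. 2 * (cmod (f x))\<^sup>2 + 2 * (cmod (g x))\<^sup>2) summable_on X"
    using assms by (intro summable_on_add summable_on_cmult_right) (auto simp: ell2_carrier)
  ultimately have "(\<lambda>x. (cmod (f x + g x))\<^sup>2) summable_on X"
    by - (rule summable_on_comparison_test[where f = "\<lambda>x. 2 * (cmod (f x))\<^sup>2 + 2 * (cmod (g x))\<^sup>2"]; simp)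
  then show ?thesis using assms by (simp add: ell2_carrier)
qed

lemma ell2_scale: "f \<in> hcarrier (ell2 X) \<Longrightarrow> (\<lambda>x. a * f x) \<in> hcarrier (ell2 X)"
  by (auto simp: ell2_carrier norm_mult power_mult_distrib intro: summable_on_cmult_right)

lemma ell2_diff:
  "\<lbrakk>f \<in> hcarrier (ell2 X); g \<in> hcarrier (ell2 X)\<rbrakk> \<Longrightarrow> (\<lambda>x. f x - g x) \<in> hcarrier (ell2 X)"
  using ell2_add[of f X "\<lambda>x. - 1 * g x"] ell2_scale[of g X "-1"] by simp

lemma complex_hilbert_ell2: "complex_hilbert (ell2 X)"
proof
  fix f g h :: "'a \<Rightarrow> complex" and a b :: complex
  show "hzero (ell2 X) \<in> hcarrier (ell2 X)" by (simp add: ell2_carrier)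
  assume f: "f \<in> hcarrier (ell2 X)"
  show "hscale (ell2 X) a f \<in> hcarrier (ell2 X)" using f by (simp add: ell2_scale)
  show "0 \<le> Re (hinner (ell2 X) f f)" by (simp add: ell2_inner_self infsum_nonneg)
  show "f = hzero (ell2 X)" if 0: "hinner (ell2 X) f f = 0"
  proof
    fix x
    show "f x = hzero (ell2 X) x"
    proof (cases "x \<in> X")
      case True
      have "(cmod (f x))\<^sup>2 = 0"
        by (rule nonneg_infsum_le_0D[where A = X and f = "\<lambda>x. (cmod (f x))\<^sup>2"])
          (use True f 0 in \<open>auto simp: ell2_carrier ell2_inner_self\<close>)
      then show ?thesis by simp
    qed (use f in \<open>simp add: ell2_carrier\<close>)
  qed
  assume g: "g \<in> hcarrier (ell2 X)"
  show "hadd (ell2 X) f g \<in> hcarrier (ell2 X)" using f g by (simp add: ell2_add)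
  show "hinner (ell2 X) (hscale (ell2 X) a f) g = a * hinner (ell2 X) f g"
    using ell2_summable[OF f g] by (simp add: ell2_inner mult.assoc infsum_cmult_right)
  show "hinner (ell2 X) g f = cnj (hinner (ell2 X) f g)"
    by (simp add: ell2_inner mult.commute flip: infsum_cnj)
  assume h: "h \<in> hcarrier (ell2 X)"
  show "hinner (ell2 X) (hadd (ell2 X) f g) h = hinner (ell2 X) f h + hinner (ell2 X) g h"
    using ell2_summable[OF f h] ell2_summable[OF g h]
    by (simp add: ell2_inner distrib_right infsum_add)
next
  fix s :: "nat \<Rightarrow> 'a \<Rightarrow> complex"
  assume s: "\<And>n. s n \<in> hcarrier (ell2 X)"
    and cauchy: "\<And>e. 0 < e \<Longrightarrow>
      \<exists>N. \<forall>m\<ge>N. \<forall>n\<ge>N. hnorm (ell2 X) (hdiff (ell2 X) (s m) (s n)) < e"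
  have fin: "(\<Sum>x\<in>F. (cmod (s m x - s n x))\<^sup>2) \<le> (hnorm (ell2 X) (hdiff (ell2 X) (s m) (s n)))\<^sup>2"
    if "finite F" "F \<subseteq> X" for F m n
    using ell2_finite_sum_le[OF ell2_diff[OF s s] that] by simp
  have pos: "0 \<le> hnorm (ell2 X) f" for f
    by (simp add: hnorm_def ell2_inner_self infsum_nonneg)
  have "Cauchy (\<lambda>n. s n x)" for x
  proof (cases "x \<in> X")
    case True
    show ?thesis
    proof (rule metric_CauchyI)
      fix e :: real assume "0 < e"
      then obtain N where N: "\<forall>m\<ge>N. \<forall>n\<ge>N. hnorm (ell2 X) (hdiff (ell2 X) (s m) (s n)) < e"
        using cauchy by blast
      have "dist (s m x) (s n x) < e" if "m \<ge> N" "n \<ge> N" for m n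
      proof -
        have "(dist (s m x) (s n x))\<^sup>2 \<le> (hnorm (ell2 X) (hdiff (ell2 X) (s m) (s n)))\<^sup>2"
          using fin[of "{x}" m n] True by (simp add: dist_norm)
        then have "dist (s m x) (s n x) \<le> hnorm (ell2 X) (hdiff (ell2 X) (s m) (s n))"
          using pos power2_le_imp_le by blast
        also have "\<dots> < e" using N that by blast
        finally show ?thesis .
      qed
      then show "\<exists>N. \<forall>m\<ge>N. \<forall>n\<ge>N. dist (s m x) (s n x) < e" by blast
    qed
  next
    case False
    then have "(\<lambda>n. s n x) = (\<lambda>n. 0)" using s by (auto simp: ell2_carrier)
    then show ?thesis by (simp add: convergent_Cauchy convergent_const)
  qed
  then have "\<exists>l. \<forall>x. (\<lambda>n. s n x) \<longlonglongrightarrow> l x"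
    by (intro choice allI) (simp add: Cauchy_convergent_iff convergent_def)
  then obtain l where l: "\<And>x. (\<lambda>n. s n x) \<longlonglongrightarrow> l x" by blast
  have l0: "l x = 0" if "x \<notin> X" for x
  proof -
    have "(\<lambda>n. s n x) = (\<lambda>n. 0)" using s that by (auto simp: ell2_carrier)
    with l[of x] show ?thesis by (simp add: LIMSEQ_const_iff)
  qed
  have tail: "\<exists>N. \<forall>m\<ge>N. (\<lambda>x. s m x - l x) \<in> hcarrier (ell2 X)
      \<and> hnorm (ell2 X) (\<lambda>x. s m x - l x) \<le> e" if e: "0 < e" for e
  proof -
    obtain N where N: "\<forall>m\<ge>N. \<forall>n\<ge>N. hnorm (ell2 X) (hdiff (ell2 X) (s m) (s n)) < e"
      using cauchy[OF e] by blast
    have "(\<lambda>x. s m x - l x) \<in> hcarrier (ell2 X) \<and> hnorm (ell2 X) (\<lambda>x. s m x - l x) \<le> e"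
      if m: "m \<ge> N" for m
    proof (intro conjI ell2_boundedI)
      fix F assume F: "finite F" "F \<subseteq> X"
      have "(\<lambda>n. \<Sum>x\<in>F. (cmod (s m x - s n x))\<^sup>2) \<longlonglongrightarrow> (\<Sum>x\<in>F. (cmod (s m x - l x))\<^sup>2)"
        by (intro tendsto_intros l)
      moreover have "(\<Sum>x\<in>F. (cmod (s m x - s n x))\<^sup>2) \<le> e\<^sup>2" if "n \<ge> N" for n
      proof -
        have "hnorm (ell2 X) (hdiff (ell2 X) (s m) (s n)) \<le> e"
          using N m that less_imp_le by blast
        then show ?thesis
          using fin[OF F, of m n] power_mono[OF _ pos, of _ e 2] by (meson order_trans)
      qed
      ultimately show "(\<Sum>x\<in>F. (cmod (s m x - l x))\<^sup>2) \<le> e\<^sup>2"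
        by (intro LIMSEQ_le_const2) auto
      then show "(\<Sum>x\<in>F. (cmod (s m x - l x))\<^sup>2) \<le> e\<^sup>2" .
    qed (use e l0 s in \<open>auto simp: ell2_carrier\<close>)
    then show ?thesis by blast
  qed
  obtain m where m: "(\<lambda>x. s m x - l x) \<in> hcarrier (ell2 X)"
    using tail[of 1] by auto
  have "l \<in> hcarrier (ell2 X)"
    using ell2_diff[OF s[of m] m] by simp
  moreover have "(\<lambda>n. hnorm (ell2 X) (hdiff (ell2 X) (s n) l)) \<longlonglongrightarrow> 0"
  proof (rule LIMSEQ_I)
    fix r :: real assume r: "0 < r"
    then obtain N where N: "\<forall>m\<ge>N. hnorm (ell2 X) (\<lambda>x. s m x - l x) \<le> r / 2"
      using tail[of "r / 2"] by auto
    have "norm (hnorm (ell2 X) (hdiff (ell2 X) (s n) l) - 0) < r" if "n \<ge> N" for n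
      using N[rule_format, OF that] r pos[of "\<lambda>x. s n x - l x"] by simp
    then show "\<exists>N. \<forall>n\<ge>N. norm (hnorm (ell2 X) (hdiff (ell2 X) (s n) l) - 0) < r" by blast
  qed
  ultimately show "\<exists>l\<in>hcarrier (ell2 X). (\<lambda>n. hnorm (ell2 X) (hdiff (ell2 X) (s n) l)) \<longlonglongrightarrow> 0"
    by blast
qed (simp_all add: fun_eq_iff algebra_simps)

lemma basis_vec_carrier: "u \<in> X \<Longrightarrow> basis_vec u \<in> hcarrier (ell2 X)"
  by (auto simp: ell2_carrier basis_vec_def if_distrib[of cmod] if_distrib[of "\<lambda>x. x\<^sup>2"]
      intro!: finite_nonzero_values_imp_summable_on finite_subset[of _ "{u}"] split: if_splits)

lemma inner_basis_vec:
  assumes "u \<in> X"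
  shows "hinner (ell2 X) (basis_vec u) f = cnj (f u)"
proof -
  have "hinner (ell2 X) (basis_vec u) f = (\<Sum>\<^sub>\<infinity>x\<in>{u}. cnj (f u))"
    unfolding ell2_inner using assms by (intro infsum_cong_neutral) (auto simp: basis_vec_def)
  then show ?thesis by simp
qed

lemma shift_basis_vec:
  "shift M T (basis_vec u) =
     (\<lambda>x. if x \<in> space M \<and> T x = u then complex_of_real (weight M T x) else 0)"
  by (auto simp: shift_def basis_vec_def)

lemma bounded_op_shift:
  assumes M: "discrete_measure_space M" and T: "T \<in> space M \<rightarrow> space M"
    and h: "ess_bounded M (h_fun M T)"
  shows "bounded_op (ell2 (space M)) (shift M T)"
proof -
  let ?X = "space M"
  have sets: "sets M = Pow ?X"
    and pos: "\<And>x. x \<in> ?X \<Longrightarrow> 0 < emeasure M {x}" "\<And>x. x \<in> ?X \<Longrightarrow> emeasure M {x} < \<infinity>"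
    using M by (auto simp: discrete_measure_space_def)
  have em: "emeasure M {x} = ennreal (measure M {x})" if "x \<in> ?X" for x
    using pos(2)[OF that] by (intro emeasure_eq_ennreal_measure) simp
  have mpos: "0 < measure M {x}" if "x \<in> ?X" for x
    using pos(1)[OF that] em[OF that] by simp
  obtain C0 :: real where AE: "AE x in M. h_fun M T x \<le> ennreal C0"
    using h by (auto simp: ess_bounded_def)
  obtain N where N: "{x \<in> ?X. \<not> h_fun M T x \<le> ennreal C0} \<subseteq> N" "emeasure M N = 0" "N \<in> sets M"
    using AE_E[OF AE] .
  have h_le0: "h_fun M T x \<le> ennreal C0" if x: "x \<in> ?X" for x
  proof (rule ccontr)
    assume "\<not> ?thesis"
    then have "{x} \<subseteq> N" using x N(1) by blast
    then have "emeasure M {x} \<le> emeasure M N" using N(3) by (rule emeasure_mono)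
    then show False using pos(1)[OF x] N(2) by simp
  qed
  define C where "C = max 0 C0"
  have h_le: "h_fun M T x \<le> ennreal C" if "x \<in> ?X" for x
    using h_le0[OF that] by (rule order_trans) (simp add: C_def ennreal_leI)
  have fib: "(\<Sum>x\<in>{x \<in> F. T x = u}. (weight M T x)\<^sup>2) \<le> C" if F: "finite F" "F \<subseteq> ?X" and u: "u \<in> ?X" for F u
  proof -
    let ?G = "{x \<in> F. T x = u}"
    have "ennreal (\<Sum>x\<in>?G. measure M {x}) = (\<Sum>x\<in>?G. emeasure M {x})"
    proof -
      have "(\<Sum>x\<in>?G. emeasure M {x}) = (\<Sum>x\<in>?G. ennreal (measure M {x}))"
        using F em by (intro sum.cong) auto
      then show ?thesis by simp
    qed
    also have "\<dots> = emeasure M ?G"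
      using F sets by (intro emeasure_eq_sum_singleton[symmetric]) auto
    also have "\<dots> \<le> emeasure M (T -` {u} \<inter> ?X)"
      using F sets by (intro emeasure_mono) auto
    also have "\<dots> = h_fun M T u * emeasure M {u}"
      using pos[OF u] by (simp add: h_fun_def ennreal_divide_times mult_divide_eq_ennreal less_top)
    also have "\<dots> \<le> ennreal C * ennreal (measure M {u})"
      using h_le[OF u] em[OF u] by (simp add: mult_right_mono)
    also have "\<dots> = ennreal (C * measure M {u})"
      by (simp add: ennreal_mult C_def)
    finally have "(\<Sum>x\<in>?G. measure M {x}) \<le> C * measure M {u}"
      by (simp add: C_def)
    moreover have "(\<Sum>x\<in>?G. (weight M T x)\<^sup>2) = (\<Sum>x\<in>?G. measure M {x}) / measure M {u}"
      unfolding sum_divide_distrib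
      by (intro sum.cong) (auto simp: weight_def power_divide)
    ultimately show ?thesis using mpos[OF u] by (simp only: pos_divide_le_eq)
  qed
  have main: "shift M T f \<in> hcarrier (ell2 ?X) \<and> hnorm (ell2 ?X) (shift M T f) \<le> sqrt C * hnorm (ell2 ?X) f"
    if f: "f \<in> hcarrier (ell2 ?X)" for f
  proof (intro conjI ell2_boundedI)
    fix F assume F: "finite F" "F \<subseteq> ?X"
    have TF: "finite (T ` F)" "T ` F \<subseteq> ?X" using F T by auto
    have "(\<Sum>x\<in>F. (cmod (shift M T f x))\<^sup>2) = (\<Sum>x\<in>F. (weight M T x)\<^sup>2 * (cmod (f (T x)))\<^sup>2)"
      using F by (intro sum.cong) (auto simp: shift_def norm_mult power_mult_distrib)
    also have "\<dots> = (\<Sum>u\<in>T ` F. \<Sum>x\<in>{x \<in> F. T x = u}. (weight M T x)\<^sup>2 * (cmod (f (T x)))\<^sup>2)"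
      by (rule sum.image_gen[OF F(1)])
    also have "\<dots> = (\<Sum>u\<in>T ` F. (\<Sum>x\<in>{x \<in> F. T x = u}. (weight M T x)\<^sup>2) * (cmod (f u))\<^sup>2)"
      by (intro sum.cong) (auto simp: sum_distrib_right)
    also have "\<dots> \<le> (\<Sum>u\<in>T ` F. C * (cmod (f u))\<^sup>2)"
    proof (intro sum_mono mult_right_mono)
      show "(\<Sum>x\<in>{x \<in> F. T x = u}. (weight M T x)\<^sup>2) \<le> C" if "u \<in> T ` F" for u
        using fib[OF F] TF(2) that by blast
    qed simp
    also have "\<dots> \<le> C * (hnorm (ell2 ?X) f)\<^sup>2"
      unfolding sum_distrib_left[symmetric]
      using ell2_finite_sum_le[OF f TF] by (rule mult_left_mono) (simp add: C_def)
    also have "\<dots> = (sqrt C * hnorm (ell2 ?X) f)\<^sup>2"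
      by (simp add: power_mult_distrib C_def)
    finally show "(\<Sum>x\<in>F. (cmod (shift M T f x))\<^sup>2) \<le> (sqrt C * hnorm (ell2 ?X) f)\<^sup>2" .
    then show "(\<Sum>x\<in>F. (cmod (shift M T f x))\<^sup>2) \<le> (sqrt C * hnorm (ell2 ?X) f)\<^sup>2" .
  qed (auto simp: shift_def C_def hnorm_def ell2_inner_self infsum_nonneg)
  have "linear_map (ell2 ?X) (ell2 ?X) (shift M T)"
    using main by (simp add: linear_map_def Pi_def) (simp add: shift_def fun_eq_iff distrib_left)
  with main show ?thesis
    unfolding bounded_op_def by blast
qed

lemma shift_unique:
  assumes M: "discrete_measure_space M" and T: "T \<in> space M \<rightarrow> space M"
    and h: "ess_bounded M (h_fun M T)" and A: "bounded_op (ell2 (space M)) A"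
    and eq: "\<And>u. u \<in> space M \<Longrightarrow> A (basis_vec u) = shift M T (basis_vec u)"
    and f: "f \<in> hcarrier (ell2 (space M))"
  shows "A f = shift M T f"
proof -
  let ?H = "ell2 (space M)" and ?S = "shift M T"
  interpret complex_hilbert ?H by (rule complex_hilbert_ell2)
  have S: "bounded_op ?H ?S" using bounded_op_shift[OF M T h] .
  have adj_eq: "adj ?H A g = adj ?H ?S g" if g: "g \<in> hcarrier ?H" for g
  proof
    fix x
    show "adj ?H A g x = adj ?H ?S g x"
    proof (cases "x \<in> space M")
      case True
      have "hinner ?H (basis_vec x) (adj ?H A g) = hinner ?H (basis_vec x) (adj ?H ?S g)"
        using inner_adj[OF A g basis_vec_carrier[OF True]]
          inner_adj[OF S g basis_vec_carrier[OF True]] eq[OF True] by simp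
      then show ?thesis by (simp add: inner_basis_vec[OF True])
    qed (use adj_closed[OF A g] adj_closed[OF S g] in \<open>simp add: ell2_carrier\<close>)
  qed
  show ?thesis
  proof (rule eq_if_inner_eq)
    show cl: "A f \<in> hcarrier ?H" "?S f \<in> hcarrier ?H"
      using A S f by (auto simp: bounded_op_def linear_map_def)
    show "hinner ?H g (A f) = hinner ?H g (?S f)" if g: "g \<in> hcarrier ?H" for g
      using inner_adj'[OF A g f] inner_adj'[OF S g f] adj_eq[OF g] by simp
  qed
qed

lemma
  shows space_two_point_measure: "space (two_point_measure \<alpha> a b) = UNIV"
    and sets_two_point_measure: "sets (two_point_measure \<alpha> a b) = sets borel"
    and emeasure_two_point_measure: "A \<in> sets borel \<Longrightarrow> emeasure (two_point_measure \<alpha> a b) A =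
      ennreal (1 - \<alpha>) * indicator A a + ennreal \<alpha> * indicator A b"
proof -
  show "space (two_point_measure \<alpha> a b) = UNIV"
    by (simp add: two_point_measure_def space_measure_of_conv)
  show sets: "sets (two_point_measure \<alpha> a b) = sets borel"
    using sets.sigma_sets_eq[of "borel :: real measure"] by (simp add: two_point_measure_def)
  show "emeasure (two_point_measure \<alpha> a b) A =
      ennreal (1 - \<alpha>) * indicator A a + ennreal \<alpha> * indicator A b" if A: "A \<in> sets borel"
  proof -
    have "emeasure (two_point_measure \<alpha> a b) A =
        ennreal (1 - \<alpha>) * emeasure (return borel a) A + ennreal \<alpha> * emeasure (return borel b) A"
    proof (rule emeasure_measure_of[OF two_point_measure_def])
      show "countably_additive (sets (two_point_measure \<alpha> a b))
        (\<lambda>A. ennreal (1 - \<alpha>) * emeasure (return borel a) A + ennreal \<alpha> * emeasure (return borel b) A)"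
      proof (rule countably_additiveI)
        fix A :: "nat \<Rightarrow> real set"
        assume A: "range A \<subseteq> sets (two_point_measure \<alpha> a b)" "disjoint_family A"
        have *: "(\<Sum>i. emeasure (return borel c) (A i)) = emeasure (return borel c) (\<Union> (range A))" for c
          using A sets by (intro suminf_emeasure) auto
        show "(\<Sum>i. ennreal (1 - \<alpha>) * emeasure (return borel a) (A i)
            + ennreal \<alpha> * emeasure (return borel b) (A i)) =
          ennreal (1 - \<alpha>) * emeasure (return borel a) (\<Union> (range A))
            + ennreal \<alpha> * emeasure (return borel b) (\<Union> (range A))"
          by (simp add: suminf_add[symmetric] ennreal_suminf_cmult *)
      qed
    qed (use A sets in \<open>auto simp: positive_def\<close>)
    then show ?thesis using A by simp
  qed
qed

end

theory Submission
  imports Defs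
begin

text \<open>
  Two-isometry says that the defect \<open>\<delta>(u) = \<mu>(T\<^sup>-\<^sup>1{u}) - \<mu>{u}\<close> satisfies \<open>\<delta>(u) = \<Sum> \<delta>(x)\<close> over
  \<open>T x = u\<close>. Since it is nonnegative, going once around the cycle shows that it is constant on
  the cycle and vanishes on the trees. So the shift is isometric on the trees, and
  \<open>d\<^sub>n(u) = \<parallel>S'\<^sup>n e\<^sub>u\<parallel>\<^sup>2\<close> satisfies \<open>d\<^sub>n\<^sub>+\<^sub>\<kappa> = D d\<^sub>n + C\<^sub>m\<close> at \<open>v\<^sub>m\<close>, whence
  \<open>d\<^sub>\<kappa>\<^sub>q = \<alpha>\<^sub>m + (1 - \<alpha>\<^sub>m) D\<^sup>q\<close>. If \<open>S'\<close> extends to a normal operator, then this subsequence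
  determines the whole moment sequence \<open>d\<^sub>n\<close>. Conversely, condition (ii) propagates to all \<open>n\<close>, and
  then \<open>S'\<close> embeds into \<open>V \<oplus> D\<^sup>1\<^sup>/\<^sup>2\<^sup>\<kappa> W\<close> with isometries \<open>V\<close>, \<open>W\<close>, each of which has a unitary
  dilation.
\<close>

section \<open>Orthogonal sums and unitary dilations\<close>

text \<open>No spectral measure of a normal operator is formed. That every \<kappa>-th moment
  determines all of them reflects the injectivity of t -> t^\<kappa> on the half-line: the
  representing measure can only sit at 1 and at the \<kappa>-th root of D. Here this is obtained
  from the nonnegativity of finitely many combinations of norms.

  The number \<alpha>_m is the fixed point of t -> D t + C_m, hence the limit of d_n(v_m), that is,
  the mass of the atom at 1. Therefore it obeys the one-step recursion of d_n around the cycle.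
  Consequently the weight p, equal to \<alpha>_m at v_m and to 1 on the trees, is always carried to
  itself by S'; this produces V. The first moment at every v_m says exactly that the complementary
  weight 1 - p is multiplied by the \<kappa>-th root of D in each step; this produces W, which lives
  on the finite cycle only.

  Both constructions divide by quantities that must not vanish: 1 - D, p, and 1 - p on the cycle. A
  tree with positive root weight forces a positive defect on the cycle, so every c at a cycle vertex
  is below 1, and this gives D < 1 and 0 < \<alpha>_m < 1.\<close>

lemma bounded_op_closed: "\<lbrakk>bounded_op H A; x \<in> hcarrier H\<rbrakk> \<Longrightarrow> A x \<in> hcarrier H"
  by (auto simp: bounded_op_def linear_map_def)

lemma bounded_op_add: "\<lbrakk>bounded_op H A; x \<in> hcarrier H; y \<in> hcarrier H\<rbrakk>
    \<Longrightarrow> A (hadd H x y) = hadd H (A x) (A y)"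
  and bounded_op_scale: "\<lbrakk>bounded_op H A; x \<in> hcarrier H\<rbrakk> \<Longrightarrow> A (hscale H a x) = hscale H a (A x)"
  by (auto simp: bounded_op_def linear_map_def)

text \<open>Only values on the carrier matter; the Cauchy dual is identified with a weighted
  composition operator only there.\<close>

lemma bounded_op_cong:
  assumes "complex_hilbert H" "bounded_op H A" and eq: "\<And>x. x \<in> hcarrier H \<Longrightarrow> B x = A x"
  shows "bounded_op H B"
proof -
  interpret complex_hilbert H by fact
  show ?thesis
    using assms(2) by (auto simp: bounded_op_def linear_map_def eq closed Pi_iff)
qed

definition hsum :: "'v hilbert \<Rightarrow> 'w hilbert \<Rightarrow> ('v \<times> 'w) hilbert" where
  "hsum H K = \<lparr>
     hcarrier = hcarrier H \<times> hcarrier K,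
     hzero = (hzero H, hzero K),
     hadd = (\<lambda>p q. (hadd H (fst p) (fst q), hadd K (snd p) (snd q))),
     hscale = (\<lambda>a p. (hscale H a (fst p), hscale K a (snd p))),
     hinner = (\<lambda>p q. hinner H (fst p) (fst q) + hinner K (snd p) (snd q))\<rparr>"

lemma hsum_simps [simp]:
  "hcarrier (hsum H K) = hcarrier H \<times> hcarrier K"
  "hzero (hsum H K) = (hzero H, hzero K)"
  "hadd (hsum H K) p q = (hadd H (fst p) (fst q), hadd K (snd p) (snd q))"
  "hscale (hsum H K) a p = (hscale H a (fst p), hscale K a (snd p))"
  "hinner (hsum H K) p q = hinner H (fst p) (fst q) + hinner K (snd p) (snd q)"
  "hdiff (hsum H K) p q = (hdiff H (fst p) (fst q), hdiff K (snd p) (snd q))"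
  by (simp_all add: hsum_def hdiff_def)

lemma hnorm_hsum_sq:
  assumes "complex_hilbert H" "complex_hilbert K" "x \<in> hcarrier H" "y \<in> hcarrier K"
  shows "(hnorm (hsum H K) (x, y))\<^sup>2 = (hnorm H x)\<^sup>2 + (hnorm K y)\<^sup>2"
proof -
  interpret H: complex_hilbert H by fact
  interpret K: complex_hilbert K by fact
  show ?thesis
    using assms by (simp add: hnorm_def H.inner_nonneg K.inner_nonneg)
qed

lemma complex_hilbert_hsum:
  assumes "complex_hilbert H" "complex_hilbert K"
  shows "complex_hilbert (hsum H K)"
proof -
  interpret H: complex_hilbert H by fact
  interpret K: complex_hilbert K by fact
  show ?thesis
  proof
    fix p assume p: "p \<in> hcarrier (hsum H K)"
    then have nn: "0 \<le> Re (hinner H (fst p) (fst p))" "0 \<le> Re (hinner K (snd p) (snd p))"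
      by (auto intro: H.inner_nonneg K.inner_nonneg)
    then show "0 \<le> Re (hinner (hsum H K) p p)" by simp
    show "p = hzero (hsum H K)" if "hinner (hsum H K) p p = 0"
    proof -
      \<comment> \<open>\<open>inner_definite\<close> asks for a complex zero, so the vanishing of
        the real parts must be lifted to the inner products.\<close>
      have "hinner H (fst p) (fst p) = of_real (Re (hinner H (fst p) (fst p)))"
        "hinner K (snd p) (snd p) = of_real (Re (hinner K (snd p) (snd p)))"
        using p H.inner_self[of "fst p"] K.inner_self[of "snd p"] by auto
      moreover have "Re (hinner H (fst p) (fst p)) = 0" "Re (hinner K (snd p) (snd p)) = 0"
        using arg_cong[OF that, of Re] nn by (simp_all)
      ultimately have "hinner H (fst p) (fst p) = 0" "hinner K (snd p) (snd p) = 0" by simp_all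
      then show ?thesis
        using p by (auto intro: H.inner_definite K.inner_definite)
    qed
    fix q assume q: "q \<in> hcarrier (hsum H K)"
    show "hinner (hsum H K) q p = cnj (hinner (hsum H K) p q)"
      using p q H.inner_cnj[of "fst p" "fst q"] K.inner_cnj[of "snd p" "snd q"] by auto
    show "hadd (hsum H K) p q = hadd (hsum H K) q p"
      using p q H.add_commute[of "fst p" "fst q"] K.add_commute[of "snd p" "snd q"] by auto
  next
    fix s :: "nat \<Rightarrow> 'a \<times> 'b"
    assume s: "\<And>n. s n \<in> hcarrier (hsum H K)"
      and cauchy: "\<And>e. 0 < e \<Longrightarrow>
        \<exists>N. \<forall>m\<ge>N. \<forall>n\<ge>N. hnorm (hsum H K) (hdiff (hsum H K) (s m) (s n)) < e"
    have s': "fst (s n) \<in> hcarrier H" "snd (s n) \<in> hcarrier K" for n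
      using s[of n] by auto
    have sq: "(hnorm (hsum H K) (hdiff (hsum H K) p q))\<^sup>2 =
        (hnorm H (hdiff H (fst p) (fst q)))\<^sup>2 + (hnorm K (hdiff K (snd p) (snd q)))\<^sup>2"
      if "p \<in> hcarrier (hsum H K)" "q \<in> hcarrier (hsum H K)" for p q
      using that by (auto simp: hnorm_hsum_sq[OF assms] H.closed K.closed)
    have nn: "0 \<le> hnorm (hsum H K) (hdiff (hsum H K) p q)"
      if "p \<in> hcarrier (hsum H K)" "q \<in> hcarrier (hsum H K)" for p q
      using that by (auto simp: hnorm_def intro!: add_nonneg_nonneg H.inner_nonneg K.inner_nonneg H.closed K.closed)
    have le: "hnorm H (hdiff H (fst (s m)) (fst (s n))) \<le> hnorm (hsum H K) (hdiff (hsum H K) (s m) (s n))"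
      "hnorm K (hdiff K (snd (s m)) (snd (s n))) \<le> hnorm (hsum H K) (hdiff (hsum H K) (s m) (s n))"
      for m n
      by (rule power2_le_imp_le[OF _ nn[OF s s]], simp only: sq[OF s s], simp)+
    have "\<exists>l\<in>hcarrier H. (\<lambda>n. hnorm H (hdiff H (fst (s n)) l)) \<longlonglongrightarrow> 0"
      using s' cauchy le(1) by (intro H.complete) (meson order_le_less_trans)+
    moreover have "\<exists>l\<in>hcarrier K. (\<lambda>n. hnorm K (hdiff K (snd (s n)) l)) \<longlonglongrightarrow> 0"
      using s' cauchy le(2) by (intro K.complete) (meson order_le_less_trans)+
    ultimately obtain l l' where l: "l \<in> hcarrier H" "l' \<in> hcarrier K"
      "(\<lambda>n. hnorm H (hdiff H (fst (s n)) l)) \<longlonglongrightarrow> 0" "(\<lambda>n. hnorm K (hdiff K (snd (s n)) l')) \<longlonglongrightarrow> 0"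
      by blast
    then have "(\<lambda>n. sqrt ((hnorm H (hdiff H (fst (s n)) l))\<^sup>2 + (hnorm K (hdiff K (snd (s n)) l'))\<^sup>2))
        \<longlonglongrightarrow> sqrt (0\<^sup>2 + 0\<^sup>2)"
      by (intro tendsto_intros)
    moreover have "sqrt ((hnorm H (hdiff H (fst (s n)) l))\<^sup>2 + (hnorm K (hdiff K (snd (s n)) l'))\<^sup>2) =
        hnorm (hsum H K) (hdiff (hsum H K) (s n) (l, l'))" for n
      using sq[OF s, of "(l, l')" n] nn[OF s, of "(l, l')" n] l
      by (simp del: hsum_simps(6)) (metis real_sqrt_abs abs_of_nonneg)
    ultimately show "\<exists>l\<in>hcarrier (hsum H K). (\<lambda>n. hnorm (hsum H K) (hdiff (hsum H K) (s n) l)) \<longlonglongrightarrow> 0"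
      using l by (intro bexI[of _ "(l, l')"]) auto
  qed (auto simp: H.closed K.closed H.add_assoc K.add_assoc H.add_zero K.add_zero H.add_neg K.add_neg
      H.scale_one K.scale_one H.scale_scale K.scale_scale H.scale_add_right K.scale_add_right
      H.scale_add_left K.scale_add_left H.inner_simps K.inner_simps algebra_simps)
qed

lemma normal_op_hsum:
  assumes HK: "complex_hilbert H" "complex_hilbert K" and A: "normal_op H A" and B: "normal_op K B"
  shows "normal_op (hsum H K) (\<lambda>p. (A (fst p), B (snd p)))"
proof -
  interpret H: complex_hilbert H by fact
  interpret K: complex_hilbert K by fact
  interpret S: complex_hilbert "hsum H K" by (rule complex_hilbert_hsum[OF HK])
  have A': "bounded_op H A" and B': "bounded_op K B" using A B by (auto simp: normal_op_def)
  note cl = bounded_op_closed[OF A'] bounded_op_closed[OF B'] H.adj_closed[OF A'] K.adj_closed[OF B']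
  obtain C1 C2 where C: "\<And>x. x \<in> hcarrier H \<Longrightarrow> hnorm H (A x) \<le> C1 * hnorm H x"
    "\<And>x. x \<in> hcarrier K \<Longrightarrow> hnorm K (B x) \<le> C2 * hnorm K x"
    using A' B' by (auto simp: bounded_op_def)
  \<comment> \<open>\<open>bounded_op\<close> admits negative bounds on a zero space, hence the
    absolute values.\<close>
  define C where "C = \<bar>C1\<bar> + \<bar>C2\<bar>"
  have "hnorm (hsum H K) (A x, B y) \<le> C * hnorm (hsum H K) (x, y)"
    if x: "x \<in> hcarrier H" and y: "y \<in> hcarrier K" for x y
  proof (rule power2_le_imp_le)
    have "hnorm H (A x) \<le> C * hnorm H x"
      using H.norm_ge_0[OF x]
      by (intro order_trans[OF C(1)[OF x]] mult_right_mono) (auto simp: C_def)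
    then have 1: "(hnorm H (A x))\<^sup>2 \<le> (C * hnorm H x)\<^sup>2"
      using x by (intro power_mono H.norm_ge_0 cl)
    have "hnorm K (B y) \<le> C * hnorm K y"
      using K.norm_ge_0[OF y]
      by (intro order_trans[OF C(2)[OF y]] mult_right_mono) (auto simp: C_def)
    then have 2: "(hnorm K (B y))\<^sup>2 \<le> (C * hnorm K y)\<^sup>2"
      using y by (intro power_mono K.norm_ge_0 cl)
    show "(hnorm (hsum H K) (A x, B y))\<^sup>2 \<le> (C * hnorm (hsum H K) (x, y))\<^sup>2"
      using 1 2 x y by (simp add: hnorm_hsum_sq[OF HK] cl power_mult_distrib distrib_left)
    show "0 \<le> C * hnorm (hsum H K) (x, y)"
      using S.norm_ge_0[of "(x, y)"] x y by (simp add: C_def)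
  qed
  then have "bounded_op (hsum H K) (\<lambda>p. (A (fst p), B (snd p)))"
    unfolding bounded_op_def linear_map_def
    by (auto simp: cl bounded_op_add[OF A'] bounded_op_add[OF B']
        bounded_op_scale[OF A'] bounded_op_scale[OF B'])
  moreover have "adj (hsum H K) (\<lambda>p. (A (fst p), B (snd p))) p = (adj H A (fst p), adj K B (snd p))"
    if "p \<in> hcarrier (hsum H K)" for p
    using that by (intro S.adj_eqI) (auto simp: cl H.inner_adj[OF A'] K.inner_adj[OF B'])
  ultimately show ?thesis
    using A B by (auto simp: normal_op_def cl)
qed

text \<open>
  Halmos: for an isometry \<open>V\<close>, the block operator with rows \<open>(V, I - V V\<^sup>*)\<close> and \<open>(0, - V\<^sup>*)\<close>
  is unitary.
\<close>

lemma scaled_isometry_normal_extension: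
  fixes r :: complex
  assumes H: "complex_hilbert H" and V: "bounded_op H V"
    and isom: "\<And>x y. \<lbrakk>x \<in> hcarrier H; y \<in> hcarrier H\<rbrakk> \<Longrightarrow> hinner H (V x) (V y) = hinner H x y"
  shows "\<exists>N. normal_extension H (\<lambda>x. hscale H r (V x)) (hsum H H) (\<lambda>x. (x, hzero H)) N"
proof -
  interpret H: complex_hilbert H by fact
  interpret S: complex_hilbert "hsum H H" by (rule complex_hilbert_hsum[OF H H])
  let ?K = "hsum H H"
  define W where "W = adj H V"
  note Vc = bounded_op_closed[OF V] and Wc = H.adj_closed[OF V, folded W_def]
  have VW: "hinner H (V x) y = hinner H x (W y)" "hinner H y (V x) = hinner H (W y) x"
    if "x \<in> hcarrier H" "y \<in> hcarrier H" for x y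
    using that H.inner_adj[OF V] H.inner_adj'[OF V] by (auto simp: W_def)
  have WV: "W (V x) = x" if "x \<in> hcarrier H" for x
    unfolding W_def using that by (intro H.adj_eqI) (auto simp: Vc isom)
  define U where "U p = (hadd H (V (fst p)) (hdiff H (snd p) (V (W (snd p)))), hscale H (- 1) (W (snd p)))" for p
  define U' where "U' p = (W (fst p), hdiff H (hdiff H (fst p) (V (W (fst p)))) (V (snd p)))" for p
  note cl = H.closed Vc Wc
  have Uc: "U p \<in> hcarrier ?K" "U' p \<in> hcarrier ?K" if "p \<in> hcarrier ?K" for p
    using that by (auto simp: U_def U'_def cl)
  have UU': "hinner ?K (U p) q = hinner ?K p (U' q)" if "p \<in> hcarrier ?K" "q \<in> hcarrier ?K" for p q
    using that by (auto simp: U_def U'_def cl H.inner_simps VW algebra_simps)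
  \<comment> \<open>Since \<open>W (V x) = x\<close>, the map I - V W is the projection onto the
    complement of the range of V. That \<open>U\<close> preserves inner products gives U' U = I;
    that its adjoint \<open>U'\<close> does gives U U' = I.\<close>
  have isoU: "hinner ?K (U p) (U q) = hinner ?K p q"
    and isoU': "hinner ?K (U' p) (U' q) = hinner ?K p q"
    if "p \<in> hcarrier ?K" "q \<in> hcarrier ?K" for p q
    using that by (clarsimp simp: U_def U'_def cl H.inner_simps, simp add: cl VW WV)+
  have U'U: "U' (U p) = p" and UU'_id: "U (U' p) = p" if p: "p \<in> hcarrier ?K" for p
  proof -
    have "hinner ?K z (U' (U p)) = hinner ?K z p" if z: "z \<in> hcarrier ?K" for z
      using UU'[OF z Uc(1)[OF p]] isoU[OF z p] by simp
    then show "U' (U p) = p"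
      by (rule S.eq_if_inner_eq[OF Uc(2)[OF Uc(1)[OF p]] p])
    have "hinner ?K z (U (U' p)) = hinner ?K z p" if z: "z \<in> hcarrier ?K" for z
    proof -
      have "hinner ?K (U (U' p)) z = hinner ?K p z"
        using UU'[OF Uc(2)[OF p] z] isoU'[OF p z] by simp
      then show ?thesis
        using S.inner_cnj[OF Uc(1)[OF Uc(2)[OF p]] z] S.inner_cnj[OF p z] by simp
    qed
    then show "U (U' p) = p"
      by (rule S.eq_if_inner_eq[OF Uc(1)[OF Uc(2)[OF p]] p])
  qed
  \<comment> \<open>A surjective map that preserves inner products is linear: test against x,
    written as \<open>U (U' x)\<close>.\<close>
  have U_lin: "U (hadd ?K p q) = hadd ?K (U p) (U q)" "U (hscale ?K a p) = hscale ?K a (U p)"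
    if p: "p \<in> hcarrier ?K" and q: "q \<in> hcarrier ?K" for p q a
  proof -
    show "U (hadd ?K p q) = hadd ?K (U p) (U q)"
    proof (rule S.eq_if_inner_eq)
      show "hinner ?K x (U (hadd ?K p q)) = hinner ?K x (hadd ?K (U p) (U q))"
        if x: "x \<in> hcarrier ?K" for x
      proof -
        have "hinner ?K (U (U' x)) (U (hadd ?K p q)) = hinner ?K (U (U' x)) (hadd ?K (U p) (U q))"
          using p q x by (simp only: isoU Uc S.closed S.inner_add_right)
        then show ?thesis using UU'_id[OF x] by simp
      qed
    qed (use p q in \<open>simp_all only: Uc S.closed\<close>)
    show "U (hscale ?K a p) = hscale ?K a (U p)"
    proof (rule S.eq_if_inner_eq)
      show "hinner ?K x (U (hscale ?K a p)) = hinner ?K x (hscale ?K a (U p))"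
        if x: "x \<in> hcarrier ?K" for x
      proof -
        have "hinner ?K (U (U' x)) (U (hscale ?K a p)) = hinner ?K (U (U' x)) (hscale ?K a (U p))"
          using p x by (simp only: isoU Uc S.closed S.inner_scale_right)
        then show ?thesis using UU'_id[OF x] by simp
      qed
    qed (use p in \<open>simp_all only: Uc S.closed\<close>)
  qed
  have U'_scale: "U' (hscale ?K a p) = hscale ?K a (U' p)" if p: "p \<in> hcarrier ?K" for p a
    using U_lin(2)[OF Uc(2)[OF p] p, of a] U'U[OF S.scale_closed[OF Uc(2)[OF p]], of a] UU'_id[OF p]
    by simp
  define N where "N p = hscale ?K r (U p)" for p
  have Nc: "N p \<in> hcarrier ?K" if "p \<in> hcarrier ?K" for p
    unfolding N_def using that by (simp only: Uc S.closed)
  have "hnorm ?K (N p) \<le> cmod r * hnorm ?K p" if p: "p \<in> hcarrier ?K" for p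
  proof (rule power2_le_imp_le)
    have "hinner ?K (N p) (N p) = r * (cnj r * hinner ?K p p)"
      unfolding N_def using p by (simp only: S.inner_simps Uc S.closed isoU mult.left_commute)
    also have "\<dots> = complex_of_real ((cmod r)\<^sup>2 * (hnorm ?K p)\<^sup>2)"
      by (simp only: S.inner_self[OF p] of_real_mult complex_norm_square mult.assoc)
    finally show "(hnorm ?K (N p))\<^sup>2 \<le> (cmod r * hnorm ?K p)\<^sup>2"
      using S.norm_sq[OF Nc[OF p]] by (simp add: power_mult_distrib)
    show "0 \<le> cmod r * hnorm ?K p" using S.norm_ge_0[OF p] by simp
  qed
  moreover have "N (hadd ?K p q) = hadd ?K (N p) (N q)" "N (hscale ?K a p) = hscale ?K a (N p)"
    if "p \<in> hcarrier ?K" "q \<in> hcarrier ?K" for p q a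
    unfolding N_def using that
    by (simp_all only: U_lin S.scale_add_right S.scale_scale Uc mult.commute[of a])
  ultimately have N_bdd: "bounded_op ?K N"
    using Nc unfolding bounded_op_def linear_map_def by blast
  have adjN: "adj ?K N p = hscale ?K (cnj r) (U' p)" if p: "p \<in> hcarrier ?K" for p
    using p Uc S.closed
    by (intro S.adj_eqI) (simp_all only: N_def S.inner_simps UU' complex_cnj_cnj)
  have N_normal: "normal_op ?K N"
    unfolding normal_op_def
  proof (intro conjI ballI N_bdd)
    fix p assume p: "p \<in> hcarrier ?K"
    show "adj ?K N (N p) = N (adj ?K N p)"
      unfolding adjN[OF p] adjN[OF Nc[OF p]] unfolding N_def
      using p by (simp only: U_lin U'_scale U'U UU'_id Uc S.scale_scale mult.commute)
  qed
  have z: "hscale H a (hzero H) = hzero H" for a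
    using H.inner_zero_left[of "hzero H"]
    by (intro H.inner_definite) (simp_all add: cl H.inner_simps)
  have "N (x, hzero H) = (hscale H r (V x), hzero H)" if x: "x \<in> hcarrier H" for x
  proof -
    have "hinner H (W (hzero H)) (W (hzero H)) = 0"
      using H.inner_adj'[OF V H.zero_closed Wc[OF H.zero_closed], folded W_def]
      by (simp add: H.inner_zero_left cl)
    then have W0: "W (hzero H) = hzero H" by (intro H.inner_definite) (simp_all add: cl)
    have "hinner H (V (hzero H)) (V (hzero H)) = 0"
      by (simp add: isom H.inner_zero_left cl)
    then have V0: "V (hzero H) = hzero H" by (intro H.inner_definite) (simp_all add: cl)
    show ?thesis using x by (simp add: N_def U_def W0 V0 z hdiff_def H.add_zero cl)
  qed
  moreover have "linear_map H ?K (\<lambda>x. (x, hzero H))"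
    by (auto simp: linear_map_def cl z H.add_zero)
  ultimately have "normal_extension H (\<lambda>x. hscale H r (V x)) ?K (\<lambda>x. (x, hzero H)) N"
    unfolding normal_extension_def using S.complex_hilbert_axioms N_normal
    by (auto simp: H.inner_zero_left cl)
  then show ?thesis by blast
qed

text \<open>Neither J1 nor J2 has to be isometric; only the pair is, and along it S becomes a
  restriction of the orthogonal sum of the two normal extensions.\<close>

lemma subnormal_if_embeds_in_sum:
  fixes H :: "'v hilbert" and H1 :: "'w hilbert" and H2 :: "'u hilbert"
    and K1 :: "'p hilbert" and K2 :: "'q hilbert"
  assumes S: "bounded_op H S"
    and J1: "linear_map H H1 J1" and J2: "linear_map H H2 J2"
    and J: "\<And>x y. \<lbrakk>x \<in> hcarrier H; y \<in> hcarrier H\<rbrakk>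
      \<Longrightarrow> hinner H x y = hinner H1 (J1 x) (J1 y) + hinner H2 (J2 x) (J2 y)"
    and ext1: "normal_extension H1 A1 K1 \<iota>1 N1" and ext2: "normal_extension H2 A2 K2 \<iota>2 N2"
    and int1: "\<And>x. x \<in> hcarrier H \<Longrightarrow> A1 (J1 x) = J1 (S x)"
    and int2: "\<And>x. x \<in> hcarrier H \<Longrightarrow> A2 (J2 x) = J2 (S x)"
  shows "subnormal H S"
proof (rule subnormalI[OF S])
  have cl: "J1 x \<in> hcarrier H1" "J2 x \<in> hcarrier H2" if "x \<in> hcarrier H" for x
    using that J1 J2 by (auto simp: linear_map_def)
  show "normal_extension H S (hsum K1 K2) (\<lambda>x. (\<iota>1 (J1 x), \<iota>2 (J2 x))) (\<lambda>p. (N1 (fst p), N2 (snd p)))"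
    using ext1 ext2 J1 J2 unfolding normal_extension_def
    by (auto simp: complex_hilbert_hsum normal_op_hsum J cl int1 int2 linear_map_def)
qed

section \<open>Norms of powers of a normal operator\<close>

text \<open>The factorization of t^k - r^k by t - r, with the left shift in place of t.\<close>

lemma diff_power_telescope:
  fixes s :: "nat \<Rightarrow> real"
  shows "s (n + k) - r ^ k * s n = (\<Sum>i<k. r ^ (k - Suc i) * (s (Suc (n + i)) - r * s (n + i)))"
proof (induction k)
  case (Suc k)
  have "(\<Sum>i<k. r ^ (Suc k - Suc i) * (s (Suc (n + i)) - r * s (n + i))) =
      r * (\<Sum>i<k. r ^ (k - Suc i) * (s (Suc (n + i)) - r * s (n + i)))"
    unfolding sum_distrib_left
    by (intro sum.cong) (auto simp: Suc_diff_Suc[symmetric] simp del: diff_Suc_Suc)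
  also have "\<dots> = r * (s (n + k) - r ^ k * s n)"
    by (simp only: Suc)
  finally show ?case
    by (simp add: right_diff_distrib)
qed simp

text \<open>
  \<open>seq_diff r k\<close> is \<open>E\<^sup>k - r\<^sup>k\<close> for the left shift \<open>E\<close> on sequences, and
  \<open>seq_geom r k\<close> is the quotient \<open>(E\<^sup>k - r\<^sup>k) / (E - r)\<close>.
\<close>

definition seq_diff :: "real \<Rightarrow> nat \<Rightarrow> (nat \<Rightarrow> real) \<Rightarrow> nat \<Rightarrow> real" where
  "seq_diff r k s n = s (n + k) - r ^ k * s n"

definition seq_geom :: "real \<Rightarrow> nat \<Rightarrow> (nat \<Rightarrow> real) \<Rightarrow> nat \<Rightarrow> real" where
  "seq_geom r k s n = (\<Sum>i<k. r ^ (k - Suc i) * s (n + i))"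

lemma seq_diff_eq_geom: "seq_diff r k s = seq_geom r k (seq_diff r 1 s)"
  using diff_power_telescope[of s _ k r] by (simp add: seq_diff_def seq_geom_def fun_eq_iff)

lemma seq_diff_geom_commute: "seq_diff r 1 (seq_geom q k s) = seq_geom q k (seq_diff r 1 s)"
  by (simp add: fun_eq_iff seq_diff_def seq_geom_def sum_distrib_left sum_subtractf
      right_diff_distrib mult.left_commute)

lemma seq_geom_nonneg: "\<lbrakk>0 \<le> r; \<And>n. 0 \<le> s n\<rbrakk> \<Longrightarrow> 0 \<le> seq_geom r k s n"
  by (simp add: seq_geom_def sum_nonneg)

text \<open>The term i = 0 alone. It replaces inverting the geometric factor: if
  \<open>seq_geom r k s\<close> vanishes at n for nonnegative s and r > 0, then so does s.\<close>

lemma seq_geom_ge: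
  assumes "0 \<le> r" "\<And>n. 0 \<le> s n" "k > 0"
  shows "r ^ (k - 1) * s n \<le> seq_geom r k s n"
proof -
  have "(\<Sum>i\<in>{0}. r ^ (k - Suc i) * s (n + i)) \<le> seq_geom r k s n"
    unfolding seq_geom_def using assms by (intro sum_mono2) auto
  then show ?thesis by simp
qed

text \<open>Let E be the left shift. Applied to a at 0, the operator (E^k - 1)^2 (E^k - b^k)^2 sees
  only multiples of k, where a is known, and gives 0. It equals (E - 1)^2 (E - b)^2 times four
  geometric quotients with nonnegative coefficients, and positivity allows these to be removed one
  at a time.\<close>

lemma second_difference_zero:
  assumes k: "k > 0" and b: "b > 0" and a: "\<And>q. a (k * q) = \<alpha> + (1 - \<alpha>) * (b ^ k) ^ q"
    and nonneg: "\<And>n. 0 \<le> seq_diff 1 1 (seq_diff b 1 (seq_diff 1 1 (seq_diff b 1 a))) n"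
  shows "seq_diff 1 1 (seq_diff b 1 (seq_diff 1 1 (seq_diff b 1 a))) 0 = 0"
proof -
  define s where "s = seq_diff 1 1 (seq_diff b 1 (seq_diff 1 1 (seq_diff b 1 a)))"
  define G where "G = seq_geom b k s"
  define G2 where "G2 = seq_geom 1 k G"
  define G3 where "G3 = seq_geom b k G2"
  have s0: "0 \<le> s n" for n using nonneg by (simp add: s_def)
  have nn: "0 \<le> G n" "0 \<le> G2 n" "0 \<le> G3 n" for n
    using b by (auto simp: G_def G2_def G3_def intro!: seq_geom_nonneg s0)
  have swap: "seq_geom q k (seq_geom r k t) = seq_geom r k (seq_geom q k t)" for q r t
    unfolding seq_geom_def fun_eq_iff sum_distrib_left
    by (subst sum.swap) (simp add: mult_ac add_ac)
  have "seq_geom 1 k G3 = seq_diff 1 k (seq_diff b k (seq_diff 1 k (seq_diff b k a)))"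
    unfolding G3_def G2_def G_def s_def
    by (simp only: seq_diff_eq_geom[of _ k] seq_diff_geom_commute swap[of 1 b])
  moreover have "\<dots> 0 = 0"
  proof -
    \<comment> \<open>Only the values of a at 0, k, ..., 4 k occur; E^k - 1 kills the constant part
      and E^k - c the geometric one.\<close>
    define c where "c = b ^ k"
    have "a 0 = 1" "a k = \<alpha> + (1 - \<alpha>) * c" "a (k + k) = \<alpha> + (1 - \<alpha>) * c ^ 2"
      "a (k + k + k) = \<alpha> + (1 - \<alpha>) * c ^ 3" "a (k + k + k + k) = \<alpha> + (1 - \<alpha>) * c ^ 4"
      using a[of 0] a[of 1] a[of 2] a[of 3] a[of 4] by (simp_all add: c_def eval_nat_numeral add.assoc)
    note vals = this
    show ?thesis
      by (simp only: seq_diff_def c_def[symmetric] add_0 power_one vals)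
        (simp add: eval_nat_numeral algebra_simps)
  qed
  ultimately have "seq_geom 1 k G3 0 = 0" by simp
  \<comment> \<open>The quotients are peeled off from the outside, keeping each time the term at
    index 0.\<close>
  then have "G3 0 \<le> 0" using seq_geom_ge[of 1 G3 k 0] nn k by simp
  then have "b ^ (k - 1) * G2 0 \<le> 0"
    using seq_geom_ge[of b G2 k 0] nn k b by (simp add: G3_def)
  then have "G2 0 \<le> 0" using zero_less_power[OF b, of "k - 1"] by (auto simp: mult_le_0_iff)
  then have "G 0 \<le> 0" using seq_geom_ge[of 1 G k 0] nn k by (simp add: G2_def)
  then have "b ^ (k - 1) * s 0 \<le> 0"
    using seq_geom_ge[of b s k 0] s0 k b by (simp add: G_def)
  then have "s 0 \<le> 0" using zero_less_power[OF b, of "k - 1"] by (auto simp: mult_le_0_iff)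
  then show ?thesis using s0[of 0] by (simp add: s_def)
qed

text \<open>The characteristic roots are 1 and b, so a solution with \<open>e 0 = 0\<close> is
  \<open>e 1\<close> times a geometric sum. That sum is positive at k, also when b = 1.\<close>

lemma two_term_recurrence_unique:
  fixes e :: "nat \<Rightarrow> real"
  assumes rec: "\<And>n. e (Suc (Suc n)) - (1 + b) * e (Suc n) + b * e n = 0"
    and e: "e 0 = 0" "e k = 0" and k: "k > 0" and b: "b > 0"
  shows "e n = 0"
proof -
  have step: "e (Suc n) = e 1 + b * e n" for n
  proof (induction n)
    case (Suc n)
    then show ?case using rec[of n] by (simp add: algebra_simps)
  qed (simp add: e)
  have sol: "e n = e 1 * (\<Sum>i<n. b ^ i)" for n
  proof (induction n)
    case (Suc n)
    have "(\<Sum>i<Suc n. b ^ i) = 1 + b * (\<Sum>i<n. b ^ i)"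
      by (simp add: sum.lessThan_Suc_shift sum_distrib_left del: sum.lessThan_Suc)
    then show ?case using step[of n] Suc by (simp add: algebra_simps)
  qed (simp add: e)
  have "(\<Sum>i<k. b ^ i) > 0" using k b by (intro sum_pos) auto
  then have "e 1 = 0" using sol[of k] e by simp
  then show ?thesis using sol[of n] by simp
qed

context complex_hilbert
begin

text \<open>
  With \<open>P = N\<^sup>* N\<close>, the numbers \<open>\<parallel>N\<^sup>n x\<parallel>\<^sup>2 = \<langle>P\<^sup>n x, x\<rangle>\<close> are the moments of a spectral measure
  on the half-line. If every \<open>k\<close>-th of them is as for the atoms \<open>1\<close> and \<open>b\<close>, then
  \<open>(P\<^sup>k - 1) (P\<^sup>k - b\<^sup>k) x = 0\<close>; dividing by operators that are bounded below gives
  \<open>(P - 1) (P - b) x = 0\<close>.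
\<close>

lemma normal_two_atoms:
  assumes N: "normal_op H N" and x: "x \<in> hcarrier H" and k: "k > 0" and b: "b > 0"
    and moments: "\<And>q. (hnorm H ((N ^^ (k * q)) x))\<^sup>2 = \<alpha> + (1 - \<alpha>) * (b ^ k) ^ q"
  shows "(hnorm H ((N ^^ n) x))\<^sup>2 = \<alpha> + (1 - \<alpha>) * b ^ n"
proof -
  have Nb: "bounded_op H N" using N by (simp add: normal_op_def)
  define M where "M = adj H N"
  define P where "P = (\<lambda>y. M (N y))"
  have Nc: "N y \<in> hcarrier H" and Mc: "M y \<in> hcarrier H" if "y \<in> hcarrier H" for y
    using that Nb adj_closed[OF Nb] by (auto simp: M_def bounded_op_def linear_map_def)
  have MN: "M (N y) = N (M y)" if "y \<in> hcarrier H" for y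
    using that N by (simp add: M_def normal_op_def)
  have NM: "hinner H (N y) z = hinner H y (M z)" "hinner H (M y) z = hinner H y (N z)"
    if "y \<in> hcarrier H" "z \<in> hcarrier H" for y z
    using that inner_adj[OF Nb] inner_adj'[OF Nb] by (auto simp: M_def)
  have P_eq: "P y = M (N y)" for y by (simp add: P_def)
  have Pc: "P y \<in> hcarrier H" if "y \<in> hcarrier H" for y using that by (simp add: P_eq Nc Mc)
  have Pnc: "(P ^^ n) y \<in> hcarrier H" and Nnc: "(N ^^ n) y \<in> hcarrier H" if "y \<in> hcarrier H" for n y
    using that by (induction n) (simp_all add: Pc Nc)
  have P_self: "hinner H (P y) z = hinner H y (P z)" if "y \<in> hcarrier H" "z \<in> hcarrier H" for y z
    using that by (simp add: P_eq NM Nc Mc)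
  have "P (N y) = N (P y)" if "y \<in> hcarrier H" for y
    using that by (simp add: P_eq MN Nc)
  then have PN: "(P ^^ n) (N y) = N ((P ^^ n) y)" if "y \<in> hcarrier H" for n y
    by (induction n) (simp_all add: Pnc that)
  \<comment> \<open>P commutes with N, so one factor of P at a time is split into an N on each
    side.\<close>
  have diag: "hinner H ((P ^^ n) y) y = hinner H ((N ^^ n) y) ((N ^^ n) y)" if "y \<in> hcarrier H" for n y
    using that
  proof (induction n arbitrary: y)
    case (Suc n)
    have "hinner H ((P ^^ Suc n) y) y = hinner H ((P ^^ n) (N y)) (N y)"
      using Suc.prems by (simp add: P_eq NM(2) Nc Pnc PN)
    also have "\<dots> = hinner H ((N ^^ n) (N y)) ((N ^^ n) (N y))"
      using Suc.prems by (intro Suc.IH Nc)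
    finally show ?case by (simp add: funpow_swap1)
  qed simp
  define a where "a n = (hnorm H ((N ^^ n) x))\<^sup>2" for n
  define w where "w n = (P ^^ n) x" for n
  have wc: "w n \<in> hcarrier H" for n by (simp add: w_def Pnc x)
  have ww: "hinner H (w i) (w j) = of_real (a (i + j))" for i j
  proof (induction j arbitrary: i)
    case 0
    show ?case by (simp add: w_def diag x a_def inner_self Nnc)
  next
    case (Suc j)
    have "hinner H (w i) (w (Suc j)) = hinner H (w (Suc i)) (w j)"
      by (simp add: w_def P_self[symmetric] Pnc x)
    then show ?case by (simp add: Suc)
  qed
  have NN: "hinner H (N (w i)) (N (w j)) = of_real (a (Suc (i + j)))" for i j
    using ww[of i "Suc j"] by (simp add: w_def P_eq NM Nc Pnc x)
  \<comment> \<open>This is \<open>P ^^ n\<close> applied to (P - 1) (P - b) x.\<close>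
  define z where "z n = hadd H (hdiff H (w (n + 2)) (hscale H (of_real (1 + b)) (w (n + 1)))) (hscale H (of_real b) (w n))" for n
  have zc: "z n \<in> hcarrier H" for n by (simp add: z_def closed wc)
  define s where "s = seq_diff 1 1 (seq_diff b 1 (seq_diff 1 1 (seq_diff b 1 a)))"
  \<comment> \<open>The coefficients of (t - 1)^2 (t - b)^2.\<close>
  have s_eq: "s n = a (n + 4) - 2 * (1 + b) * a (n + 3) + ((1 + b)\<^sup>2 + 2 * b) * a (n + 2)
      - 2 * b * (1 + b) * a (n + 1) + b\<^sup>2 * a n" for n
    by (simp add: s_def seq_diff_def eval_nat_numeral algebra_simps)
  have zz: "hinner H (z i) (z i) = of_real (s (2 * i))" for i
    unfolding s_eq z_def
    by (simp only: inner_simps closed wc ww complex_cnj_complex_of_real)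
      (simp add: eval_nat_numeral algebra_simps)
  have Nz: "N (z i) = hadd H (hdiff H (N (w (i + 2))) (hscale H (of_real (1 + b)) (N (w (i + 1)))))
      (hscale H (of_real b) (N (w i)))" for i
    unfolding z_def hdiff_def
    by (simp only: bounded_op_add[OF Nb] bounded_op_scale[OF Nb] closed wc)
  have NzNz: "hinner H (N (z i)) (N (z i)) = of_real (s (Suc (2 * i)))" for i
    unfolding s_eq Nz
    by (simp only: inner_simps closed wc Nc NN complex_cnj_complex_of_real)
      (simp add: eval_nat_numeral algebra_simps)
  \<comment> \<open>Even indices give the squared norm of \<open>z i\<close>, odd ones that of
    \<open>N (z i)\<close>, the inner product of \<open>P (z i)\<close> with
    \<open>z i\<close>.\<close>
  have s_nonneg: "0 \<le> s n" for n
  proof (cases "even n")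
    case True
    then obtain i where "n = 2 * i" by blast
    then show ?thesis using inner_nonneg[OF zc[of i]] by (simp add: zz)
  next
    case False
    then obtain i where "n = Suc (2 * i)" using oddE by fastforce
    then show ?thesis using inner_nonneg[OF Nc[OF zc[of i]]] by (simp add: NzNz)
  qed
  have a_mult: "a (k * q) = \<alpha> + (1 - \<alpha>) * (b ^ k) ^ q" for q
    using moments by (simp add: a_def)
  have "s 0 = 0"
    unfolding s_def by (rule second_difference_zero[OF k b a_mult s_nonneg[unfolded s_def]])
  then have "z 0 = hzero H" using zz[of 0] by (intro inner_definite zc) simp
  \<comment> \<open>Pairing (P - 1) (P - b) x = 0 with \<open>w n\<close> turns it into a recurrence
    for a.\<close>
  then have z0w: "hinner H (z 0) (w n) = 0" for n by (simp add: inner_zero_left wc)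
  have "hinner H (z 0) (w n) = of_real (a (Suc (Suc n)) - (1 + b) * a (Suc n) + b * a n)" for n
    by (simp only: z_def inner_simps closed wc ww)
      (simp add: eval_nat_numeral algebra_simps)
  then have rec: "a (Suc (Suc n)) = (1 + b) * a (Suc n) - b * a n" for n
    unfolding z0w by (smt (verit) of_real_eq_0_iff)
  define e where "e n = a n - (\<alpha> + (1 - \<alpha>) * b ^ n)" for n
  have "e n = 0"
  proof (rule two_term_recurrence_unique[OF _ _ _ k b])
    show "e (Suc (Suc m)) - (1 + b) * e (Suc m) + b * e m = 0" for m
      unfolding e_def rec by (simp add: algebra_simps)
    show "e 0 = 0" "e k = 0" using a_mult[of 0] a_mult[of 1] by (simp_all add: e_def)
  qed
  then have "a n = \<alpha> + (1 - \<alpha>) * b ^ n" by (simp add: e_def)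
  then show ?thesis by (simp add: a_def)
qed

end

lemma subnormal_two_atoms:
  assumes H: "complex_hilbert H" and S: "subnormal H S" and x: "x \<in> hcarrier H" and k: "k > 0" and b: "b > 0"
    and moments: "\<And>q. (hnorm H ((S ^^ (k * q)) x))\<^sup>2 = \<alpha> + (1 - \<alpha>) * (b ^ k) ^ q"
  shows "(hnorm H ((S ^^ n) x))\<^sup>2 = \<alpha> + (1 - \<alpha>) * b ^ n"
proof -
  obtain K :: "(nat \<times> 'a \<Rightarrow> complex) hilbert" and \<iota> N where "normal_extension H S K \<iota> N"
    and Sb: "bounded_op H S" using S by (auto simp: subnormal_def)
  then have K: "complex_hilbert K" and \<iota>: "linear_map H K \<iota>" and N: "normal_op K N"
    and iso: "\<And>x. x \<in> hcarrier H \<Longrightarrow> hnorm K (\<iota> x) = hnorm H x"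
    and N\<iota>: "\<And>x. x \<in> hcarrier H \<Longrightarrow> N (\<iota> x) = \<iota> (S x)"
    by (auto simp: normal_extension_def hnorm_def)
  interpret K: complex_hilbert K by (rule K)
  have "(S ^^ n) x \<in> hcarrier H \<and> (N ^^ n) (\<iota> x) = \<iota> ((S ^^ n) x)" for n
    using x Sb by (induction n) (auto simp: N\<iota> bounded_op_def linear_map_def)
  then have eq: "hnorm K ((N ^^ n) (\<iota> x)) = hnorm H ((S ^^ n) x)" for n by (simp add: iso)
  have "\<iota> x \<in> hcarrier K" using \<iota> x by (auto simp: linear_map_def)
  then show ?thesis
    using K.normal_two_atoms[OF N _ k b, of "\<iota> x" \<alpha> n] moments by (simp add: eq)
qed

section \<open>Weighted composition operators on square-summable functions\<close>

definition fibre :: "'a set \<Rightarrow> ('a \<Rightarrow> 'a) \<Rightarrow> 'a \<Rightarrow> 'a set" where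
  "fibre X T u = {x \<in> X. T x = u}"

lemma bij_betw_fibres: "T \<in> X \<rightarrow> X \<Longrightarrow> bij_betw (\<lambda>x. (T x, x)) X (Sigma X (fibre X T))"
  by (auto simp: bij_betw_def inj_on_def fibre_def)

lemma infsum_fibres:
  fixes F :: "'a \<Rightarrow> 'b :: banach"
  assumes T: "T \<in> X \<rightarrow> X" and F: "F summable_on X"
  shows "infsum F X = (\<Sum>\<^sub>\<infinity>u\<in>X. infsum F (fibre X T u))"
proof -
  have "(\<lambda>p. F (snd p)) summable_on Sigma X (fibre X T)"
    using summable_on_reindex_bij_betw[OF bij_betw_fibres[OF T], of "\<lambda>p. F (snd p)"] F by simp
  then have "(\<Sum>\<^sub>\<infinity>u\<in>X. infsum F (fibre X T u)) = (\<Sum>\<^sub>\<infinity>p\<in>Sigma X (fibre X T). F (snd p))"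
    using infsum_Sigma_banach[of "\<lambda>p. F (snd p)" X "fibre X T"] by simp
  then show ?thesis
    using infsum_reindex_bij_betw[OF bij_betw_fibres[OF T], of "\<lambda>p. F (snd p)"] by simp
qed

lemma summable_on_fibresI:
  fixes F :: "'a \<Rightarrow> real"
  assumes T: "T \<in> X \<rightarrow> X" and F: "\<And>u. u \<in> X \<Longrightarrow> (F has_sum g u) (fibre X T u)"
    and g: "g summable_on X" and nonneg: "\<And>x. x \<in> X \<Longrightarrow> 0 \<le> F x"
  shows "F summable_on X"
proof -
  have "(\<lambda>p. F (snd p)) summable_on Sigma X (fibre X T)"
    using F g nonneg by (intro summable_on_SigmaI[where g = g]) (auto simp: fibre_def)
  then show ?thesis
    using summable_on_reindex_bij_betw[OF bij_betw_fibres[OF T], of "\<lambda>p. F (snd p)"] by simp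
qed

text \<open>The carrier is a parameter because the same form serves for the shift and its Cauchy
  dual on the whole space and for an isometry on the cycle alone.\<close>

definition wcomp :: "'a set \<Rightarrow> ('a \<Rightarrow> 'a) \<Rightarrow> ('a \<Rightarrow> real) \<Rightarrow> ('a \<Rightarrow> complex) \<Rightarrow> 'a \<Rightarrow> complex" where
  "wcomp X T w f = (\<lambda>x. if x \<in> X then complex_of_real (w x) * f (T x) else 0)"

text \<open>Distinct fibres are disjoint, so the images of distinct basis vectors are orthogonal.
  Hence A* A, for A the operator \<open>wcomp X T w\<close>, is multiplication by q, and the bound
  on q makes A bounded.\<close>

locale weighted_composition =
  fixes X :: "'a set" and T :: "'a \<Rightarrow> 'a" and w q :: "'a \<Rightarrow> real" and B :: real
  assumes T: "T \<in> X \<rightarrow> X"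
    and q: "u \<in> X \<Longrightarrow> ((\<lambda>x. (w x)\<^sup>2) has_sum q u) (fibre X T u)"
    and q_le: "u \<in> X \<Longrightarrow> q u \<le> B"
begin

lemma q_nonneg: "u \<in> X \<Longrightarrow> 0 \<le> q u"
  using q by (rule has_sum_nonneg) auto

lemma wcomp_norm_sq_fibre:
  assumes "u \<in> X"
  shows "((\<lambda>x. (cmod (wcomp X T w f x))\<^sup>2) has_sum q u * (cmod (f u))\<^sup>2) (fibre X T u)"
proof -
  have "((\<lambda>x. (w x)\<^sup>2 * (cmod (f u))\<^sup>2) has_sum q u * (cmod (f u))\<^sup>2) (fibre X T u)"
    by (intro has_sum_cmult_left q assms)
  then show ?thesis
    by (rule has_sum_cong[THEN iffD1, rotated])
      (auto simp: wcomp_def fibre_def norm_mult power_mult_distrib)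
qed

lemma wcomp_carrier:
  assumes f: "f \<in> hcarrier (ell2 X)"
  shows "wcomp X T w f \<in> hcarrier (ell2 X)"
proof -
  have "(\<lambda>u. B * (cmod (f u))\<^sup>2) summable_on X"
    using f by (intro summable_on_cmult_right) (simp add: ell2_carrier)
  then have "(\<lambda>u. q u * (cmod (f u))\<^sup>2) summable_on X"
    by (rule summable_on_comparison_test) (auto intro!: mult_right_mono mult_nonneg_nonneg q_le q_nonneg)
  then have "(\<lambda>x. (cmod (wcomp X T w f x))\<^sup>2) summable_on X"
    by (rule summable_on_fibresI[OF T wcomp_norm_sq_fibre, rotated]) auto
  then show ?thesis by (simp add: ell2_carrier wcomp_def)
qed

lemma wcomp_inner:
  assumes f: "f \<in> hcarrier (ell2 X)" and g: "g \<in> hcarrier (ell2 X)"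
  shows "hinner (ell2 X) (wcomp X T w f) (wcomp X T w g) = hinner (ell2 X) f (\<lambda>u. of_real (q u) * g u)"
proof -
  have "hinner (ell2 X) (wcomp X T w f) (wcomp X T w g) =
      (\<Sum>\<^sub>\<infinity>u\<in>X. \<Sum>\<^sub>\<infinity>x\<in>fibre X T u. wcomp X T w f x * cnj (wcomp X T w g x))"
    unfolding ell2_inner
    by (intro infsum_fibres T ell2_summable wcomp_carrier f g)
  also have "\<dots> = (\<Sum>\<^sub>\<infinity>u\<in>X. f u * cnj (of_real (q u) * g u))"
  proof (rule infsum_cong)
    fix u assume u: "u \<in> X"
    have "((\<lambda>x. complex_of_real ((w x)\<^sup>2) * (f u * cnj (g u))) has_sum of_real (q u) * (f u * cnj (g u))) (fibre X T u)"
      by (intro has_sum_cmult_left has_sum_of_real q u)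
    then have "((\<lambda>x. wcomp X T w f x * cnj (wcomp X T w g x)) has_sum of_real (q u) * (f u * cnj (g u))) (fibre X T u)"
      by (rule has_sum_cong[THEN iffD1, rotated])
        (auto simp: wcomp_def fibre_def power2_eq_square)
    then show "(\<Sum>\<^sub>\<infinity>x\<in>fibre X T u. wcomp X T w f x * cnj (wcomp X T w g x)) = f u * cnj (of_real (q u) * g u)"
      by (subst infsumI) (auto simp: mult_ac)
  qed
  finally show ?thesis by (simp add: ell2_inner)
qed

text \<open>One application of the operator is absorbed into the weight d; iterating this computes
  the norms of powers. The bounds on d ensure summability.\<close>

lemma wcomp_norm_sq_weighted:
  assumes f: "f \<in> hcarrier (ell2 X)" and d: "\<And>x. x \<in> X \<Longrightarrow> 0 \<le> d x" "\<And>x. x \<in> X \<Longrightarrow> d x \<le> 1"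
  shows "(\<Sum>\<^sub>\<infinity>x\<in>X. d x * (cmod (wcomp X T w f x))\<^sup>2) =
    (\<Sum>\<^sub>\<infinity>u\<in>X. (\<Sum>\<^sub>\<infinity>x\<in>fibre X T u. (w x)\<^sup>2 * d x) * (cmod (f u))\<^sup>2)"
proof -
  have "(\<lambda>x. (cmod (wcomp X T w f x))\<^sup>2) summable_on X"
    using wcomp_carrier[OF f] by (simp add: ell2_carrier)
  then have "(\<lambda>x. d x * (cmod (wcomp X T w f x))\<^sup>2) summable_on X"
    using d by - (rule summable_on_comparison_test[where f = "\<lambda>x. (cmod (wcomp X T w f x))\<^sup>2"],
      auto intro: mult_left_le_one_le)
  then have "(\<Sum>\<^sub>\<infinity>x\<in>X. d x * (cmod (wcomp X T w f x))\<^sup>2) =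
      (\<Sum>\<^sub>\<infinity>u\<in>X. \<Sum>\<^sub>\<infinity>x\<in>fibre X T u. d x * (cmod (wcomp X T w f x))\<^sup>2)"
    by (rule infsum_fibres[OF T])
  also have "\<dots> = (\<Sum>\<^sub>\<infinity>u\<in>X. \<Sum>\<^sub>\<infinity>x\<in>fibre X T u. (w x)\<^sup>2 * d x * (cmod (f u))\<^sup>2)"
    by (intro infsum_cong) (auto simp: wcomp_def fibre_def norm_mult power_mult_distrib mult_ac)
  finally show ?thesis by (simp add: infsum_cmult_left')
qed

lemma wcomp_norm_sq:
  assumes f: "f \<in> hcarrier (ell2 X)"
  shows "(hnorm (ell2 X) (wcomp X T w f))\<^sup>2 = (\<Sum>\<^sub>\<infinity>u\<in>X. q u * (cmod (f u))\<^sup>2)"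
proof -
  have "(hnorm (ell2 X) (wcomp X T w f))\<^sup>2 =
      (\<Sum>\<^sub>\<infinity>u\<in>X. (\<Sum>\<^sub>\<infinity>x\<in>fibre X T u. (w x)\<^sup>2) * (cmod (f u))\<^sup>2)"
    unfolding ell2_norm_sq using wcomp_norm_sq_weighted[OF f, of "\<lambda>_. 1"] by simp
  also have "\<dots> = (\<Sum>\<^sub>\<infinity>u\<in>X. q u * (cmod (f u))\<^sup>2)"
    using q by (intro infsum_cong) (simp add: infsumI)
  finally show ?thesis .
qed

lemma mult_q_carrier:
  assumes f: "f \<in> hcarrier (ell2 X)"
  shows "(\<lambda>u. of_real (q u) * f u) \<in> hcarrier (ell2 X)"
proof -
  have "(\<lambda>u. B\<^sup>2 * (cmod (f u))\<^sup>2) summable_on X"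
    using f by (intro summable_on_cmult_right) (simp add: ell2_carrier)
  then have "(\<lambda>u. (cmod (of_real (q u) * f u))\<^sup>2) summable_on X"
    by (rule summable_on_comparison_test)
      (auto simp: norm_mult power_mult_distrib intro!: mult_right_mono power_mono q_le q_nonneg)
  then show ?thesis using f by (simp add: ell2_carrier)
qed

lemma bounded_op_wcomp: "bounded_op (ell2 X) (wcomp X T w)"
proof -
  have bd: "hnorm (ell2 X) (wcomp X T w f) \<le> sqrt \<bar>B\<bar> * hnorm (ell2 X) f" if f: "f \<in> hcarrier (ell2 X)" for f
  proof (rule power2_le_imp_le)
    have 1: "(\<lambda>u. \<bar>B\<bar> * (cmod (f u))\<^sup>2) summable_on X"
      using f by (intro summable_on_cmult_right) (simp add: ell2_carrier)
    have le: "q u * (cmod (f u))\<^sup>2 \<le> \<bar>B\<bar> * (cmod (f u))\<^sup>2" if "u \<in> X" for u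
      using q_le[OF that] by (intro mult_right_mono) auto
    have 2: "(\<lambda>u. q u * (cmod (f u))\<^sup>2) summable_on X"
      using 1 by (rule summable_on_comparison_test) (simp_all add: le q_nonneg)
    show "(hnorm (ell2 X) (wcomp X T w f))\<^sup>2 \<le> (sqrt \<bar>B\<bar> * hnorm (ell2 X) f)\<^sup>2"
      unfolding wcomp_norm_sq[OF f] unfolding power_mult_distrib ell2_norm_sq
      using infsum_mono[OF 2 1 le] by (simp add: infsum_cmult_right')
    show "0 \<le> sqrt \<bar>B\<bar> * hnorm (ell2 X) f"
      by (simp add: hnorm_def ell2_inner_self infsum_nonneg)
  qed
  have "linear_map (ell2 X) (ell2 X) (wcomp X T w)"
    unfolding linear_map_def
    by (auto simp: wcomp_carrier) (auto simp: wcomp_def fun_eq_iff distrib_left)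
  with bd show ?thesis unfolding bounded_op_def by blast
qed

lemma adj_wcomp_wcomp:
  assumes f: "f \<in> hcarrier (ell2 X)"
  shows "adj (ell2 X) (wcomp X T w) (wcomp X T w f) = (\<lambda>u. of_real (q u) * f u)"
proof -
  interpret complex_hilbert "ell2 X" by (rule complex_hilbert_ell2)
  show ?thesis
    using f by (intro adj_eqI wcomp_carrier mult_q_carrier wcomp_inner)
qed

text \<open>A* A is multiplication by q >= 1, so its inverse divides by q; applying A afterwards
  evaluates this factor at \<open>T x\<close>.\<close>

lemma cauchy_dual_wcomp:
  assumes q1: "\<And>u. u \<in> X \<Longrightarrow> 1 \<le> q u" and f: "f \<in> hcarrier (ell2 X)"
  shows "cauchy_dual (ell2 X) (wcomp X T w) f = wcomp X T (\<lambda>x. w x / q (T x)) f"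
proof -
  let ?g = "\<lambda>u. of_real (1 / q u) * f u"
  let ?D = "\<lambda>y. adj (ell2 X) (wcomp X T w) (wcomp X T w y)"
  have "(\<lambda>u. (cmod (f u))\<^sup>2) summable_on X" using f by (simp add: ell2_carrier)
  then have "(\<lambda>u. (cmod (?g u))\<^sup>2) summable_on X"
  proof (rule summable_on_comparison_test)
    show "(cmod (?g u))\<^sup>2 \<le> (cmod (f u))\<^sup>2" if "u \<in> X" for u
    proof -
      have "\<bar>1 / q u\<bar> \<le> 1" using q1[OF that] by simp
      then have "(\<bar>1 / q u\<bar> * cmod (f u))\<^sup>2 \<le> (1 * cmod (f u))\<^sup>2"
        by (intro power_mono mult_right_mono) auto
      then show ?thesis by (simp add: norm_mult norm_divide)
    qed
  qed auto
  then have g: "?g \<in> hcarrier (ell2 X)" using f by (simp add: ell2_carrier)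
  have Dg: "?D ?g = f"
    unfolding adj_wcomp_wcomp[OF g]
  proof
    fix u
    show "of_real (q u) * (of_real (1 / q u) * f u) = f u"
      using q1[of u] f by (cases "u \<in> X") (auto simp: ell2_carrier)
  qed
  have "inj_on ?D (hcarrier (ell2 X))"
  proof (rule inj_onI)
    fix h k assume hk: "h \<in> hcarrier (ell2 X)" "k \<in> hcarrier (ell2 X)" "?D h = ?D k"
    have eq: "of_real (q u) * h u = of_real (q u) * k u" for u
      using hk(3) unfolding adj_wcomp_wcomp[OF hk(1)] adj_wcomp_wcomp[OF hk(2)] by (rule fun_cong)
    show "h = k"
    proof
      show "h u = k u" for u
        using eq[of u] q1[of u] hk(1,2) by (cases "u \<in> X") (auto simp: ell2_carrier)
    qed
  qed
  then have "inv_into (hcarrier (ell2 X)) ?D f = ?g"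
    by (rule inv_into_f_eq[where f = ?D and x = ?g, OF _ g Dg])
  then show ?thesis
    unfolding cauchy_dual_def by (simp add: wcomp_def fun_eq_iff)
qed

end

lemma shift_eq_wcomp: "shift M T = wcomp (space M) T (weight M T)"
  by (simp add: shift_def wcomp_def fun_eq_iff)

lemma norm_sq_wcomp_basis_vec:
  assumes "u \<in> X"
  shows "(hnorm (ell2 X) (wcomp X T w (basis_vec u)))\<^sup>2 = (\<Sum>\<^sub>\<infinity>x\<in>fibre X T u. (w x)\<^sup>2)"
  unfolding ell2_norm_sq
  by (intro infsum_cong_neutral) (auto simp: wcomp_def fibre_def basis_vec_def)

section \<open>The one-cycle graph of a two-isometric shift\<close>

lemma periodic_decreasing_const:
  fixes f :: "nat \<Rightarrow> real"
  assumes dec: "\<And>j. f (Suc j) \<le> f j" and per: "\<And>j. f (j + k) = f j" and k: "1 \<le> k"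
  shows "f j = f 0"
proof -
  have anti: "antimono f" using dec by (rule antimonoI[OF lift_Suc_antimono_le])
  have "f (j * k) = f 0" for j
  proof (induction j)
    case (Suc j)
    then show ?case using per[of "j * k"] by (simp add: add.commute)
  qed simp
  then have "f 0 = f (j * k)" by simp
  also have "\<dots> \<le> f j" using k by (intro antimonoD[OF anti]) simp
  finally show ?thesis using antimonoD[OF anti, of 0 j] by simp
qed

lemma has_sum_diff_real:
  fixes f g :: "'a \<Rightarrow> real"
  assumes "(f has_sum a) A" "(g has_sum b) A"
  shows "((\<lambda>x. f x - g x) has_sum (a - b)) A"
  using has_sum_add[OF assms(1) has_sum_cmult_right[OF assms(2), of "-1"]] by simp

locale one_cycle_two_isometry =
  fixes M :: "'a measure" and T :: "'a \<Rightarrow> 'a"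
    and \<kappa> :: nat and v :: "nat \<Rightarrow> 'a" and \<R> :: "'a set set"
  assumes M: "discrete_measure_space M"
    and T: "T \<in> space M \<rightarrow> space M"
    and bdd: "ess_bounded M (h_fun M T)"
    and conn: "graph_connected (space M) (edges M T)"
    and one_cycle: "one_cycle_type (space M) (edges M T) \<kappa> v \<R>"
    and \<R>_ne: "\<R> \<noteq> {}"
    and two_iso: "two_isometric (ell2 (space M)) (shift M T)"
begin

abbreviation X :: "'a set" where "X \<equiv> space M"
abbreviation \<mu> :: "'a \<Rightarrow> real" where "\<mu> x \<equiv> measure M {x}"
abbreviation wt :: "'a \<Rightarrow> real" where "wt \<equiv> weight M T"
abbreviation c :: "'a \<Rightarrow> real" where "c \<equiv> c_coeff M T"
abbreviation ch :: "'a \<Rightarrow> 'a set" where "ch \<equiv> fibre X T"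

text \<open>This is the squared norm of the image of the basis vector at u, equivalently the value
  of h_T at u. \<open>has_sum_weight_sq\<close> shows that the sum is not a default value.\<close>

definition q :: "'a \<Rightarrow> real" where "q u = (\<Sum>\<^sub>\<infinity>x\<in>ch u. (wt x)\<^sup>2)"

lemma T_in [simp]: "x \<in> X \<Longrightarrow> T x \<in> X"
  using T by auto

lemma \<mu>_pos: "x \<in> X \<Longrightarrow> 0 < \<mu> x"
  using M by (auto simp: discrete_measure_space_def measure_def enn2real_positive_iff)

lemma weight_sq: "(wt x)\<^sup>2 = \<mu> x / \<mu> (T x)"
  by (simp add: weight_def power_divide)

lemma weight_pos: "x \<in> X \<Longrightarrow> 0 < wt x"
  by (simp add: weight_def \<mu>_pos)

lemma shift_bounded: "bounded_op (ell2 X) (shift M T)"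
  by (rule bounded_op_shift[OF M T bdd])

lemma norm_shift_basis_vec: "(hnorm (ell2 X) (shift M T (basis_vec u)))\<^sup>2 = q u" if "u \<in> X"
  using that by (simp add: shift_eq_wcomp norm_sq_wcomp_basis_vec q_def)

lemma c_eq: "u \<in> X \<Longrightarrow> c u = 1 / q u"
  by (simp add: c_coeff_def norm_shift_basis_vec)

lemma has_sum_weight_sq: "u \<in> X \<Longrightarrow> ((\<lambda>x. (wt x)\<^sup>2) has_sum q u) (ch u)"
proof -
  assume u: "u \<in> X"
  have "shift M T (basis_vec u) \<in> hcarrier (ell2 X)"
    using bounded_op_closed[OF shift_bounded basis_vec_carrier[OF u]] .
  then have "(\<lambda>x. (cmod (shift M T (basis_vec u) x))\<^sup>2) summable_on X"
    by (simp add: ell2_carrier)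
  then have "(\<lambda>x. (cmod (shift M T (basis_vec u) x))\<^sup>2) summable_on ch u"
    by (rule summable_on_subset_banach) (auto simp: fibre_def)
  then have "(\<lambda>x. (wt x)\<^sup>2) summable_on ch u"
    by (rule summable_on_cong[THEN iffD1, rotated]) (auto simp: fibre_def shift_basis_vec)
  then show ?thesis by (simp add: q_def)
qed

lemma wcomp_shift: "\<exists>B. weighted_composition X T wt q B"
proof -
  obtain C where C: "\<And>f. f \<in> hcarrier (ell2 X) \<Longrightarrow> hnorm (ell2 X) (shift M T f) \<le> C * hnorm (ell2 X) f"
    using shift_bounded by (auto simp: bounded_op_def)
  have "q u \<le> C\<^sup>2" if u: "u \<in> X" for u
  proof -
    interpret complex_hilbert "ell2 X" by (rule complex_hilbert_ell2)
    have "(hnorm (ell2 X) (basis_vec u))\<^sup>2 = 1"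
      using inner_basis_vec[OF u, of "basis_vec u"] by (simp add: norm_sq basis_vec_carrier u) (simp add: basis_vec_def)
    then have "hnorm (ell2 X) (basis_vec u) = 1"
      using norm_ge_0[OF basis_vec_carrier[OF u]] by (simp add: power2_eq_1_iff)
    then have "hnorm (ell2 X) (shift M T (basis_vec u)) \<le> C"
      using C[OF basis_vec_carrier[OF u]] by simp
    then show ?thesis
      using power_mono[OF _ norm_ge_0[OF bounded_op_closed[OF shift_bounded basis_vec_carrier[OF u]]], of C 2]
      by (simp add: norm_shift_basis_vec u)
  qed
  then have "weighted_composition X T wt q (C\<^sup>2)"
    by unfold_locales (use T has_sum_weight_sq in auto)
  then show ?thesis by blast
qed

text \<open>The two-isometry identity paired with e_u is 1 - 2 \<parallel>S e_u\<parallel>^2 +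
  \<parallel>S^2 e_u\<parallel>^2 = 0, and the last norm is the sum of q over the children with the
  squared weights.\<close>

lemma two_isometric_sum: "((\<lambda>x. (wt x)\<^sup>2 * q x) has_sum 2 * q u - 1) (ch u)" if u: "u \<in> X"
proof -
  obtain B where "weighted_composition X T wt q B" using wcomp_shift by blast
  then interpret weighted_composition X T wt q B .
  interpret complex_hilbert "ell2 X" by (rule complex_hilbert_ell2)
  let ?S = "shift M T" and ?e = "basis_vec u"
  note S = shift_bounded
  have e: "?e \<in> hcarrier (ell2 X)" using u by (rule basis_vec_carrier)
  note Se = bounded_op_closed[OF S e]
  note SSe = bounded_op_closed[OF S Se]
  define F where "F x = q x * (cmod (?S ?e x))\<^sup>2" for x
  have "(\<lambda>x. B * (cmod (?S ?e x))\<^sup>2) summable_on X"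
    using Se by (intro summable_on_cmult_right) (simp add: ell2_carrier)
  then have F: "F summable_on X"
    unfolding F_def
    by (rule summable_on_comparison_test) (auto intro!: mult_right_mono mult_nonneg_nonneg q_le q_nonneg)
  have "(hnorm (ell2 X) (?S (?S ?e)))\<^sup>2 = infsum F X"
    unfolding F_def shift_eq_wcomp by (rule wcomp_norm_sq[OF Se[unfolded shift_eq_wcomp]])
  moreover have "infsum F X = (\<Sum>\<^sub>\<infinity>x\<in>ch u. (wt x)\<^sup>2 * q x)"
    by (rule infsum_cong_neutral) (auto simp: F_def fibre_def shift_basis_vec)
  moreover have "(hnorm (ell2 X) (?S (?S ?e)))\<^sup>2 = 2 * q u - 1"
  proof -
    have "hadd (ell2 X) (hdiff (ell2 X) ?e (hscale (ell2 X) 2 (adj (ell2 X) ?S (?S ?e))))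
        (adj (ell2 X) ?S (adj (ell2 X) ?S (?S (?S ?e)))) = hzero (ell2 X)"
      using two_iso e by (auto simp: two_isometric_def)
    then have "hinner (ell2 X) ?e (hadd (ell2 X) (hdiff (ell2 X) ?e (hscale (ell2 X) 2 (adj (ell2 X) ?S (?S ?e))))
        (adj (ell2 X) ?S (adj (ell2 X) ?S (?S (?S ?e))))) = hinner (ell2 X) ?e (hzero (ell2 X))"
      by (rule arg_cong)
    moreover have "hinner (ell2 X) ?e (hzero (ell2 X)) = 0"
      by (simp add: inner_basis_vec u)
    ultimately have "hinner (ell2 X) ?e ?e - 2 * hinner (ell2 X) (?S ?e) (?S ?e)
        + hinner (ell2 X) (?S (?S ?e)) (?S (?S ?e)) = 0"
      by (simp only: inner_simps closed e Se SSe adj_closed[OF S] complex_cnj_numeral inner_adj[OF S, symmetric])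
    moreover have "hinner (ell2 X) ?e ?e = 1"
      using inner_basis_vec[OF u, of ?e] by (simp add: basis_vec_def)
    ultimately have "complex_of_real (1 - 2 * q u + (hnorm (ell2 X) (?S (?S ?e)))\<^sup>2) = 0"
      using inner_self[OF Se] inner_self[OF SSe] by (simp add: norm_shift_basis_vec u)
    then show ?thesis unfolding of_real_eq_0_iff by simp
  qed
  moreover have "(\<lambda>x. (wt x)\<^sup>2 * q x) summable_on ch u"
  proof -
    have "F summable_on ch u"
      using F by (rule summable_on_subset_banach) (auto simp: fibre_def)
    then show ?thesis
      by (rule summable_on_cong[THEN iffD1, rotated]) (auto simp: F_def fibre_def shift_basis_vec)
  qed
  ultimately show ?thesis by (simp add: has_sum_infsum)
qed

text \<open>The defect of the overview, since \<open>\<mu> u * q u\<close> is the measure of the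
  fibre over u.\<close>

definition \<delta> :: "'a \<Rightarrow> real" where "\<delta> u = \<mu> u * (q u - 1)"

lemma defect_sum: "(\<delta> has_sum \<delta> u) (ch u)" if u: "u \<in> X"
proof -
  have "((\<lambda>x. \<mu> u * ((wt x)\<^sup>2 * q x - (wt x)\<^sup>2)) has_sum \<mu> u * ((2 * q u - 1) - q u)) (ch u)"
    by (intro has_sum_cmult_right has_sum_diff_real two_isometric_sum has_sum_weight_sq u)
  then have "((\<lambda>x. \<mu> u * ((wt x)\<^sup>2 * q x - (wt x)\<^sup>2)) has_sum \<delta> u) (ch u)"
    by (simp add: \<delta>_def)
  then show ?thesis
    by (rule has_sum_cong[THEN iffD1, rotated])
      (use \<mu>_pos[OF u] in \<open>auto simp: fibre_def weight_sq \<delta>_def field_simps\<close>)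
qed

text \<open>For a two-isometry \<parallel>S^n e_u\<parallel>^2 = 1 + n (q u - 1), which could not
  stay nonnegative for all n if q u < 1.\<close>

lemma q_ge_1: "u \<in> X \<Longrightarrow> 1 \<le> q u"
proof -
  assume u: "u \<in> X"
  have pos: "0 \<le> 1 + real n * (q x - 1)" if "x \<in> X" for n x
    using that
  proof (induction n arbitrary: x)
    case (Suc n)
    \<comment> \<open>Summing the induction hypothesis over the children with the squared weights
      gives 1 + (n + 1) (q x - 1).\<close>
    have "((\<lambda>y. (wt y)\<^sup>2 + real n * ((wt y)\<^sup>2 * q y - (wt y)\<^sup>2)) has_sum
        q x + real n * ((2 * q x - 1) - q x)) (ch x)"
      by (intro has_sum_cmult_right has_sum_diff_real has_sum_add two_isometric_sum has_sum_weight_sq Suc.prems)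
    moreover have "0 \<le> (wt y)\<^sup>2 + real n * ((wt y)\<^sup>2 * q y - (wt y)\<^sup>2)" if "y \<in> ch x" for y
    proof -
      have "0 \<le> (wt y)\<^sup>2 * (1 + real n * (q y - 1))"
        using that Suc.IH[of y] by (intro mult_nonneg_nonneg) (auto simp: fibre_def)
      then show ?thesis by (simp add: algebra_simps)
    qed
    ultimately have "0 \<le> q x + real n * ((2 * q x - 1) - q x)" by (rule has_sum_nonneg)
    then show ?case by (simp add: algebra_simps)
  qed simp
  show "1 \<le> q u"
  proof (rule ccontr)
    assume "\<not> 1 \<le> q u"
    then obtain n where "1 < real n * (1 - q u)"
      using reals_Archimedean3[of "1 - q u"] by auto
    then show False using pos[OF u, of n] by (simp add: algebra_simps)
  qed
qed

lemma defect_nonneg: "u \<in> X \<Longrightarrow> 0 \<le> \<delta> u"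
  using q_ge_1[of u] by (simp add: \<delta>_def)

lemma c_bounds: "u \<in> X \<Longrightarrow> 0 < c u" "u \<in> X \<Longrightarrow> c u \<le> 1" "u \<in> X \<Longrightarrow> c u * q u = 1"
  using q_ge_1[of u] by (auto simp: c_eq)

section \<open>The cycle, indexed periodically, and the vertices attached to it\<close>

definition vc :: "nat \<Rightarrow> 'a" where "vc j = v (j mod \<kappa>)"
definition Cyc :: "'a set" where "Cyc = v ` {..<\<kappa>}"
text \<open>By \<open>bij_betw_roots\<close> these are the roots of the trees attached at
  \<open>vc j\<close>; so \<open>\<tau> j\<close> is the inner sum in
  \<open>C_const\<close>.\<close>

definition off :: "nat \<Rightarrow> 'a set" where "off j = ch (vc j) - Cyc"
definition \<tau> :: "nat \<Rightarrow> real" where "\<tau> j = (\<Sum>\<^sub>\<infinity>x\<in>off j. (wt x)\<^sup>2)"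

lemma \<kappa>_pos: "1 \<le> \<kappa>" and Cyc_sub: "Cyc \<subseteq> X" and inj_v: "inj_on v {..<\<kappa>}"
  using one_cycle by (auto simp: one_cycle_type_def Cyc_def)

lemma vc_Cyc [simp]: "vc j \<in> Cyc"
  using \<kappa>_pos by (auto simp: vc_def Cyc_def)

lemma vc_in [simp]: "vc j \<in> X"
  using Cyc_sub by auto

lemma Cyc_eq: "Cyc = range vc"
proof
  show "Cyc \<subseteq> range vc"
    by (auto simp: Cyc_def vc_def image_iff) (metis mod_less)
qed auto

lemma vc_periodic [simp]: "vc (j + \<kappa>) = vc j"
  by (simp add: vc_def)

lemma T_vc [simp]: "T (vc (Suc j)) = vc j"
proof -
  have e: "T y = x" if "(x, y) \<in> edges M T" for x y using that by (auto simp: edges_def)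
  have step: "T (v (Suc i)) = v i" if "Suc i < \<kappa>" for i
    using one_cycle that by (intro e) (auto simp: one_cycle_type_def)
  have last: "T (v 0) = v (\<kappa> - 1)"
    using one_cycle by (intro e) (auto simp: one_cycle_type_def)
  show ?thesis
  proof (cases "Suc (j mod \<kappa>) = \<kappa>")
    case True
    then have "j mod \<kappa> = \<kappa> - 1" by simp
    with True last show ?thesis by (simp add: vc_def mod_Suc)
  next
    case False
    then have "Suc (j mod \<kappa>) < \<kappa>" using \<kappa>_pos mod_less_divisor[of \<kappa> j] by linarith
    with False step show ?thesis by (simp add: vc_def mod_Suc)
  qed
qed

lemma vc_eq_iff: "vc i = vc j \<longleftrightarrow> i mod \<kappa> = j mod \<kappa>"
  using \<kappa>_pos inj_v by (auto simp: vc_def inj_on_def)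

lemma T_Cyc: "x \<in> Cyc \<Longrightarrow> T x \<in> Cyc"
proof -
  assume "x \<in> Cyc"
  then obtain j where "x = vc j" by (auto simp: Cyc_eq)
  \<comment> \<open>Adding a period first keeps the truncated predecessor harmless at j = 0.\<close>
  then have "x = vc (Suc (j + \<kappa> - 1))" using \<kappa>_pos by simp
  then show ?thesis by (simp del: vc_periodic)
qed

lemma ch_vc: "ch (vc j) = insert (vc (Suc j)) (off j)"
proof -
  have "x = vc (Suc j)" if x: "x \<in> Cyc" "T x = vc j" for x
  proof -
    obtain i where i: "x = vc (Suc (i + \<kappa> - 1))"
    proof -
      obtain i where "x = vc i" using x by (auto simp: Cyc_eq)
      then have "x = vc (Suc (i + \<kappa> - 1))" using \<kappa>_pos by simp
      then show thesis by (rule that)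
    qed
    then have "(i + \<kappa> - 1) mod \<kappa> = j mod \<kappa>" using x(2) T_vc vc_eq_iff by metis
    then show ?thesis unfolding i vc_eq_iff by (simp add: mod_Suc)
  qed
  then show ?thesis by (auto simp: off_def fibre_def)
qed

lemma off_sub: "off j \<subseteq> X" "off j \<subseteq> ch (vc j)" "vc i \<notin> off j"
  by (auto simp: off_def fibre_def)

lemma sum_ch_vc:
  fixes F :: "'a \<Rightarrow> real"
  assumes "(F has_sum S) (ch (vc j))"
  shows "F summable_on off j" "S = F (vc (Suc j)) + infsum F (off j)"
proof -
  show s: "F summable_on off j"
    using assms off_sub(2) by (meson summable_on_def summable_on_subset_banach)
  show "S = F (vc (Suc j)) + infsum F (off j)"
    using infsumI[OF assms] infsum_insert[OF s, of "vc (Suc j)"] off_sub(3)[of "Suc j" j] by (simp add: ch_vc)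
qed

lemma defect_vc_const: "\<delta> (vc j) = \<delta> (vc 0)"
  and defect_off: "x \<in> off j \<Longrightarrow> \<delta> x = 0"
proof -
  have nn: "0 \<le> infsum \<delta> (off i)" for i
    using off_sub(1) defect_nonneg by (intro infsum_nonneg) blast
  have step: "\<delta> (vc i) = \<delta> (vc (Suc i)) + infsum \<delta> (off i)" for i
    by (rule sum_ch_vc(2)[OF defect_sum]) simp
  have const: "\<delta> (vc i) = \<delta> (vc 0)" for i
  proof (rule periodic_decreasing_const[of "\<lambda>j. \<delta> (vc j)" \<kappa>])
    show "\<delta> (vc (Suc j)) \<le> \<delta> (vc j)" for j using step[of j] nn[of j] by simp
  qed (use \<kappa>_pos in auto)
  then show "\<delta> (vc j) = \<delta> (vc 0)" .
  \<comment> \<open>The sum over \<open>off j\<close> is the drop from \<open>vc j\<close> to its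
    successor, and there is no drop.\<close>
  have "infsum \<delta> (off j) \<le> 0" using step[of j] const[of j] const[of "Suc j"] by simp
  then show "\<delta> x = 0" if "x \<in> off j"
    by (rule nonneg_infsum_le_0D[OF _ sum_ch_vc(1)[OF defect_sum[OF vc_in]] _ that])
      (use off_sub(1) defect_nonneg in blast)
qed

text \<open>Along an undirected path from the cycle to x, a step to a child costs one more
  application of T, and a step to the parent costs none because T preserves the cycle.\<close>

lemma reaches_cycle: "x \<in> X \<Longrightarrow> \<exists>n. (T ^^ n) x \<in> Cyc"
proof -
  assume x: "x \<in> X"
  have "(vc 0, x) \<in> (edges M T \<union> (edges M T)\<inverse>)\<^sup>*"
    using conn x by (auto simp: graph_connected_def)
  then show ?thesis
  proof (induction rule: rtrancl_induct)
    case base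
    show ?case by (intro exI[of _ 0]) simp
  next
    case (step y z)
    then obtain n where n: "(T ^^ n) y \<in> Cyc" by blast
    from step(2) consider "T z = y" | "T y = z" by (auto simp: edges_def)
    then show ?case
    proof cases
      case 1
      then have "(T ^^ Suc n) z \<in> Cyc" using n by (simp add: funpow_swap1)
      then show ?thesis by blast
    next
      case 2
      have "T ((T ^^ n) y) \<in> Cyc" using n by (rule T_Cyc)
      then have "(T ^^ n) z \<in> Cyc" using 2 by (simp add: funpow_swap1)
      then show ?thesis by blast
    qed
  qed
qed

text \<open>Induction on the number of steps to the cycle: if the parent has defect 0, its children
  have nonnegative defects with sum 0.\<close>

lemma defect_off_cycle: "\<lbrakk>x \<in> X; x \<notin> Cyc\<rbrakk> \<Longrightarrow> \<delta> x = 0"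
proof -
  assume "x \<in> X" "x \<notin> Cyc"
  moreover obtain n where "(T ^^ n) x \<in> Cyc" using reaches_cycle \<open>x \<in> X\<close> by blast
  ultimately show ?thesis
  proof (induction n arbitrary: x)
    case (Suc n)
    have x: "x \<in> ch (T x)" using Suc.prems by (simp add: fibre_def)
    show ?case
    proof (cases "T x \<in> Cyc")
      case True
      then obtain j where "T x = vc j" by (auto simp: Cyc_eq)
      then have "x \<in> off j" using x Suc.prems by (simp add: off_def)
      then show ?thesis by (rule defect_off)
    next
      case False
      then have "\<delta> (T x) = 0" using Suc.prems by (intro Suc.IH) (simp_all add: funpow_swap1)
      then have sum: "(\<delta> has_sum 0) (ch (T x))" using defect_sum[of "T x"] Suc.prems by simp
      show ?thesis
        by (rule nonneg_infsum_le_0D[OF _ _ _ x])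
          (use sum defect_nonneg in \<open>auto simp: infsumI fibre_def summable_on_def\<close>)
    qed
  qed simp
qed

lemma q_off_cycle: "\<lbrakk>x \<in> X; x \<notin> Cyc\<rbrakk> \<Longrightarrow> q x = 1"
  using defect_off_cycle[of x] \<mu>_pos[of x] by (simp add: \<delta>_def)

lemma c_off_cycle: "\<lbrakk>x \<in> X; x \<notin> Cyc\<rbrakk> \<Longrightarrow> c x = 1"
  by (simp add: c_eq q_off_cycle)

lemma \<tau>_nonneg: "0 \<le> \<tau> j"
  by (simp add: \<tau>_def infsum_nonneg)

lemma q_vc: "q (vc j) = (wt (vc (Suc j)))\<^sup>2 + \<tau> j"
  using sum_ch_vc(2)[OF has_sum_weight_sq[OF vc_in]] by (simp add: \<tau>_def)

section \<open>The trees and their roots\<close>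

lemma \<R>_partition: "partition_on (X - Cyc) \<R>"
  and \<R>_tree: "R \<in> \<R> \<Longrightarrow> rooted_directed_tree R (induced (edges M T) R)"
  and \<R>_attach: "R \<in> \<R> \<Longrightarrow> \<exists>!i. i < \<kappa> \<and> (v i, root_of (edges M T) R) \<in> edges M T"
  using one_cycle unfolding one_cycle_type_def Cyc_def by blast+

abbreviation rt :: "'a set \<Rightarrow> 'a" where "rt \<equiv> root_of (edges M T)"
abbreviation att :: "'a set \<Rightarrow> nat" where "att \<equiv> attach_index (edges M T) \<kappa> v"

lemma rt_eq: "\<lbrakk>R \<in> \<R>; is_root R (induced (edges M T) R) w\<rbrakk> \<Longrightarrow> rt R = w"
  and rt_in: "R \<in> \<R> \<Longrightarrow> rt R \<in> R"
proof -
  assume R: "R \<in> \<R>"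
  then have ex: "\<exists>!w. is_root R (induced (edges M T) R) w"
    using \<R>_tree by (auto simp: rooted_directed_tree_def)
  show "rt R \<in> R"
    using theI'[OF ex] by (simp add: root_of_def is_root_def)
  show "rt R = w" if "is_root R (induced (edges M T) R) w"
    unfolding root_of_def using ex that by (rule the1_equality)
qed

lemma att: "R \<in> \<R> \<Longrightarrow> att R < \<kappa> \<and> T (rt R) = v (att R)"
  using theI'[OF \<R>_attach, of R] by (auto simp: attach_index_def edges_def)

lemma att_eq: "\<lbrakk>R \<in> \<R>; T (rt R) = v i; i < \<kappa>\<rbrakk> \<Longrightarrow> att R = i"
  using att[of R] inj_v by (auto simp: inj_on_def)

lemma \<R>_sub: "R \<in> \<R> \<Longrightarrow> R \<subseteq> X - Cyc"
  using \<R>_partition by (auto simp: partition_on_def)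

text \<open>The only parent of x is \<open>T x\<close>. If that lies on the cycle, x has no parent
  inside its own block, so it is the root there.\<close>

lemma bij_betw_roots: "bij_betw rt {R \<in> \<R>. att R = j mod \<kappa>} (off j)"
  unfolding bij_betw_def
proof
  show "inj_on rt {R \<in> \<R>. att R = j mod \<kappa>}"
  proof (rule inj_onI)
    fix R R' assume "R \<in> {R \<in> \<R>. att R = j mod \<kappa>}" "R' \<in> {R \<in> \<R>. att R = j mod \<kappa>}" "rt R = rt R'"
    then show "R = R'"
      using rt_in[of R] rt_in[of R'] \<R>_partition by (auto simp: partition_on_def disjoint_def)
  qed
  show "rt ` {R \<in> \<R>. att R = j mod \<kappa>} = off j"
  proof (intro equalityI subsetI)
    fix x assume "x \<in> rt ` {R \<in> \<R>. att R = j mod \<kappa>}"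
    then obtain R where R: "R \<in> \<R>" "att R = j mod \<kappa>" "x = rt R" by blast
    then show "x \<in> off j"
      using att[of R] rt_in[of R] \<R>_sub[of R] by (auto simp: off_def fibre_def vc_def)
  next
    fix x assume x: "x \<in> off j"
    then have "x \<in> X - Cyc" and Tx: "T x = vc j" by (auto simp: off_def fibre_def)
    then obtain R where R: "R \<in> \<R>" "x \<in> R" using \<R>_partition by (auto simp: partition_on_def)
    have "is_root R (induced (edges M T) R) x"
      using R Tx \<R>_sub[OF R(1)] by (auto simp: is_root_def induced_def edges_def)
    then have "rt R = x" by (rule rt_eq[OF R(1)])
    moreover have "att R = j mod \<kappa>"
      using R Tx calculation \<kappa>_pos by (intro att_eq) (auto simp: vc_def)
    ultimately show "x \<in> rt ` {R \<in> \<R>. att R = j mod \<kappa>}" using R by blast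
  qed
qed

lemma roots_sum: "(\<Sum>\<^sub>\<infinity>R\<in>{R \<in> \<R>. att R = j mod \<kappa>}. (wt (rt R))\<^sup>2) = \<tau> j"
  unfolding \<tau>_def by (rule infsum_reindex_bij_betw[OF bij_betw_roots])

text \<open>Here the existence of a tree enters; it makes the defect on the cycle positive.\<close>

lemma \<tau>_pos_ex: "\<exists>j<\<kappa>. 0 < \<tau> j"
proof -
  obtain R where R: "R \<in> \<R>" using \<R>_ne by blast
  have "rt R \<in> off (att R)"
    using bij_betw_roots[of "att R"] att[OF R] R by (auto simp: bij_betw_def)
  moreover have "\<tau> (att R) \<noteq> 0"
  proof
    assume "\<tau> (att R) = 0"
    then have "(wt (rt R))\<^sup>2 = 0"
      unfolding \<tau>_def
      by (intro nonneg_infsum_le_0D[OF _ sum_ch_vc(1)[OF has_sum_weight_sq[OF vc_in]] _ \<open>rt R \<in> off (att R)\<close>]) auto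
    then show False using weight_pos[of "rt R"] rt_in[OF R] \<R>_sub[OF R] by auto
  qed
  ultimately show ?thesis using att[OF R] \<tau>_nonneg[of "att R"] by (intro exI[of _ "att R"]) simp
qed

lemma \<tau>_mod: "\<tau> (j mod \<kappa>) = \<tau> j"
  by (simp add: \<tau>_def off_def vc_def)

text \<open>With zero defect, q would be 1 on the cycle, and the measure would shrink by the factor
  \<open>1 - \<tau> j\<close> in each step. Returning to the start would force every
  \<open>\<tau> j\<close> to vanish.\<close>

lemma defect_pos: "0 < \<delta> (vc 0)"
proof (rule ccontr)
  assume "\<not> 0 < \<delta> (vc 0)"
  then have "\<delta> (vc j) = 0" for j
    using defect_vc_const[of j] defect_nonneg[of "vc 0"] by simp
  then have "\<mu> (vc j) = 0 \<or> q (vc j) = 1" for j by (simp add: \<delta>_def)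
  then have "q (vc j) = 1" for j using \<mu>_pos[of "vc j"] by (metis less_irrefl vc_in)
  then have step: "\<mu> (vc (Suc j)) = \<mu> (vc j) * (1 - \<tau> j)" for j
    using q_vc[of j] \<mu>_pos[of "vc j"] by (simp add: weight_sq field_simps)
  have const: "\<mu> (vc j) = \<mu> (vc 0)" for j
  proof (rule periodic_decreasing_const[of "\<lambda>j. \<mu> (vc j)" \<kappa>])
    show "\<mu> (vc (Suc j)) \<le> \<mu> (vc j)" for j
      unfolding step using \<mu>_pos[of "vc j"] \<tau>_nonneg[of j] by (simp add: mult_left_le)
  qed (use \<kappa>_pos in auto)
  have "\<tau> j = 0" for j
    using step[of j] const[of j] const[of "Suc j"] \<mu>_pos[of "vc j"] by simp
  then show False using \<tau>_pos_ex by auto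
qed

lemma c_vc_less_1: "c (vc j) < 1"
proof -
  have "0 < \<mu> (vc j) * (q (vc j) - 1)"
    using defect_pos defect_vc_const[of j] by (simp add: \<delta>_def)
  then have "1 < q (vc j)"
    using \<mu>_pos[of "vc j"] by (simp add: zero_less_mult_iff)
  then show ?thesis by (simp add: c_eq)
qed

end

section \<open>Integrals with respect to two-point measures\<close>

lemma integral_two_point_measure:
  fixes f :: "real \<Rightarrow> real"
  assumes \<alpha>: "0 \<le> \<alpha>" "\<alpha> \<le> 1" and b: "0 \<le> b" "b < 1" and f: "f \<in> borel_measurable borel"
  shows "(LINT t:{0..1}|two_point_measure \<alpha> b 1. f t) = (1 - \<alpha>) * f b + \<alpha> * f 1"
proof -
  let ?N = "two_point_measure \<alpha> b 1"
  have meas: "borel_measurable ?N = borel_measurable borel"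
    by (rule measurable_cong_sets) (simp_all add: sets_two_point_measure)
  have em: "emeasure ?N {b} = ennreal (1 - \<alpha>)" "emeasure ?N {1} = ennreal \<alpha>"
    "emeasure ?N (- {b, 1}) = 0"
    using b by (simp_all add: emeasure_two_point_measure)
  have m: "measure ?N {b} = 1 - \<alpha>" "measure ?N {1} = \<alpha>"
    using \<alpha> by (simp_all add: measure_def em)
  have AE: "AE t in ?N. t \<in> {b, 1}"
    using em(3) by (intro AE_I[of _ _ "- {b, 1}"]) (auto simp: sets_two_point_measure)
  have "(LINT t:{0..1}|?N. f t) = (LINT t|?N. indicator {b} t *\<^sub>R f b + indicator {1} t *\<^sub>R f 1)"
    unfolding set_lebesgue_integral_def
  proof (rule integral_cong_AE)
    show "(\<lambda>t. indicator {0..1} t *\<^sub>R f t) \<in> borel_measurable ?N"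
      unfolding meas using f by measurable
    show "(\<lambda>t. indicator {b} t *\<^sub>R f b + indicator {1} t *\<^sub>R f 1) \<in> borel_measurable ?N"
      unfolding meas by measurable
    show "AE t in ?N. indicator {0..1} t *\<^sub>R f t = indicator {b} t *\<^sub>R f b + indicator {1} t *\<^sub>R f 1"
      using AE by eventually_elim (use b in \<open>auto simp: indicator_def\<close>)
  qed
  also have "\<dots> = measure ?N {b} *\<^sub>R f b + measure ?N {1} *\<^sub>R f 1"
    by (subst Bochner_Integration.integral_add)
      (auto simp: sets_two_point_measure em intro!: integrable_scaleR_left)
  finally show ?thesis by (simp add: m)
qed

context one_cycle_two_isometry
begin

section \<open>The Cauchy dual\<close>

text \<open>These are the factors of \<open>Lam\<close>: as T takes \<open>vc (Suc j)\<close> to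
  \<open>vc j\<close>, \<open>Lam\<close> is the product of the dual weights along the
  cycle.\<close>

definition dual_weight :: "'a \<Rightarrow> real" where "dual_weight x = wt x * c (T x)"

abbreviation S' :: "('a \<Rightarrow> complex) \<Rightarrow> 'a \<Rightarrow> complex" where
  "S' \<equiv> cauchy_dual (ell2 X) (shift M T)"

lemma cauchy_dual_eq: "f \<in> hcarrier (ell2 X) \<Longrightarrow> S' f = wcomp X T dual_weight f"
proof -
  assume f: "f \<in> hcarrier (ell2 X)"
  obtain B where "weighted_composition X T wt q B" using wcomp_shift by blast
  then interpret weighted_composition X T wt q B .
  show ?thesis
    unfolding shift_eq_wcomp
    by (subst cauchy_dual_wcomp[OF _ f]) (auto simp: q_ge_1 wcomp_def dual_weight_def c_eq fun_eq_iff)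
qed

lemma has_sum_dual_weight_sq: "u \<in> X \<Longrightarrow> ((\<lambda>x. (dual_weight x)\<^sup>2) has_sum c u) (ch u)"
proof -
  assume u: "u \<in> X"
  have "((\<lambda>x. (wt x)\<^sup>2 * (c u)\<^sup>2) has_sum q u * (c u)\<^sup>2) (ch u)"
    by (intro has_sum_cmult_left has_sum_weight_sq u)
  moreover have "q u * (c u)\<^sup>2 = c u"
    using c_bounds(3)[OF u] by (simp add: power2_eq_square mult.assoc[symmetric] mult.commute)
  ultimately have "((\<lambda>x. (wt x)\<^sup>2 * (c u)\<^sup>2) has_sum c u) (ch u)" by simp
  then show ?thesis
    by (rule has_sum_cong[THEN iffD1, rotated]) (auto simp: fibre_def dual_weight_def power_mult_distrib)
qed

text \<open>Thus S'* S' is multiplication by c, the inverse of S* S, and S' is a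
  contraction.\<close>

sublocale dual: weighted_composition X T dual_weight c 1
  by unfold_locales (use T has_sum_dual_weight_sq c_bounds in auto)

lemma bounded_op_cauchy_dual: "bounded_op (ell2 X) S'"
  using bounded_op_cong[OF complex_hilbert_ell2 dual.bounded_op_wcomp] cauchy_dual_eq .

section \<open>Norms of the powers of the Cauchy dual, by recursion over the children\<close>

primrec dn :: "nat \<Rightarrow> 'a \<Rightarrow> real" where
  "dn 0 = (\<lambda>u. 1)"
| "dn (Suc n) = (\<lambda>u. (c u)\<^sup>2 * (\<Sum>\<^sub>\<infinity>x\<in>ch u. (wt x)\<^sup>2 * dn n x))"

lemma weight_mult_summable:
  assumes u: "u \<in> X" and d: "\<And>x. x \<in> X \<Longrightarrow> 0 \<le> d x \<and> d x \<le> 1"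
  shows "(\<lambda>x. (wt x)\<^sup>2 * d x) summable_on ch u"
    and "(\<Sum>\<^sub>\<infinity>x\<in>ch u. (wt x)\<^sup>2 * d x) \<le> q u"
proof -
  have q: "(\<lambda>x. (wt x)\<^sup>2) summable_on ch u"
    using has_sum_weight_sq[OF u] by (auto simp: summable_on_def)
  have le: "0 \<le> (wt x)\<^sup>2 * d x" "(wt x)\<^sup>2 * d x \<le> (wt x)\<^sup>2" if "x \<in> ch u" for x
    using that d[of x] by (auto simp: fibre_def intro: mult_left_le)
  show s: "(\<lambda>x. (wt x)\<^sup>2 * d x) summable_on ch u"
    using q by (rule summable_on_comparison_test) (simp_all add: le)
  show "(\<Sum>\<^sub>\<infinity>x\<in>ch u. (wt x)\<^sup>2 * d x) \<le> q u"
    unfolding q_def using s q le(2) by (rule infsum_mono)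
qed

lemma dn_bounds: "u \<in> X \<Longrightarrow> 0 \<le> dn n u \<and> dn n u \<le> 1"
  and dn_Suc_le: "u \<in> X \<Longrightarrow> dn (Suc n) u \<le> c u"
proof -
  have le: "dn (Suc n) u \<le> c u" if d: "\<And>x. x \<in> X \<Longrightarrow> 0 \<le> dn n x \<and> dn n x \<le> 1" and u: "u \<in> X" for n u
  proof -
    have "dn (Suc n) u \<le> (c u)\<^sup>2 * q u"
      using weight_mult_summable(2)[OF u d] by (simp add: mult_left_mono)
    also have "\<dots> = c u"
      using c_bounds(3)[OF u] by (simp add: power2_eq_square mult.assoc)
    finally show ?thesis .
  qed
  have bd: "\<forall>u\<in>X. 0 \<le> dn n u \<and> dn n u \<le> 1" for n
  proof (induction n)
    case (Suc n)
    have "0 \<le> dn (Suc n) u" if "u \<in> X" for u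
      using Suc by (auto simp: fibre_def intro!: mult_nonneg_nonneg infsum_nonneg)
    moreover have "dn (Suc n) u \<le> 1" if "u \<in> X" for u
      using le[of n u] Suc c_bounds(2)[OF that] that by force
    ultimately show ?case by blast
  qed simp
  show "u \<in> X \<Longrightarrow> 0 \<le> dn n u \<and> dn n u \<le> 1" using bd by blast
  show "u \<in> X \<Longrightarrow> dn (Suc n) u \<le> c u" using le bd by blast
qed

text \<open>Stated for all f, since S' does not map basis vectors to basis vectors, which the
  induction would require.\<close>

lemma norm_power_cauchy_dual:
  "f \<in> hcarrier (ell2 X) \<Longrightarrow> (hnorm (ell2 X) ((S' ^^ n) f))\<^sup>2 = (\<Sum>\<^sub>\<infinity>u\<in>X. dn n u * (cmod (f u))\<^sup>2)"
proof (induction n arbitrary: f)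
  case (Suc n)
  have S'f: "S' f \<in> hcarrier (ell2 X)"
    using bounded_op_closed[OF bounded_op_cauchy_dual Suc.prems] .
  have "(hnorm (ell2 X) ((S' ^^ Suc n) f))\<^sup>2 = (\<Sum>\<^sub>\<infinity>x\<in>X. dn n x * (cmod (wcomp X T dual_weight f x))\<^sup>2)"
    using Suc.IH[OF S'f] by (simp add: funpow_swap1 cauchy_dual_eq[OF Suc.prems])
  also have "\<dots> = (\<Sum>\<^sub>\<infinity>u\<in>X. (\<Sum>\<^sub>\<infinity>x\<in>ch u. (dual_weight x)\<^sup>2 * dn n x) * (cmod (f u))\<^sup>2)"
    using dn_bounds by (intro dual.wcomp_norm_sq_weighted Suc.prems) auto
  also have "\<dots> = (\<Sum>\<^sub>\<infinity>u\<in>X. dn (Suc n) u * (cmod (f u))\<^sup>2)"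
  proof (rule infsum_cong)
    fix u assume u: "u \<in> X"
    have "(\<Sum>\<^sub>\<infinity>x\<in>ch u. (dual_weight x)\<^sup>2 * dn n x) = (\<Sum>\<^sub>\<infinity>x\<in>ch u. (c u)\<^sup>2 * ((wt x)\<^sup>2 * dn n x))"
      by (intro infsum_cong) (auto simp: fibre_def dual_weight_def power_mult_distrib)
    then show "(\<Sum>\<^sub>\<infinity>x\<in>ch u. (dual_weight x)\<^sup>2 * dn n x) * (cmod (f u))\<^sup>2 = dn (Suc n) u * (cmod (f u))\<^sup>2"
      by (simp add: infsum_cmult_right')
  qed
  finally show ?case .
qed (simp add: ell2_norm_sq)

lemma norm_power_basis_vec: "u \<in> X \<Longrightarrow> (hnorm (ell2 X) ((S' ^^ n) (basis_vec u)))\<^sup>2 = dn n u"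
proof -
  assume u: "u \<in> X"
  have "(hnorm (ell2 X) ((S' ^^ n) (basis_vec u)))\<^sup>2 = (\<Sum>\<^sub>\<infinity>x\<in>X. dn n x * (cmod (basis_vec u x))\<^sup>2)"
    by (rule norm_power_cauchy_dual[OF basis_vec_carrier[OF u]])
  also have "\<dots> = (\<Sum>\<^sub>\<infinity>x\<in>{u}. dn n x)"
    using u by (intro infsum_cong_neutral) (auto simp: basis_vec_def)
  finally show ?thesis by simp
qed

lemma ch_off_cycle: "\<lbrakk>u \<notin> Cyc; x \<in> ch u\<rbrakk> \<Longrightarrow> x \<notin> Cyc"
  using T_Cyc by (auto simp: fibre_def)

lemma dn_off_cycle: "\<lbrakk>u \<in> X; u \<notin> Cyc\<rbrakk> \<Longrightarrow> dn n u = 1"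
proof (induction n arbitrary: u)
  case (Suc n)
  have "(\<Sum>\<^sub>\<infinity>x\<in>ch u. (wt x)\<^sup>2 * dn n x) = q u"
    unfolding q_def using Suc.IH ch_off_cycle[OF Suc.prems(2)]
    by (intro infsum_cong) (auto simp: fibre_def)
  then show ?case using Suc.prems by (simp add: q_off_cycle c_off_cycle)
qed simp

text \<open>The children are the next cycle vertex and tree roots; at the latter \<open>dn n\<close>
  is 1.\<close>

lemma dn_vc: "dn (Suc n) (vc j) = (c (vc j))\<^sup>2 * ((wt (vc (Suc j)))\<^sup>2 * dn n (vc (Suc j)) + \<tau> j)"
proof -
  have "infsum (\<lambda>x. (wt x)\<^sup>2 * dn n x) (off j) = \<tau> j"
    unfolding \<tau>_def using dn_off_cycle by (intro infsum_cong) (auto simp: off_def fibre_def)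
  moreover have "(\<lambda>x. (wt x)\<^sup>2 * dn n x) summable_on ch (vc j)"
    by (rule weight_mult_summable(1)) (simp_all add: dn_bounds)
  ultimately show ?thesis
    using sum_ch_vc(2)[OF has_sum_infsum] by simp
qed

section \<open>One turn around the cycle\<close>

lemma Lam_Suc: "Lam M T \<kappa> v m (Suc i) = Lam M T \<kappa> v m i * (wt (vc (Suc (m + i))) * c (vc (m + i)))"
  by (simp add: Lam_def vc_def)

text \<open>The weights are quotients of square roots of measures and telescope. Over a full period
  only the product of the c remains, the same for every starting point.\<close>

lemma Lam_closed: "Lam M T \<kappa> v m i = sqrt (\<mu> (vc (m + i))) / sqrt (\<mu> (vc m)) * (\<Prod>l<i. c (vc (m + l)))"
proof (induction i)
  case 0
  show ?case using \<mu>_pos[of "vc m"] by (simp add: Lam_def)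
next
  case (Suc i)
  then show ?case using \<mu>_pos[of "vc (m + i)"] by (simp add: Lam_Suc weight_def)
qed

text \<open>At i = \<kappa> the coefficient becomes D and the sum becomes C_m.\<close>

lemma dn_unroll: "dn (n + i) (vc m) = (Lam M T \<kappa> v m i)\<^sup>2 * dn n (vc (m + i))
    + (\<Sum>l<i. (c (vc (l + m)))\<^sup>2 * (Lam M T \<kappa> v m l)\<^sup>2 * \<tau> (l + m))"
proof (induction i arbitrary: n)
  case 0
  show ?case by (simp add: Lam_def)
next
  case (Suc i)
  have "dn (n + Suc i) (vc m) = (Lam M T \<kappa> v m i)\<^sup>2 * dn (Suc n) (vc (m + i))
    + (\<Sum>l<i. (c (vc (l + m)))\<^sup>2 * (Lam M T \<kappa> v m l)\<^sup>2 * \<tau> (l + m))"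
    using Suc[of "Suc n"] by simp
  then show ?case
    by (simp only: dn_vc Lam_Suc sum.lessThan_Suc power_mult_distrib add_Suc_right)
      (simp add: algebra_simps)
qed

lemma prod_c_shift: "(\<Prod>l<\<kappa>. c (vc (m + l))) = (\<Prod>l<\<kappa>. c (vc l))"
proof (induction m)
  case (Suc m)
  have "(\<Prod>l<Suc \<kappa>. c (vc (m + l))) = c (vc m) * (\<Prod>l<\<kappa>. c (vc (Suc m + l)))"
    by (subst prod.lessThan_Suc_shift) simp
  then have "(\<Prod>l<\<kappa>. c (vc (m + l))) * c (vc m) = c (vc m) * (\<Prod>l<\<kappa>. c (vc (Suc m + l)))"
    by simp
  then show ?case using c_bounds(1)[of "vc m"] Suc by simp
qed simp

section \<open>The constants D, C and \<alpha>\<close>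

abbreviation D :: real where "D \<equiv> D_const M T \<kappa> v"
abbreviation C :: "nat \<Rightarrow> real" where "C \<equiv> C_const M T \<kappa> v \<R>"
abbreviation \<alpha> :: "nat \<Rightarrow> real" where "\<alpha> \<equiv> alpha_const M T \<kappa> v \<R>"

lemma Lam_period: "Lam M T \<kappa> v m \<kappa> = (\<Prod>l<\<kappa>. c (vc l))"
  using \<mu>_pos[of "vc m"] by (simp add: Lam_closed prod_c_shift)

lemma Lam_period_sq: "(Lam M T \<kappa> v m \<kappa>)\<^sup>2 = D"
  by (simp add: D_const_def Lam_period)

lemma D_const_eq: "D = (\<Prod>i=0..\<kappa>-1. (c (v i))\<^sup>2)"
proof -
  have "{0..\<kappa>-1} = {..<\<kappa>}" using \<kappa>_pos by auto
  moreover have "c (vc l) = c (v l)" if "l < \<kappa>" for l using that by (simp add: vc_def)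
  ultimately show ?thesis by (simp add: D_const_def Lam_period prod_power_distrib)
qed

lemma D_bounds: "0 < D" "D < 1"
proof -
  define P where "P = (\<Prod>l<\<kappa>. c (vc l))"
  have D: "D = P\<^sup>2" by (simp add: D_const_def Lam_period P_def)
  have pos: "0 < P" unfolding P_def by (intro prod_pos) (simp add: c_bounds)
  obtain k where k: "\<kappa> = Suc k" using \<kappa>_pos by (cases \<kappa>) auto
  have "P = (\<Prod>l<k. c (vc l)) * c (vc k)" by (simp add: P_def k)
  also have "\<dots> \<le> 1 * c (vc k)"
    using c_bounds by (intro mult_right_mono prod_le_1) (auto intro: less_imp_le)
  also have "\<dots> < 1" using c_vc_less_1[of k] by simp
  finally have "P < 1" .
  then show "0 < D" "D < 1" using pos by (auto simp: D power_less_one_iff)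
qed

lemma C_const_eq: "C m = (\<Sum>l<\<kappa>. (c (vc (l + m)))\<^sup>2 * (Lam M T \<kappa> v m l)\<^sup>2 * \<tau> (l + m))"
proof -
  have "{0..\<kappa>-1} = {..<\<kappa>}" using \<kappa>_pos by auto
  then show ?thesis by (simp add: C_const_def roots_sum vc_def)
qed

lemma dn_period: "dn (n + \<kappa>) (vc m) = D * dn n (vc m) + C m"
  using dn_unroll[of n \<kappa> m] by (simp add: Lam_period_sq C_const_eq)

lemma C_pos: "0 < C m"
proof -
  obtain j where j: "j < \<kappa>" "0 < \<tau> j" using \<tau>_pos_ex by blast
  \<comment> \<open>This solves i + m = j modulo \<kappa> without subtracting: (\<kappa> - 1) m is
    congruent to -m.\<close>
  define i where "i = (j + (\<kappa> - 1) * m) mod \<kappa>"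
  have i: "i < \<kappa>" using \<kappa>_pos by (simp add: i_def)
  have "(i + m) mod \<kappa> = (j + (\<kappa> - 1) * m + m) mod \<kappa>" by (simp add: i_def mod_add_left_eq)
  also have "j + (\<kappa> - 1) * m + m = j + \<kappa> * m" using \<kappa>_pos by (cases \<kappa>) auto
  finally have "(i + m) mod \<kappa> = j" using j by simp
  then have \<tau>: "0 < \<tau> (i + m)" using j \<tau>_mod[of "i + m"] by simp
  have Lam: "0 < Lam M T \<kappa> v m i"
    unfolding Lam_closed using \<mu>_pos c_bounds by (intro mult_pos_pos divide_pos_pos prod_pos) auto
  show ?thesis
    unfolding C_const_eq
  proof (rule sum_pos2)
    show "0 < (c (vc (i + m)))\<^sup>2 * (Lam M T \<kappa> v m i)\<^sup>2 * \<tau> (i + m)"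
      using \<tau> Lam c_bounds(1)[of "vc (i + m)"] by simp
  qed (use i \<tau>_nonneg in auto)
qed

lemma \<alpha>_fix: "D * \<alpha> m + C m = \<alpha> m"
  using D_bounds by (simp add: alpha_const_def field_simps)

lemma dn_period_diff: "dn (n + \<kappa>) (vc m) - \<alpha> m = D * (dn n (vc m) - \<alpha> m)"
proof -
  have "C m = \<alpha> m - D * \<alpha> m" using \<alpha>_fix[of m] by simp
  then show ?thesis by (simp add: dn_period right_diff_distrib)
qed

lemma \<alpha>_pos: "0 < \<alpha> m"
  using C_pos D_bounds by (simp add: alpha_const_def)

text \<open>At n = 0 the period relation reads D + C_m = d_\<kappa>(v_m), which is at most c <
  1.\<close>

lemma \<alpha>_less_1: "\<alpha> m < 1"
proof -
  have "D + C m = dn \<kappa> (vc m)" using dn_period[of 0 m] by simp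
  also have "\<dots> \<le> c (vc m)" using dn_Suc_le[of "vc m" "\<kappa> - 1"] \<kappa>_pos by simp
  also have "\<dots> < 1" by (rule c_vc_less_1)
  finally show ?thesis using D_bounds by (simp add: alpha_const_def)
qed

text \<open>C_m can be read off from \<open>dn \<kappa> (vc m)\<close>, which depends on the vertex
  and not on its index.\<close>

lemma \<alpha>_cong: "vc i = vc j \<Longrightarrow> \<alpha> i = \<alpha> j"
  using dn_period[of 0 i] dn_period[of 0 j] by (simp add: alpha_const_def)

text \<open>The limit form of \<open>dn_vc\<close>, proved without limits. Let A be the error in the
  claimed identity. The deviations from \<alpha> at \<open>vc j\<close> and
  \<open>vc (Suc j)\<close> are related affinely with constant term -A, and both are multiplied by D
  over a period; hence (1 - D) A = 0.\<close>

lemma \<alpha>_rec: "\<alpha> j = (c (vc j))\<^sup>2 * ((wt (vc (Suc j)))\<^sup>2 * \<alpha> (Suc j) + \<tau> j)"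
proof -
  define A where "A = \<alpha> j - (c (vc j))\<^sup>2 * ((wt (vc (Suc j)))\<^sup>2 * \<alpha> (Suc j) + \<tau> j)"
  define K where "K = (c (vc j))\<^sup>2 * (wt (vc (Suc j)))\<^sup>2"
  have eq: "dn (Suc n) (vc j) - \<alpha> j = K * (dn n (vc (Suc j)) - \<alpha> (Suc j)) - A" for n
    by (simp only: dn_vc A_def K_def) (simp add: algebra_simps)
  define E where "E = dn 0 (vc (Suc j)) - \<alpha> (Suc j)"
  have "D * (K * E - A) = dn (Suc 0 + \<kappa>) (vc j) - \<alpha> j"
    unfolding E_def eq[of 0, symmetric] by (rule dn_period_diff[symmetric])
  also have "\<dots> = K * (D * E) - A"
    using eq[of \<kappa>] dn_period_diff[of 0 "Suc j"] by (simp only: E_def add_Suc add_0)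
  finally have "(1 - D) * A = 0" by (simp add: algebra_simps)
  then show ?thesis using D_bounds by (simp add: A_def)
qed

section \<open>Moments and subnormality\<close>

definition b :: real where "b = root \<kappa> D"

lemma b_bounds: "0 < b" "b < 1" and b_power: "b ^ \<kappa> = D"
  using D_bounds \<kappa>_pos by (simp_all add: b_def real_root_lt_1_iff)

lemma moment_eq:
  "(LINT t:{0..1}|two_point_measure (\<alpha> m) (root \<kappa> D) 1. t ^ n) = \<alpha> m + (1 - \<alpha> m) * b ^ n"
  using integral_two_point_measure[of "\<alpha> m" b "\<lambda>t. t ^ n"] \<alpha>_pos[of m] \<alpha>_less_1[of m] b_bounds
  by (simp add: b_def[symmetric])

lemma dn_multiple: "dn (\<kappa> * k) (vc m) = \<alpha> m + (1 - \<alpha> m) * D ^ k"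
proof (induction k)
  case (Suc k)
  have "dn (\<kappa> * Suc k) (vc m) = \<alpha> m + D * (dn (\<kappa> * k) (vc m) - \<alpha> m)"
    using dn_period_diff[of "\<kappa> * k" m] by (simp add: add.commute)
  then show ?case by (simp add: Suc)
qed simp

text \<open>Both sides have deviations from \<open>\<alpha> m\<close> that are multiplied by D =
  b^\<kappa> when n grows by \<kappa>.\<close>

lemma dn_extend:
  assumes "\<And>n. n < \<kappa> \<Longrightarrow> dn n (vc m) = \<alpha> m + (1 - \<alpha> m) * b ^ n"
  shows "dn n (vc m) = \<alpha> m + (1 - \<alpha> m) * b ^ n"
proof (induction n rule: less_induct)
  case (less n)
  show ?case
  proof (cases "n < \<kappa>")
    case False
    then obtain k where k: "n = k + \<kappa>" using le_Suc_ex[of \<kappa> n] by (auto simp: add.commute)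
    then have "dn k (vc m) = \<alpha> m + (1 - \<alpha> m) * b ^ k" using less \<kappa>_pos by simp
    moreover have "dn n (vc m) = \<alpha> m + D * (dn k (vc m) - \<alpha> m)"
      using dn_period_diff[of k m] by (simp add: k)
    ultimately show ?thesis by (simp add: k power_add b_power)
  qed (use assms in simp)
qed

lemma subnormal_imp_moments:
  assumes "subnormal (ell2 X) S'"
  shows "dn n (vc m) = \<alpha> m + (1 - \<alpha> m) * b ^ n"
proof -
  have "(hnorm (ell2 X) ((S' ^^ n) (basis_vec (vc m))))\<^sup>2 = \<alpha> m + (1 - \<alpha> m) * b ^ n"
    using \<kappa>_pos b_bounds
    by (intro subnormal_two_atoms[OF complex_hilbert_ell2 assms basis_vec_carrier, where k = \<kappa>])
      (auto simp: norm_power_basis_vec dn_multiple b_power)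
  then show ?thesis by (simp add: norm_power_basis_vec)
qed

text \<open>
  The atoms of the representing measures at \<open>1\<close> carry an isometry, those at \<open>b\<close> carry \<open>\<surd>b\<close> times
  an isometry, and \<open>S'\<close> is the restriction of the orthogonal sum of the two.
\<close>

definition p :: "'a \<Rightarrow> real" where
  "p x = (if x \<in> Cyc then \<alpha> (SOME j. vc j = x) else 1)"

text \<open>The choice of the index in \<open>p\<close> is immaterial by
  \<open>\<alpha>_cong\<close>.\<close>

lemma p_vc: "p (vc j) = \<alpha> j"
  using someI[of "\<lambda>i. vc i = vc j" j] by (auto simp: p_def intro: \<alpha>_cong)

lemma p_bounds: "0 < p x" "p x \<le> 1" "x \<in> Cyc \<Longrightarrow> p x < 1" and p_off: "x \<notin> Cyc \<Longrightarrow> p x = 1"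
  using \<alpha>_pos \<alpha>_less_1 by (auto simp: p_def less_imp_le)

text \<open>This makes S' isometric for the norm weighted by p. On the cycle it is
  \<open>\<alpha>_rec\<close>; on the trees p, q and c are all 1.\<close>

lemma has_sum_weight_p: "u \<in> X \<Longrightarrow> ((\<lambda>x. (dual_weight x)\<^sup>2 * p x) has_sum p u) (ch u)"
proof -
  assume u: "u \<in> X"
  have p01: "0 \<le> p x \<and> p x \<le> 1" if "x \<in> X" for x using p_bounds[of x] by simp
  have s: "((\<lambda>x. (wt x)\<^sup>2 * p x) has_sum (\<Sum>\<^sub>\<infinity>x\<in>ch u. (wt x)\<^sup>2 * p x)) (ch u)"
    by (rule has_sum_infsum[OF weight_mult_summable(1)[OF u p01]])
  have "(c u)\<^sup>2 * (\<Sum>\<^sub>\<infinity>x\<in>ch u. (wt x)\<^sup>2 * p x) = p u"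
  proof (cases "u \<in> Cyc")
    case True
    then obtain j where j: "u = vc j" by (auto simp: Cyc_eq)
    have "infsum (\<lambda>x. (wt x)\<^sup>2 * p x) (off j) = \<tau> j"
      unfolding \<tau>_def using p_off by (intro infsum_cong) (auto simp: off_def)
    then show ?thesis
      using sum_ch_vc(2)[OF s[unfolded j]] \<alpha>_rec[of j] by (simp add: j p_vc)
  next
    case False
    have "(\<Sum>\<^sub>\<infinity>x\<in>ch u. (wt x)\<^sup>2 * p x) = q u"
      unfolding q_def using ch_off_cycle[OF False] p_off by (intro infsum_cong) auto
    then show ?thesis using u False by (simp add: q_off_cycle c_off_cycle p_off)
  qed
  moreover have "((\<lambda>x. (c u)\<^sup>2 * ((wt x)\<^sup>2 * p x)) has_sum (c u)\<^sup>2 * (\<Sum>\<^sub>\<infinity>x\<in>ch u. (wt x)\<^sup>2 * p x)) (ch u)"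
    using s by (rule has_sum_cmult_right)
  ultimately have "((\<lambda>x. (c u)\<^sup>2 * ((wt x)\<^sup>2 * p x)) has_sum p u) (ch u)" by simp
  then show ?thesis
    by (rule has_sum_cong[THEN iffD1, rotated]) (auto simp: fibre_def dual_weight_def power_mult_distrib)
qed

lemma fibre_Cyc: "fibre Cyc T (vc j) = {vc (Suc j)}"
  using ch_vc[of j] Cyc_sub vc_Cyc[of "Suc j"] by (auto simp: fibre_def off_def)

lemma moments_imp_subnormal:
  assumes moments: "\<And>m n. dn n (vc m) = \<alpha> m + (1 - \<alpha> m) * b ^ n"
  shows "subnormal (ell2 X) S'"
proof -
  \<comment> \<open>The weights of S' conjugated by multiplication with the square root of p; for
    \<open>w2\<close>, with that of 1 - p, and divided by the square root of b. The latter is used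
    only on the cycle, where 1 - p is positive.\<close>
  define w1 where "w1 x = dual_weight x * sqrt (p x) / sqrt (p (T x))" for x
  define w2 where "w2 x = dual_weight x * sqrt (1 - p x) / (sqrt b * sqrt (1 - p (T x)))" for x
  have "((\<lambda>x. (w1 x)\<^sup>2) has_sum 1) (ch u)" if u: "u \<in> X" for u
  proof -
    have "((\<lambda>x. (dual_weight x)\<^sup>2 * p x * (1 / p u)) has_sum p u * (1 / p u)) (ch u)"
      by (intro has_sum_cmult_left has_sum_weight_p u)
    then have "((\<lambda>x. (dual_weight x)\<^sup>2 * p x * (1 / p u)) has_sum 1) (ch u)"
      using p_bounds(1)[of u] by simp
    then show ?thesis
      by (rule has_sum_cong[THEN iffD1, rotated])
        (use p_bounds(1) in \<open>auto simp: w1_def fibre_def power_mult_distrib power_divide less_imp_le\<close>)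
  qed
  then interpret V1: weighted_composition X T w1 "\<lambda>_. 1" 1
    by unfold_locales (use T in auto)
  have "((\<lambda>x. (w2 x)\<^sup>2) has_sum 1) (fibre Cyc T u)" if u: "u \<in> Cyc" for u
  proof -
    obtain j where j: "u = vc j" using u by (auto simp: Cyc_eq)
    \<comment> \<open>Subtracting \<open>\<alpha>_rec\<close> from \<open>dn_vc\<close> at n = 0
      leaves the right-hand side; the first moment makes the same difference equal to the left-hand
      side.\<close>
    have "b * (1 - \<alpha> j) = (dual_weight (vc (Suc j)))\<^sup>2 * (1 - \<alpha> (Suc j))"
      using dn_vc[of 0 j] moments[of 1 j] \<alpha>_rec[of j]
      by (simp add: dual_weight_def power_mult_distrib algebra_simps)
    moreover have "(w2 (vc (Suc j)))\<^sup>2 = (dual_weight (vc (Suc j)))\<^sup>2 * (1 - \<alpha> (Suc j)) / (b * (1 - \<alpha> j))"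
      using b_bounds \<alpha>_less_1[of j] \<alpha>_less_1[of "Suc j"]
      by (simp add: w2_def p_vc power_mult_distrib power_divide less_imp_le)
    moreover have "b * (1 - \<alpha> j) \<noteq> 0"
      using b_bounds \<alpha>_less_1[of j] by simp
    ultimately have "(w2 (vc (Suc j)))\<^sup>2 = 1" by simp
    then show ?thesis
      using has_sum_finite[of "{vc (Suc j)}" "\<lambda>x. (w2 x)\<^sup>2"] by (simp add: j fibre_Cyc)
  qed
  then interpret V2: weighted_composition Cyc T w2 "\<lambda>_. 1" 1
    by unfold_locales (use T_Cyc in auto)
  obtain N1 where N1: "normal_extension (ell2 X) (\<lambda>f. hscale (ell2 X) 1 (wcomp X T w1 f))
      (hsum (ell2 X) (ell2 X)) (\<lambda>f. (f, hzero (ell2 X))) N1"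
    using scaled_isometry_normal_extension[OF complex_hilbert_ell2 V1.bounded_op_wcomp, of 1]
      V1.wcomp_inner by auto
  obtain N2 where N2: "normal_extension (ell2 Cyc) (\<lambda>f. hscale (ell2 Cyc) (of_real (sqrt b)) (wcomp Cyc T w2 f))
      (hsum (ell2 Cyc) (ell2 Cyc)) (\<lambda>f. (f, hzero (ell2 Cyc))) N2"
    using scaled_isometry_normal_extension[OF complex_hilbert_ell2 V2.bounded_op_wcomp, of "of_real (sqrt b)"]
      V2.wcomp_inner by auto
  define J1 where "J1 f = (\<lambda>x. complex_of_real (sqrt (p x)) * f x)" for f :: "'a \<Rightarrow> complex"
  define J2 where "J2 f = (\<lambda>x. if x \<in> Cyc then complex_of_real (sqrt (1 - p x)) * f x else 0)"
    for f :: "'a \<Rightarrow> complex"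
  \<comment> \<open>Finiteness puts every \<open>J2 f\<close> into the carrier and makes the sums
    with factor 1 - p, which vanishes off the cycle, finite.\<close>
  have fin: "finite Cyc" by (simp add: Cyc_def)
  have J1_cl: "J1 f \<in> hcarrier (ell2 X)" if f: "f \<in> hcarrier (ell2 X)" for f
  proof -
    have "(\<lambda>x. (cmod (f x))\<^sup>2) summable_on X" using f by (simp add: ell2_carrier)
    then have "(\<lambda>x. (cmod (J1 f x))\<^sup>2) summable_on X"
      by (rule summable_on_comparison_test)
        (use p_bounds in \<open>auto simp: J1_def norm_mult power_mult_distrib less_imp_le intro: mult_left_le_one_le\<close>)
    then show ?thesis using f by (simp add: ell2_carrier J1_def)
  qed
  have J2_cl: "J2 f \<in> hcarrier (ell2 Cyc)" for f
    using fin by (simp add: ell2_carrier J2_def)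
  show ?thesis
  proof (rule subnormal_if_embeds_in_sum[OF bounded_op_cauchy_dual _ _ _ N1 N2])
    show "linear_map (ell2 X) (ell2 X) J1"
      unfolding linear_map_def by (auto simp: J1_cl) (auto simp: J1_def fun_eq_iff algebra_simps)
    show "linear_map (ell2 X) (ell2 Cyc) J2"
      unfolding linear_map_def by (auto simp: J2_cl) (auto simp: J2_def fun_eq_iff algebra_simps)
    fix f assume f: "f \<in> hcarrier (ell2 X)"
    show "hscale (ell2 X) 1 (wcomp X T w1 (J1 f)) = J1 (S' f)"
      using p_bounds(1)[THEN less_imp_neq] by (auto simp: cauchy_dual_eq[OF f] wcomp_def J1_def w1_def fun_eq_iff)
    show "hscale (ell2 Cyc) (of_real (sqrt b)) (wcomp Cyc T w2 (J2 f)) = J2 (S' f)"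
    proof
      fix x
      show "hscale (ell2 Cyc) (of_real (sqrt b)) (wcomp Cyc T w2 (J2 f)) x = J2 (S' f) x"
      proof (cases "x \<in> Cyc")
        case True
        then have "T x \<in> Cyc" "x \<in> X" using T_Cyc Cyc_sub by auto
        then show ?thesis
          using True p_bounds(3)[of "T x"] b_bounds
          by (simp add: cauchy_dual_eq[OF f] wcomp_def J2_def w2_def)
      qed (simp add: J2_def wcomp_def)
    qed
    fix g assume g: "g \<in> hcarrier (ell2 X)"
    have 1: "hinner (ell2 X) (J1 f) (J1 g) = (\<Sum>\<^sub>\<infinity>x\<in>X. of_real (p x) * (f x * cnj (g x)))"
      unfolding ell2_inner
    proof (rule infsum_cong)
      fix x
      have "complex_of_real (p x) = of_real (sqrt (p x)) * of_real (sqrt (p x))"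
        using p_bounds(1)[of x] by (simp flip: of_real_mult)
      then show "J1 f x * cnj (J1 g x) = of_real (p x) * (f x * cnj (g x))"
        by (simp add: J1_def)
    qed
    have 2: "hinner (ell2 Cyc) (J2 f) (J2 g) = (\<Sum>\<^sub>\<infinity>x\<in>X. of_real (1 - p x) * (f x * cnj (g x)))"
      unfolding ell2_inner
    proof (rule infsum_cong_neutral)
      fix x assume "x \<in> Cyc \<inter> X"
      have "complex_of_real (1 - p x) = of_real (sqrt (1 - p x)) * of_real (sqrt (1 - p x))"
        using p_bounds(2)[of x] by (simp flip: of_real_mult)
      then show "J2 f x * cnj (J2 g x) = of_real (1 - p x) * (f x * cnj (g x))"
        using \<open>x \<in> Cyc \<inter> X\<close> by (simp add: J2_def del: of_real_diff)
    qed (use Cyc_sub p_off in auto)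
    have s1: "(\<lambda>x. of_real (p x) * (f x * cnj (g x))) summable_on X"
    proof -
      have "(\<lambda>x. J1 f x * cnj (J1 g x)) summable_on X"
        by (intro ell2_summable J1_cl f g)
      moreover have "J1 f x * cnj (J1 g x) = of_real (p x) * (f x * cnj (g x))" for x
      proof -
        have "complex_of_real (p x) = of_real (sqrt (p x)) * of_real (sqrt (p x))"
          using p_bounds(1)[of x] by (simp flip: of_real_mult)
        then show ?thesis by (simp add: J1_def)
      qed
      ultimately show ?thesis by simp
    qed
    have s2: "(\<lambda>x. of_real (1 - p x) * (f x * cnj (g x))) summable_on X"
      by (rule finite_nonzero_values_imp_summable_on, rule finite_subset[OF _ fin]) (use p_off in fastforce)
    show "hinner (ell2 X) f g = hinner (ell2 X) (J1 f) (J1 g) + hinner (ell2 Cyc) (J2 f) (J2 g)"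
      unfolding 1 2 infsum_add[OF s1 s2, symmetric]
      by (simp add: ell2_inner algebra_simps)
  qed
qed

lemma subnormal_iff_moments:
  "subnormal (ell2 X) S' \<longleftrightarrow> (\<forall>m<\<kappa>. \<forall>n<\<kappa>. (hnorm (ell2 X) ((S' ^^ n) (basis_vec (v m))))\<^sup>2 =
     (LINT t:{0..1}|two_point_measure (\<alpha> m) (root \<kappa> D) 1. t ^ n))"
proof -
  have eq: "((hnorm (ell2 X) ((S' ^^ n) (basis_vec (v m))))\<^sup>2 =
      (LINT t:{0..1}|two_point_measure (\<alpha> m) (root \<kappa> D) 1. t ^ n)) \<longleftrightarrow>
      dn n (vc m) = \<alpha> m + (1 - \<alpha> m) * b ^ n" if "m < \<kappa>" for m n
    using that norm_power_basis_vec[OF vc_in, of n m] by (simp add: moment_eq) (simp add: vc_def)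
  have "subnormal (ell2 X) S'"
    if *: "\<And>m n. \<lbrakk>m < \<kappa>; n < \<kappa>\<rbrakk> \<Longrightarrow> dn n (vc m) = \<alpha> m + (1 - \<alpha> m) * b ^ n"
  proof (rule moments_imp_subnormal, rule dn_extend)
    fix m n assume n: "n < \<kappa>"
    have "m mod \<kappa> < \<kappa>" "vc (m mod \<kappa>) = vc m" using \<kappa>_pos by (simp_all add: vc_def)
    then show "dn n (vc m) = \<alpha> m + (1 - \<alpha> m) * b ^ n"
      using *[of "m mod \<kappa>" n] n \<alpha>_cong[of "m mod \<kappa>" m] by simp
  qed
  then show ?thesis
    using subnormal_imp_moments eq by blast
qed

end

theorem theorem6p2:
  fixes M :: "'a measure" and T :: "'a \<Rightarrow> 'a"
    and \<kappa> :: nat and v :: "nat \<Rightarrow> 'a" and \<R> :: "'a set set"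
  assumes "discrete_measure_space M"
    and "T \<in> space M \<rightarrow> space M"
    and "ess_bounded M (h_fun M T)"
    and "graph_connected (space M) (edges M T)"
    and "one_cycle_type (space M) (edges M T) \<kappa> v \<R>"
    and "\<R> \<noteq> {}"
    and "two_isometric (ell2 (space M)) (shift M T)"
  shows "D_const M T \<kappa> v = (\<Prod>i=0..\<kappa>-1. (c_coeff M T (v i))\<^sup>2) \<and>
    (subnormal (ell2 (space M)) (cauchy_dual (ell2 (space M)) (shift M T)) \<longleftrightarrow>
     (\<forall>m<\<kappa>. \<forall>n<\<kappa>.
        (hnorm (ell2 (space M))
          ((cauchy_dual (ell2 (space M)) (shift M T) ^^ n) (basis_vec (v m))))\<^sup>2 =
        (LINT t:{0..1}|two_point_measure (alpha_const M T \<kappa> v \<R> m)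
            (root \<kappa> (D_const M T \<kappa> v)) 1. t ^ n)))"
proof -
  interpret one_cycle_two_isometry M T \<kappa> v \<R>
    by unfold_locales (fact assms)+
  show ?thesis
    using D_const_eq subnormal_iff_moments by blast
qed

end
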